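(* Let $1<p\le\infty$, $1\le q\le\infty$, $\frac12<\alpha<\frac14\left(5-\frac3p\right)$, $\nu>0$ and $\Omega\in\mathbb R$. There exist two constants $C>0$ and $\varepsilon>0$ such that, for every external force $F\in\dot{FB}^{4-4\alpha-\frac3p}_{p,q}$ with $$\|F\|_{\dot{FB}^{4-4\alpha-\frac3p}_{p,q}}<\frac{\varepsilon\nu}{C},$$ there is a stationary (mild) solution $u\in\dot{FB}^{4-2\alpha-\frac3p}_{p,q}$ of the stationary fractional Navier-Stokes-Coriolis system with external force $F$. Moreover, this solution is unique in the ball $\{u\in\dot{FB}^{4-2\alpha-\frac3p}_{p,q}:\|u\|_{\dot{FB}^{4-2\alpha-\frac3p}_{p,q}}\le2\varepsilon\}$.
   Context: Fourier-Besov spaces on $\mathbb R^3$: fix a radially symmetric $\varphi\in\mathcal S(\mathbb R^3)$ supported in $\{\xi:\frac34\le|\xi|\le\frac83\}$ with $\sum_{j\in\mathbb Z}\varphi(2^{-j}\xi)=1$ for all $\xi\ne0$, and put $\varphi_j(\xi)=\varphi(2^{-j}\xi)$. For $s\in\mathbb R$, $1\le p,q\le\infty$, $\dot{FB}^s_{p,q}$ is the set of $f\in\mathcal S'$ with $\hat f\in L^1_{loc}$ and $\|f\|_{\dot{FB}^s_{p,q}}=\big\|\big(2^{js}\|\varphi_j\hat f\|_{L^p}\big)_{j\in\mathbb Z}\big\|_{\ell^q}<\infty$ (vector-valued versions are understood). The stationary fractional Navier-Stokes-Coriolis system is $\nu(-\Delta)^\alpha u+\Omega e_3\times u+(u\cdot\nabla)u+\nabla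 p=F$, $\mathrm{div}\,u=0$ in $\mathbb R^3$, with $\nu>0$, $\Omega\in\mathbb R$, $e_3=(0,0,1)$. Semigroup: $(S^\alpha_\Omega(t)f)^\wedge(\xi)=e^{-\nu|\xi|^{2\alpha}t}\big[\cos(\Omega\tfrac{\xi_3}{|\xi|}t)\,I_3+\sin(\Omega\tfrac{\xi_3}{|\xi|}t)\,R(\xi)\big]\hat f(\xi)$, where $I_3$ is the identity matrix and $R(\xi)=\frac1{|\xi|}\begin{pmatrix}0&\xi_3&-\xi_2\\-\xi_3&0&\xi_1\\\xi_2&-\xi_1&0\end{pmatrix}$. $\mathbb P$ is the Leray projector, with symbol $\hat{\mathbb P}(\xi)_{mk}=\delta_{mk}-\xi_m\xi_k/|\xi|^2$; $u\otimes u$ has Fourier transform with entries $\hat u_m*\hat u_k$. Stationary (mild) solution: a time-independent $u\in\dot{FB}^{4-2\alpha-\frac3p}_{p,q}$ such that $u=S^\alpha_\Omega(t)u-\int_0^tS^\alpha_\Omega(t-\tau)\mathbb P\nabla\cdot(u\otimes u)\,d\tau+\int_0^tS^\alpha_\Omega(\tau)\mathbb PF\,d\tau$ for every $t>0$; equivalently, $u=-\int_0^\infty S^\alpha_\Omega(\tau)\mathbb P\nabla\cdot(u\otimes u)\,d\tau+\int_0^\infty S^\alpha_\Omega(\tau)\mathbb PF\,d\tau$. All integrals are understood in Fourier variables, for almost every $\xi\in\mathbb R^3$. *)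

theory Defs
  imports "HOL-Analysis.Analysis" "HOL-Probability.Essential_Supremum"
begin

section \<open>Schwartz functions and tempered distributions on three-dimensional space\<close>

definition partial_deriv :: "3 \<Rightarrow> (real^3 \<Rightarrow> complex) \<Rightarrow> real^3 \<Rightarrow> complex" where
  "partial_deriv i \<psi> x = frechet_derivative \<psi> (at x) (axis i 1)"

text \<open>Multi-indices are represented by lists of directions, in order of differentiation.\<close>

definition iterated_deriv :: "3 list \<Rightarrow> (real^3 \<Rightarrow> complex) \<Rightarrow> real^3 \<Rightarrow> complex" where
  "iterated_deriv is \<psi> = foldr partial_deriv is \<psi>"

definition smooth :: "(real^3 \<Rightarrow> complex) \<Rightarrow> bool" where
  "smooth \<psi> \<longleftrightarrow> (\<forall>is x. iterated_deriv is \<psi> differentiable (at x))"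

definition schwartz :: "(real^3 \<Rightarrow> complex) \<Rightarrow> bool" where
  "schwartz \<psi> \<longleftrightarrow> smooth \<psi> \<and>
     (\<forall>n is. bounded (range (\<lambda>x. (1 + norm x) ^ n *\<^sub>R iterated_deriv is \<psi> x)))"

definition test_function :: "(real^3 \<Rightarrow> complex) \<Rightarrow> bool" where
  "test_function \<psi> \<longleftrightarrow> smooth \<psi> \<and> compact (closure {x. \<psi> x \<noteq> 0})"

text \<open>The seminorms below increase with \<^term>\<open>N\<close> and generate the topology of the Schwartz space.
  They are only meaningful on Schwartz functions, where the supremum is over a bounded set.\<close>

definition schwartz_seminorm :: "nat \<Rightarrow> (real^3 \<Rightarrow> complex) \<Rightarrow> real" where
  "schwartz_seminorm N \<psi> =
     (SUP (is, x) \<in> {is. length is \<le> N} \<times> UNIV. (1 + norm x) ^ N * cmod (iterated_deriv is \<psi> x))"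

text \<open>A distribution is a functional on all functions; it is required to vanish off the Schwartz
  space, so that equality of distributions is equality on Schwartz functions.\<close>

type_synonym functional = "(real^3 \<Rightarrow> complex) \<Rightarrow> complex"

definition tempered :: "functional \<Rightarrow> bool" where
  "tempered T \<longleftrightarrow>
     (\<forall>\<psi>. \<not> schwartz \<psi> \<longrightarrow> T \<psi> = 0) \<and>
     (\<forall>a b \<psi> \<theta>. schwartz \<psi> \<longrightarrow> schwartz \<theta> \<longrightarrow> T (\<lambda>x. a * \<psi> x + b * \<theta> x) = a * T \<psi> + b * T \<theta>) \<and>
     (\<exists>C N. \<forall>\<psi>. schwartz \<psi> \<longrightarrow> cmod (T \<psi>) \<le> C * schwartz_seminorm N \<psi>)"

text \<open>The factor in front of the integral is the normalisation for which both the gradient has symbol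
  \<open>i \<xi>\<close> and the transform of a product is the convolution of the transforms, without constants.\<close>

definition fourier :: "(real^3 \<Rightarrow> complex) \<Rightarrow> real^3 \<Rightarrow> complex" where
  "fourier \<psi> \<xi> = complex_of_real (1 / (2 * pi) ^ 3) * (LINT x|lborel. cis (- (x \<bullet> \<xi>)) * \<psi> x)"

definition fourier_dist :: "functional \<Rightarrow> functional" where
  "fourier_dist T = (\<lambda>\<psi>. if schwartz \<psi> then T (fourier \<psi>) else 0)"

definition locally_integrable :: "(real^3 \<Rightarrow> complex) \<Rightarrow> bool" where
  "locally_integrable g \<longleftrightarrow>
     g \<in> borel_measurable borel \<and> (\<forall>K. compact K \<longrightarrow> set_integrable lborel K g)"

definition represents :: "(real^3 \<Rightarrow> complex) \<Rightarrow> functional \<Rightarrow> bool" where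
  "represents g T \<longleftrightarrow> locally_integrable g \<and>
     (\<forall>\<psi>. test_function \<psi> \<longrightarrow> T \<psi> = (LINT \<xi>|lborel. g \<xi> * \<psi> \<xi>))"

text \<open>The Fourier transform of a vector-valued distribution as a function, determined almost
  everywhere when all components of the transform are locally integrable.\<close>

definition fourier_fun :: "functional^3 \<Rightarrow> real^3 \<Rightarrow> complex^3" where
  "fourier_fun f \<xi> = (\<chi> k. (SOME g. represents g (fourier_dist (f $ k))) \<xi>)"

section \<open>Fourier-Besov spaces\<close>

definition ennreal_pow :: "ennreal \<Rightarrow> real \<Rightarrow> ennreal" where
  "ennreal_pow x a = (if x = \<infinity> then \<infinity> else ennreal (enn2real x powr a))"

definition Lp_norm :: "'a measure \<Rightarrow> ennreal \<Rightarrow> ('a \<Rightarrow> ennreal) \<Rightarrow> ennreal" where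
  "Lp_norm M p f =
     (if p = \<infinity> then esssup M f
      else ennreal_pow (\<integral>\<^sup>+ x. ennreal_pow (f x) (enn2real p) \<partial>M) (1 / enn2real p))"

definition dyadic :: "(real^3 \<Rightarrow> complex) \<Rightarrow> int \<Rightarrow> real^3 \<Rightarrow> complex" where
  "dyadic \<phi> j \<xi> = \<phi> ((2 powr (- real_of_int j)) *\<^sub>R \<xi>)"

definition littlewood_paley :: "(real^3 \<Rightarrow> complex) \<Rightarrow> bool" where
  "littlewood_paley \<phi> \<longleftrightarrow> schwartz \<phi> \<and>
     (\<forall>\<xi> \<eta>. norm \<xi> = norm \<eta> \<longrightarrow> \<phi> \<xi> = \<phi> \<eta>) \<and>
     closure {\<xi>. \<phi> \<xi> \<noteq> 0} \<subseteq> {\<xi>. 3/4 \<le> norm \<xi> \<and> norm \<xi> \<le> 8/3} \<and>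
     (\<forall>\<xi>. \<xi> \<noteq> 0 \<longrightarrow> ((\<lambda>j. dyadic \<phi> j \<xi>) has_sum 1) UNIV)"

text \<open>The sequence norm over the integers is the Lebesgue norm for counting measure.\<close>

definition fb_norm ::
  "(real^3 \<Rightarrow> complex) \<Rightarrow> real \<Rightarrow> ennreal \<Rightarrow> ennreal \<Rightarrow> functional^3 \<Rightarrow> ennreal" where
  "fb_norm \<phi> s p q f =
     Lp_norm (count_space UNIV) q
       (\<lambda>j::int. ennreal (2 powr (real_of_int j * s)) *
          Lp_norm lborel p (\<lambda>\<xi>. ennreal (norm (dyadic \<phi> j \<xi> *s fourier_fun f \<xi>))))"

definition fourier_besov ::
  "(real^3 \<Rightarrow> complex) \<Rightarrow> real \<Rightarrow> ennreal \<Rightarrow> ennreal \<Rightarrow> (functional^3) set" where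
  "fourier_besov \<phi> s p q =
     {f. (\<forall>k. tempered (f $ k)) \<and> (\<forall>k. \<exists>g. represents g (fourier_dist (f $ k))) \<and>
         fb_norm \<phi> s p q f < \<infinity>}"

section \<open>The stationary fractional Navier-Stokes-Coriolis system\<close>

definition coriolis_matrix :: "real^3 \<Rightarrow> real^3^3" where
  "coriolis_matrix \<xi> = (1 / norm \<xi>) *\<^sub>R
     vector [vector [0, \<xi>$3, - \<xi>$2],
             vector [- \<xi>$3, 0, \<xi>$1],
             vector [\<xi>$2, - \<xi>$1, 0]]"

definition semigroup_symbol :: "real \<Rightarrow> real \<Rightarrow> real \<Rightarrow> real \<Rightarrow> real^3 \<Rightarrow> complex^3^3" where
  "semigroup_symbol \<nu> \<Omega> \<alpha> t \<xi> = map_matrix complex_of_real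
     (exp (- \<nu> * norm \<xi> powr (2 * \<alpha>) * t) *\<^sub>R
        (cos (\<Omega> * (\<xi>$3 / norm \<xi>) * t) *\<^sub>R mat 1 +
         sin (\<Omega> * (\<xi>$3 / norm \<xi>) * t) *\<^sub>R coriolis_matrix \<xi>))"

definition leray_symbol :: "real^3 \<Rightarrow> complex^3^3" where
  "leray_symbol \<xi> = (\<chi> m k. complex_of_real ((if m = k then 1 else 0) - \<xi>$m * \<xi>$k / (norm \<xi>)\<^sup>2))"

text \<open>The following two are the Fourier transforms of \<open>u \<otimes> u\<close> and of its divergence,
  in terms of the Fourier transform \<open>v\<close> of \<open>u\<close>.\<close>

definition tensor_hat :: "(real^3 \<Rightarrow> complex^3) \<Rightarrow> real^3 \<Rightarrow> complex^3^3" where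
  "tensor_hat v \<xi> = (\<chi> m k. LINT \<eta>|lborel. v (\<xi> - \<eta>) $ m * v \<eta> $ k)"

definition div_tensor_hat :: "(real^3 \<Rightarrow> complex^3) \<Rightarrow> real^3 \<Rightarrow> complex^3" where
  "div_tensor_hat v \<xi> = (\<chi> m. \<Sum>k\<in>UNIV. \<i> * complex_of_real (\<xi>$k) * tensor_hat v \<xi> $ m $ k)"

text \<open>The convolution integrals are required to converge absolutely. The integrands in time are
  continuous for fixed \<open>\<xi>\<close>, so nothing has to be required there.\<close>

definition stationary_mild_solution ::
  "(real^3 \<Rightarrow> complex) \<Rightarrow> ennreal \<Rightarrow> ennreal \<Rightarrow> real \<Rightarrow> real \<Rightarrow> real \<Rightarrow>
   functional^3 \<Rightarrow> functional^3 \<Rightarrow> bool" where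
  "stationary_mild_solution \<phi> p q \<alpha> \<nu> \<Omega> F u \<longleftrightarrow>
     u \<in> fourier_besov \<phi> (4 - 2 * \<alpha> - enn2real (3 / p)) p q \<and>
     (AE \<xi> in lborel. \<forall>m k.
        integrable lborel (\<lambda>\<eta>. fourier_fun u (\<xi> - \<eta>) $ m * fourier_fun u \<eta> $ k)) \<and>
     (\<forall>t>0. AE \<xi> in lborel.
        fourier_fun u \<xi> =
          semigroup_symbol \<nu> \<Omega> \<alpha> t \<xi> *v fourier_fun u \<xi>
          - (LINT \<tau>:{0..t}|lborel. semigroup_symbol \<nu> \<Omega> \<alpha> (t - \<tau>) \<xi> *v
                (leray_symbol \<xi> *v div_tensor_hat (fourier_fun u) \<xi>))
          + (LINT \<tau>:{0..t}|lborel. semigroup_symbol \<nu> \<Omega> \<alpha> \<tau> \<xi> *v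
                (leray_symbol \<xi> *v fourier_fun F \<xi>)))"

end

theory Submission
  imports Defs "HOL-Probability.Characteristic_Functions" "HOL-Probability.Sinc_Integral"
    "HOL-Computational_Algebra.Polynomial"
begin

text \<open>On the Fourier side, the mild equation for all \<open>t > 0\<close> says that \<open>X = S(t) X\<close> for the defect
  \<open>X = u - L (F - div (u \<otimes> u))\<close>, where \<open>L\<close> is the explicit value of \<open>\<integral>\<^sub>0\<^sup>\<infinity> S(\<tau>) P d\<tau>\<close> and is bounded by
  a multiple of \<open>|\<xi>|\<^sup>-\<^sup>2\<^sup>\<alpha> / \<nu>\<close>; since \<open>S(t)\<close> decays, this means \<open>X = 0\<close>. The resulting fixed point equation is
  controlled by the convolution estimate for \<open>|u|\<close> in the Fourier-Besov norm: splitting the convolution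
  at \<open>|\<eta>| \<le> |\<xi> - \<eta>|\<close>, the low frequency factor is integrable because \<open>\<alpha> > 1/2\<close>, and the sum over the
  high frequencies converges because \<open>5 - 4 \<alpha> - 3/p > 0\<close>. The Picard iterates are dominated, together
  with their increments, by the iterates of the scalar equation for absolute values, so they converge
  almost everywhere and dominated convergence identifies the limit. The limit has moderate growth,
  hence it is the Fourier transform of a tempered distribution; distributions are determined by their
  transforms because test functions are dense in the Schwartz space and the Fourier transform is onto.\<close>

section \<open>Smooth functions\<close>

text \<open>One identity makes the exponents close up: with s = 4 - 2\<alpha> - 3/p, the number
  2\<alpha> - 1 equals 3 - 3/p - s, the room left for low frequencies, and it is also the power of
  |\<xi>| by which L outweighs the divergence. So L regains exactly the regularity that the
  convolution loses.

  The estimates use sharp annuli and extended nonnegative norms; the Littlewood-Paley norm of the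
  statement enters only through comparison constants. They are the reason why C and \<epsilon> are
  not the bare constants of the fixed point problem.

  A pointwise scalar majorant, instead of a contraction in the Fourier-Besov space, asks for no
  completeness of that space: the limit is found at almost every frequency, and monotone convergence
  bounds its norm.

  The transform \<open>fourier_fun\<close> is a chosen representative, known up to null sets. A
  fixed point is therefore first a function, then a distribution, then the chosen representative of
  its transform, and each passage has to preserve the equation and the norm. Uniqueness concerns
  functionals, so equality almost everywhere of transforms must be lifted back.\<close>

lemma partial_deriv_eq:
  assumes "(f has_derivative D) (at x)"
  shows "partial_deriv i f x = D (axis i 1)"
  using frechet_derivative_at[OF assms] by (simp add: partial_deriv_def)

lemma iterated_deriv_Nil [simp]: "iterated_deriv [] f = f"
  and iterated_deriv_Cons [simp]: "iterated_deriv (i # is) f = partial_deriv i (iterated_deriv is f)"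
  by (simp_all add: iterated_deriv_def)

lemma iterated_deriv_snoc: "iterated_deriv (is @ [i]) f = iterated_deriv is (partial_deriv i f)"
  by (simp add: iterated_deriv_def)

lemma smooth_differentiable: "smooth f \<Longrightarrow> f differentiable (at x)"
  unfolding smooth_def by (metis iterated_deriv_Nil)

lemma smooth_partial_deriv: "smooth f \<Longrightarrow> smooth (partial_deriv i f)"
  unfolding smooth_def by (metis iterated_deriv_snoc)

lemma smooth_iterated_deriv: "smooth f \<Longrightarrow> smooth (iterated_deriv is f)"
  by (induction "is") (auto intro: smooth_partial_deriv)

text \<open>By induction every iterated derivative stays in the invariant class \<open>S\<close>.
  Suitable classes are the profiles in \<open>smooth_bump\<close> or the transforms of Schwartz
  functions, so that no formula for higher derivatives has to be found.\<close>

lemma smooth_coinduct: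
  assumes "f \<in> S" and "\<And>g x. g \<in> S \<Longrightarrow> g differentiable (at x)"
    and "\<And>g i. g \<in> S \<Longrightarrow> partial_deriv i g \<in> S"
  shows "smooth f"
proof -
  have "iterated_deriv is f \<in> S" for "is" by (induction "is") (auto simp: assms)
  then show ?thesis using assms(2) by (auto simp: smooth_def)
qed

lemma smooth_if_partials:
  assumes "\<And>x. f differentiable (at x)" "\<And>i. smooth (partial_deriv i f)"
  shows "smooth f"
proof -
  have "iterated_deriv is f differentiable (at x)" for "is" x
    using assms by (cases "is" rule: rev_cases) (auto simp: iterated_deriv_snoc smooth_def)
  then show ?thesis by (simp add: smooth_def)
qed

lemma smooth_continuous: "smooth f \<Longrightarrow> continuous_on A f"
  using smooth_differentiable continuous_at_imp_continuous_on differentiable_imp_continuous_within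
  by blast

lemma smooth_measurable: "smooth f \<Longrightarrow> f \<in> borel_measurable borel"
  by (intro borel_measurable_continuous_onI smooth_continuous)

lemma partial_deriv_add:
  assumes "\<And>x. f differentiable (at x)" "\<And>x. g differentiable (at x)"
  shows "partial_deriv i (\<lambda>x. f x + g x) = (\<lambda>x. partial_deriv i f x + partial_deriv i g x)"
proof
  fix x
  have "((\<lambda>x. f x + g x) has_derivative
      (\<lambda>h. frechet_derivative f (at x) h + frechet_derivative g (at x) h)) (at x)"
    using assms by (intro has_derivative_add) (auto simp: frechet_derivative_works)
  from partial_deriv_eq[OF this]
  show "partial_deriv i (\<lambda>x. f x + g x) x = partial_deriv i f x + partial_deriv i g x"
    by (simp add: partial_deriv_def)
qed

lemma partial_deriv_mult:
  assumes "f differentiable (at x)" "g differentiable (at x)"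
  shows "partial_deriv i (\<lambda>x. f x * g x) x = partial_deriv i f x * g x + f x * partial_deriv i g x"
proof -
  have "((\<lambda>x. f x * g x) has_derivative
      (\<lambda>h. f x * frechet_derivative g (at x) h + frechet_derivative f (at x) h * g x)) (at x)"
    using assms by (intro has_derivative_mult) (auto simp: frechet_derivative_works)
  from partial_deriv_eq[OF this] show ?thesis by (simp add: partial_deriv_def add.commute)
qed

lemma partial_deriv_const [simp]: "partial_deriv i (\<lambda>x. c) = (\<lambda>x. 0)"
  by (auto simp: fun_eq_iff intro!: partial_deriv_eq[where D = "\<lambda>_. 0"])

lemma smooth_const [simp]: "smooth (\<lambda>x. c)"
  by (rule smooth_coinduct[where S = "range (\<lambda>c x. c)"]) auto

text \<open>Differentiability of finite order exists for the sake of the product rule. The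
  derivative of a product is a sum of two products, so products alone form no class closed under
  derivatives, whereas induction on the order only asks for sums and products one order
  lower.\<close>

primrec smooth_upto :: "nat \<Rightarrow> (real^3 \<Rightarrow> complex) \<Rightarrow> bool" where
  "smooth_upto 0 f \<longleftrightarrow> True"
| "smooth_upto (Suc n) f \<longleftrightarrow>
     (\<forall>x. f differentiable (at x)) \<and> (\<forall>i. smooth_upto n (partial_deriv i f))"

lemma smooth_iff_upto: "smooth f \<longleftrightarrow> (\<forall>n. smooth_upto n f)"
proof
  show "\<forall>n. smooth_upto n f" if "smooth f"
  proof
    show "smooth_upto n f" for n using that
      by (induction n arbitrary: f) (auto intro: smooth_partial_deriv smooth_differentiable)
  qed
next
  have "smooth_upto (Suc (length is)) g \<Longrightarrow> iterated_deriv is g differentiable (at x)" for g "is" x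
    by (induction "is" arbitrary: g rule: rev_induct) (auto simp: iterated_deriv_snoc)
  then show "\<forall>n. smooth_upto n f \<Longrightarrow> smooth f" unfolding smooth_def by blast
qed

lemma smooth_upto_Suc: "smooth_upto (Suc n) f \<Longrightarrow> smooth_upto n f"
  by (induction n arbitrary: f) auto

lemma smooth_upto_add: "smooth_upto n f \<Longrightarrow> smooth_upto n g \<Longrightarrow> smooth_upto n (\<lambda>x. f x + g x)"
proof (induction n arbitrary: f g)
  case (Suc n)
  have "partial_deriv i (\<lambda>x. f x + g x) = (\<lambda>x. partial_deriv i f x + partial_deriv i g x)" for i
    using Suc.prems by (intro partial_deriv_add) auto
  then show ?case using Suc by (auto intro: differentiable_add)
qed simp

lemma smooth_upto_mult: "smooth_upto n f \<Longrightarrow> smooth_upto n g \<Longrightarrow> smooth_upto n (\<lambda>x. f x * g x)"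
proof (induction n arbitrary: f g)
  case (Suc n)
  have "partial_deriv i (\<lambda>x. f x * g x) =
      (\<lambda>x. partial_deriv i f x * g x + f x * partial_deriv i g x)" for i
    using Suc.prems by (auto simp: fun_eq_iff partial_deriv_mult)
  moreover have "smooth_upto n f" "smooth_upto n g" using Suc.prems smooth_upto_Suc by blast+
  ultimately show ?case using Suc by (auto intro!: differentiable_mult smooth_upto_add)
qed simp

lemma smooth_add: "smooth f \<Longrightarrow> smooth g \<Longrightarrow> smooth (\<lambda>x. f x + g x)"
  by (simp add: smooth_iff_upto smooth_upto_add)

lemma smooth_mult: "smooth f \<Longrightarrow> smooth g \<Longrightarrow> smooth (\<lambda>x. f x * g x)"
  by (simp add: smooth_iff_upto smooth_upto_mult)

lemma smooth_prod: "(\<And>i. i \<in> A \<Longrightarrow> smooth (f i)) \<Longrightarrow> smooth (\<lambda>x. \<Prod>i\<in>A. f i x)"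
  by (induction A rule: infinite_finite_induct) (auto intro: smooth_mult)

lemma partial_deriv_cmult:
  assumes "smooth f"
  shows "partial_deriv i (\<lambda>x. c * f x) = (\<lambda>x. c * partial_deriv i f x)"
  using partial_deriv_mult[of "\<lambda>_. c"] smooth_differentiable[OF assms] by (auto simp: fun_eq_iff)

lemma iterated_deriv_add:
  assumes "smooth f" "smooth g"
  shows "iterated_deriv is (\<lambda>x. f x + g x) = (\<lambda>x. iterated_deriv is f x + iterated_deriv is g x)"
  using assms by (induction "is") (simp_all add: partial_deriv_add smooth_iterated_deriv smooth_differentiable)

lemma iterated_deriv_cmult:
  assumes "smooth f"
  shows "iterated_deriv is (\<lambda>x. c * f x) = (\<lambda>x. c * iterated_deriv is f x)"
  using assms by (induction "is") (simp_all add: partial_deriv_cmult smooth_iterated_deriv)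

section \<open>Coordinate functions and dilations\<close>

lemma has_derivative_coord:
  "((\<lambda>x. complex_of_real (x $ i)) has_derivative (\<lambda>h. complex_of_real (h $ i))) (at x)"
  by (intro bounded_linear_imp_has_derivative bounded_linear_compose[OF bounded_linear_of_real]
      bounded_linear_vec_nth)

lemma partial_deriv_coord:
  "partial_deriv j (\<lambda>x. complex_of_real (x $ i)) = (\<lambda>x. if i = j then 1 else 0)"
  using partial_deriv_eq[OF has_derivative_coord] by (auto simp: fun_eq_iff axis_def)

lemma smooth_coord: "smooth (\<lambda>x. complex_of_real (x $ i))"
proof -
  have "smooth (partial_deriv j (\<lambda>x. complex_of_real (x $ i)))" for j
    unfolding partial_deriv_coord by simp
  moreover have "(\<lambda>x. complex_of_real (x $ i)) differentiable (at x)" for x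
    using has_derivative_coord by (auto simp: differentiable_def)
  ultimately show ?thesis by (metis smooth_if_partials)
qed

lemma
  assumes "smooth f"
  shows partial_deriv_scale:
      "partial_deriv i (\<lambda>x. f (c *\<^sub>R x)) = (\<lambda>x. c *\<^sub>R partial_deriv i f (c *\<^sub>R x))" (is ?d)
    and scale_differentiable: "(\<lambda>x. f (c *\<^sub>R x)) differentiable (at x)"
proof -
  have D: "((\<lambda>x. f (c *\<^sub>R x)) has_derivative
      (\<lambda>h. frechet_derivative f (at (c *\<^sub>R x)) (c *\<^sub>R h))) (at x)" for x
  proof -
    have A: "((\<lambda>x. c *\<^sub>R x) has_derivative (\<lambda>h. c *\<^sub>R h)) (at x)"
      by (intro has_derivative_scaleR_right has_derivative_ident)
    have B: "(f has_derivative frechet_derivative f (at (c *\<^sub>R x))) (at (c *\<^sub>R x))"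
      using smooth_differentiable[OF assms] by (simp add: frechet_derivative_works)
    show ?thesis by (rule has_derivative_compose[OF A B])
  qed
  then show "(\<lambda>x. f (c *\<^sub>R x)) differentiable (at x)" by (auto simp: differentiable_def)
  have "linear (frechet_derivative f (at y))" for y
    using smooth_differentiable[OF assms] linear_frechet_derivative by blast
  then show ?d
    using partial_deriv_eq[OF D] by (auto simp: fun_eq_iff partial_deriv_def linear_scale)
qed

lemma iterated_deriv_scale:
  assumes "smooth f"
  shows "iterated_deriv is (\<lambda>x. f (c *\<^sub>R x)) =
    (\<lambda>x. c ^ length is *\<^sub>R iterated_deriv is f (c *\<^sub>R x))"
proof (induction "is")
  case (Cons i "is")
  have S: "smooth (iterated_deriv is f)" by (rule smooth_iterated_deriv[OF assms])
  have "((\<lambda>x. c ^ length is *\<^sub>R iterated_deriv is f (c *\<^sub>R x)) has_derivative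
      (\<lambda>h. c ^ length is *\<^sub>R frechet_derivative (\<lambda>x. iterated_deriv is f (c *\<^sub>R x)) (at x) h)) (at x)" for x
    using scale_differentiable[OF S]
    by (intro has_derivative_scaleR_right) (auto simp: frechet_derivative_works)
  from partial_deriv_eq[OF this] show ?case
    using partial_deriv_scale[OF S, of i c]
    by (auto simp: fun_eq_iff Cons partial_deriv_def mult.commute)
qed simp

lemma smooth_scale:
  assumes "smooth f"
  shows "smooth (\<lambda>x. f (c *\<^sub>R x))"
  unfolding smooth_def iterated_deriv_scale[OF assms]
  by (intro allI differentiable_scaleR differentiable_const scale_differentiable
      smooth_iterated_deriv assms)

section \<open>Schwartz functions\<close>

lemma schwartz_smooth: "schwartz f \<Longrightarrow> smooth f"
  by (simp add: schwartz_def)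

lemma schwartz_bound:
  assumes "schwartz f"
  shows "\<exists>B. \<forall>x. (1 + norm x) ^ n * cmod (iterated_deriv is f x) \<le> B"
proof -
  have "bounded (range (\<lambda>x. (1 + norm x) ^ n *\<^sub>R iterated_deriv is f x))"
    using assms by (simp add: schwartz_def)
  then obtain B where "\<forall>x. norm ((1 + norm x) ^ n *\<^sub>R iterated_deriv is f x) \<le> B"
    unfolding bounded_iff by blast
  then show ?thesis by (intro exI[of _ B]) simp
qed

lemma schwartzI:
  assumes "smooth f" and "\<And>n is. \<exists>B. \<forall>x. (1 + norm x) ^ n * cmod (iterated_deriv is f x) \<le> B"
  shows "schwartz f"
proof -
  have "bounded (range (\<lambda>x. (1 + norm x) ^ n *\<^sub>R iterated_deriv is f x))" for n "is"
  proof -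
    obtain B where "\<And>x. (1 + norm x) ^ n * cmod (iterated_deriv is f x) \<le> B" using assms(2) by blast
    then show ?thesis unfolding bounded_iff by (intro exI[of _ B]) simp
  qed
  then show ?thesis using assms(1) by (simp add: schwartz_def)
qed

section \<open>Schwartz seminorms and estimates by them\<close>

lemma finite_lists_le: "finite {is :: 3 list. length is \<le> N}"
  using finite_lists_length_le[of "UNIV :: 3 set" N] by simp

lemma seminorm_bdd:
  assumes "schwartz f"
  shows "bdd_above ((\<lambda>(is, x). (1 + norm x) ^ N * cmod (iterated_deriv is f x)) `
    ({is. length is \<le> N} \<times> UNIV))"
proof -
  obtain B where B: "\<And>is x. (1 + norm x) ^ N * cmod (iterated_deriv is f x) \<le> B is"
    using schwartz_bound[OF assms, of N] by metis
  have "(1 + norm x) ^ N * cmod (iterated_deriv is f x) \<le> Max (B ` {is. length is \<le> N})"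
    if "length is \<le> N" for "is" x
    using that finite_lists_le by (intro order_trans[OF B Max_ge]) auto
  then show ?thesis by (intro bdd_aboveI2[where M = "Max (B ` {is. length is \<le> N})"]) auto
qed

lemma seminorm_upper:
  assumes "schwartz f" "n \<le> N" "length is \<le> N"
  shows "(1 + norm x) ^ n * cmod (iterated_deriv is f x) \<le> schwartz_seminorm N f"
proof -
  have "(1 + norm x) ^ n * cmod (iterated_deriv is f x) \<le> (1 + norm x) ^ N * cmod (iterated_deriv is f x)"
    using assms by (intro mult_right_mono power_increasing) auto
  also have "\<dots> \<le> schwartz_seminorm N f"
    using cSUP_upper[OF _ seminorm_bdd[OF assms(1), of N], of "(is, x)"] assms
    by (simp add: schwartz_seminorm_def)
  finally show ?thesis .
qed

lemma seminorm_least: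
  assumes "\<And>is x. length is \<le> N \<Longrightarrow> (1 + norm x) ^ N * cmod (iterated_deriv is f x) \<le> B"
  shows "schwartz_seminorm N f \<le> B"
  unfolding schwartz_seminorm_def using assms by (intro cSUP_least) (auto intro!: exI[of _ "[]"])

lemma seminorm_nonneg: "schwartz f \<Longrightarrow> 0 \<le> schwartz_seminorm N f"
  using seminorm_upper[of f 0 N "[]" 0] by (auto intro: order_trans[OF norm_ge_zero])

lemma seminorm_mono: "schwartz f \<Longrightarrow> N \<le> M \<Longrightarrow> schwartz_seminorm N f \<le> schwartz_seminorm M f"
  by (intro seminorm_least seminorm_upper) auto


text \<open>The index type is free so that a single calculus of estimates covers quantities at a
  point \<open>x\<close> and, over \<open>unit\<close>, numbers such as seminorms. One seminorm is
  enough as a bound because the seminorms increase with \<open>N\<close>.\<close>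

definition seminorm_dominated :: "((real^3 \<Rightarrow> complex) \<Rightarrow> 'x \<Rightarrow> real) \<Rightarrow> bool" where
  "seminorm_dominated Q \<longleftrightarrow> (\<exists>C N. 0 \<le> C \<and> (\<forall>f x. schwartz f \<longrightarrow> Q f x \<le> C * schwartz_seminorm N f))"

lemma dominatedI:
  assumes "\<And>f x. schwartz f \<Longrightarrow> Q f x \<le> C * schwartz_seminorm N f"
  shows "seminorm_dominated Q"
  unfolding seminorm_dominated_def
proof (intro exI[of _ "max C 0"] exI[of _ N] conjI allI impI)
  fix f :: "real^3 \<Rightarrow> complex" and x assume f: "schwartz f"
  have "Q f x \<le> C * schwartz_seminorm N f" by (rule assms[OF f])
  also have "\<dots> \<le> max C 0 * schwartz_seminorm N f"
    using seminorm_nonneg[OF f] by (intro mult_right_mono) auto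
  finally show "Q f x \<le> max C 0 * schwartz_seminorm N f" .
qed simp

lemma dominated_mono:
  assumes "seminorm_dominated Q" "\<And>f x. schwartz f \<Longrightarrow> \<exists>y. P f x \<le> Q f y"
  shows "seminorm_dominated P"
  using assms unfolding seminorm_dominated_def by (metis order_trans)

lemma dominated_add:
  assumes "seminorm_dominated P" "seminorm_dominated Q"
  shows "seminorm_dominated (\<lambda>f x. P f x + Q f x)"
proof -
  from assms obtain C N D M where C: "0 \<le> C" "\<And>f x. schwartz f \<Longrightarrow> P f x \<le> C * schwartz_seminorm N f"
    and D: "0 \<le> D" "\<And>f x. schwartz f \<Longrightarrow> Q f x \<le> D * schwartz_seminorm M f"
    unfolding seminorm_dominated_def by metis
  show ?thesis
  proof (rule dominatedI)
    fix f :: "real^3 \<Rightarrow> complex" and x assume f: "schwartz f"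
    have "P f x \<le> C * schwartz_seminorm (max N M) f" "Q f x \<le> D * schwartz_seminorm (max N M) f"
      using C D f seminorm_mono[OF f, of N "max N M"] seminorm_mono[OF f, of M "max N M"]
      by (meson max.cobounded1 max.cobounded2 mult_left_mono order_trans)+
    then show "P f x + Q f x \<le> (C + D) * schwartz_seminorm (max N M) f"
      by (simp add: distrib_right)
  qed
qed

lemma dominated_cmult:
  assumes "seminorm_dominated P" "0 \<le> c"
  shows "seminorm_dominated (\<lambda>f x. c * P f x)"
proof -
  from assms obtain C N where C: "0 \<le> C" "\<And>f x. schwartz f \<Longrightarrow> P f x \<le> C * schwartz_seminorm N f"
    unfolding seminorm_dominated_def by metis
  then show ?thesis
    using assms(2) by (intro dominatedI[where C = "c * C" and N = N]) (simp add: mult.assoc mult_left_mono)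
qed

lemma dominated_sum:
  assumes "finite A" "\<And>i. i \<in> A \<Longrightarrow> seminorm_dominated (P i)"
  shows "seminorm_dominated (\<lambda>f x. \<Sum>i\<in>A. P i f x)"
  using assms
  by (induction A) (auto intro!: dominated_add dominatedI[where C = 0 and Q = "\<lambda>_ _. 0"])

lemma dominated_deriv: "seminorm_dominated (\<lambda>f x. (1 + norm x) ^ n * cmod (iterated_deriv is f x))"
  by (rule dominatedI[where C = 1 and N = "max n (length is)"]) (auto intro: seminorm_upper)

text \<open>For linear \<open>A\<close> this is continuity in the Schwartz topology; linearity is
  left out because the estimates compose without it. The index over \<open>unit\<close> is a
  dummy.\<close>

definition schwartz_continuous :: "((real^3 \<Rightarrow> complex) \<Rightarrow> real^3 \<Rightarrow> complex) \<Rightarrow> bool" where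
  "schwartz_continuous A \<longleftrightarrow> (\<forall>f. schwartz f \<longrightarrow> schwartz (A f)) \<and>
     (\<forall>N. seminorm_dominated (\<lambda>f (x::unit). schwartz_seminorm N (A f)))"

lemma dominated_compose:
  assumes "seminorm_dominated Q" "schwartz_continuous A"
  shows "seminorm_dominated (\<lambda>f. Q (A f))"
proof -
  obtain C N where C: "0 \<le> C" "\<And>f x. schwartz f \<Longrightarrow> Q f x \<le> C * schwartz_seminorm N f"
    using assms(1) unfolding seminorm_dominated_def by metis
  have "seminorm_dominated (\<lambda>f (x::unit). schwartz_seminorm N (A f))"
    using assms(2) by (auto simp: schwartz_continuous_def)
  from dominated_cmult[OF this C(1)] show ?thesis
    by (rule dominated_mono) (use C(2) assms(2) in \<open>auto simp: schwartz_continuous_def\<close>)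
qed

text \<open>A seminorm of \<open>A f\<close> is a supremum over points and over finitely many lists
  of directions. For each list the supremum over points inherits the pointwise bound, and the sum
  over the lists, again dominated, stands in for their maximum.\<close>

lemma schwartz_continuousI:
  assumes S: "\<And>f. schwartz f \<Longrightarrow> smooth (A f)"
    and D: "\<And>n is. seminorm_dominated (\<lambda>f x. (1 + norm x) ^ n * cmod (iterated_deriv is (A f) x))"
  shows "schwartz_continuous A"
  unfolding schwartz_continuous_def
proof (intro conjI allI impI)
  show "schwartz (A f)" if "schwartz f" for f
  proof (rule schwartzI[OF S[OF that]])
    fix n "is"
    obtain C N where "\<And>f x. schwartz f \<Longrightarrow>
        (1 + norm x) ^ n * cmod (iterated_deriv is (A f) x) \<le> C * schwartz_seminorm N f"
      using D[of n "is"] unfolding seminorm_dominated_def by metis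
    then show "\<exists>B. \<forall>x. (1 + norm x) ^ n * cmod (iterated_deriv is (A f) x) \<le> B"
      using that by blast
  qed
  fix N
  define P :: "3 list \<Rightarrow> (real^3 \<Rightarrow> complex) \<Rightarrow> unit \<Rightarrow> real" where
    "P is f u = (SUP x. (1 + norm x) ^ N * cmod (iterated_deriv is (A f) x))" for "is" f u
  have bd: "\<exists>B. \<forall>x. (1 + norm x) ^ N * cmod (iterated_deriv is (A f) x) \<le> B" if "schwartz f" for f "is"
    using that D[of N "is"] unfolding seminorm_dominated_def by metis
  have "seminorm_dominated (P is)" for "is"
  proof -
    obtain C M where "\<And>f x. schwartz f \<Longrightarrow>
        (1 + norm x) ^ N * cmod (iterated_deriv is (A f) x) \<le> C * schwartz_seminorm M f"
      using D[of N "is"] unfolding seminorm_dominated_def by metis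
    then show ?thesis unfolding P_def by (intro dominatedI[where C = C and N = M] cSUP_least) auto
  qed
  then have "seminorm_dominated (\<lambda>f u. \<Sum>is | length is \<le> N. P is f u)"
    by (intro dominated_sum finite_lists_le)
  then show "seminorm_dominated (\<lambda>f (x::unit). schwartz_seminorm N (A f))"
  proof (rule dominated_mono)
    fix f :: "real^3 \<Rightarrow> complex" and u :: unit assume f: "schwartz f"
    have up: "(1 + norm x) ^ N * cmod (iterated_deriv is (A f) x) \<le> P is f u" for "is" x u
      unfolding P_def using bd[OF f, of "is"] by (intro cSUP_upper) (auto simp: bdd_above_def)
    have nn: "0 \<le> P is f u" for "is" u by (rule order_trans[OF _ up[of 0]]) auto
    show "\<exists>y. schwartz_seminorm N (A f) \<le> (\<Sum>is | length is \<le> N. P is f y)"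
    proof (intro exI[of _ u] seminorm_least)
      fix "is" x assume "length (is :: 3 list) \<le> N"
      then have "P is f u \<le> (\<Sum>is | length is \<le> N. P is f u)"
        by (intro member_le_sum) (auto simp: nn finite_lists_le)
      with up[of x "is" u]
      show "(1 + norm x) ^ N * cmod (iterated_deriv is (A f) x) \<le> (\<Sum>is | length is \<le> N. P is f u)"
        by linarith
    qed
  qed
qed

section \<open>Operations on the Schwartz space\<close>

lemma schwartz_continuous_partial: "schwartz_continuous (partial_deriv i)"
proof (rule schwartz_continuousI)
  show "seminorm_dominated (\<lambda>f x. (1 + norm x) ^ n * cmod (iterated_deriv is (partial_deriv i f) x))" for n "is"
    using dominated_deriv[of n "is @ [i]"] by (simp add: iterated_deriv_snoc)
qed (auto intro: smooth_partial_deriv schwartz_smooth)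

lemma schwartz_partial: "schwartz f \<Longrightarrow> schwartz (partial_deriv i f)"
  using schwartz_continuous_partial by (auto simp: schwartz_continuous_def)

text \<open>The induction removes the innermost derivative. There the product rule gives
  \<open>f\<close> itself when the directions agree, plus the coordinate times a partial derivative
  of \<open>f\<close>, and the induction hypothesis reaches that derivative through
  \<open>dominated_compose\<close>.\<close>

lemma coord_dominated: "seminorm_dominated
  (\<lambda>f x. (1 + norm x) ^ n * cmod (iterated_deriv is (\<lambda>x. complex_of_real (x $ i) * f x) x))"
proof (induction "is" rule: rev_induct)
  case Nil
  show ?case
  proof (rule dominated_mono[OF dominated_deriv[of "Suc n" "[]"]])
    fix f :: "real^3 \<Rightarrow> complex" and x :: "real^3"
    have "\<bar>x $ i\<bar> \<le> 1 + norm x" using component_le_norm_cart[of x i] by linarith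
    then have "(1 + norm x) ^ n * (\<bar>x $ i\<bar> * cmod (f x)) \<le> (1 + norm x) ^ n * ((1 + norm x) * cmod (f x))"
      by (intro mult_left_mono mult_right_mono) auto
    then show "\<exists>y. (1 + norm x) ^ n * cmod (iterated_deriv [] (\<lambda>x. complex_of_real (x $ i) * f x) x)
        \<le> (1 + norm y) ^ Suc n * cmod (iterated_deriv [] f y)"
      by (intro exI[of _ x]) (simp add: norm_mult mult_ac)
  qed
next
  case (snoc j "is")
  let ?Q = "\<lambda>f x. (1 + norm x) ^ n * cmod (iterated_deriv is (\<lambda>x. complex_of_real (x $ i) * f x) x)"
  show ?case
  proof (rule dominated_mono[OF dominated_add[OF dominated_deriv[of n "is"]
        dominated_compose[OF snoc schwartz_continuous_partial[of j]]]])
    fix f :: "real^3 \<Rightarrow> complex" and x :: "real^3" assume f: "schwartz f"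
    note fs = schwartz_smooth[OF f]
    have "partial_deriv j (\<lambda>x. complex_of_real (x $ i) * f x) =
        (\<lambda>x. (if i = j then 1 else 0) * f x + complex_of_real (x $ i) * partial_deriv j f x)"
      using smooth_coord smooth_differentiable fs
      by (auto simp: fun_eq_iff partial_deriv_mult partial_deriv_coord)
    then have "iterated_deriv (is @ [j]) (\<lambda>x. complex_of_real (x $ i) * f x) =
      (\<lambda>x. (if i = j then 1 else 0) * iterated_deriv is f x +
        iterated_deriv is (\<lambda>x. complex_of_real (x $ i) * partial_deriv j f x) x)"
      by (simp add: iterated_deriv_snoc iterated_deriv_add iterated_deriv_cmult fs smooth_mult
          smooth_coord smooth_partial_deriv)
    then have "cmod (iterated_deriv (is @ [j]) (\<lambda>x. complex_of_real (x $ i) * f x) x) \<le>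
       cmod (iterated_deriv is f x) +
       cmod (iterated_deriv is (\<lambda>x. complex_of_real (x $ i) * partial_deriv j f x) x)"
      by (auto intro!: order_trans[OF norm_triangle_ineq])
    then have "(1 + norm x) ^ n * cmod (iterated_deriv (is @ [j]) (\<lambda>x. complex_of_real (x $ i) * f x) x) \<le>
       (1 + norm x) ^ n * (cmod (iterated_deriv is f x) +
       cmod (iterated_deriv is (\<lambda>x. complex_of_real (x $ i) * partial_deriv j f x) x))"
      by (intro mult_left_mono) auto
    then show "\<exists>y. (1 + norm x) ^ n * cmod (iterated_deriv (is @ [j]) (\<lambda>x. complex_of_real (x $ i) * f x) x)
      \<le> (1 + norm y) ^ n * cmod (iterated_deriv is f y) + ?Q (partial_deriv j f) y"
      by (intro exI[of _ x]) (simp add: algebra_simps)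
  qed
qed

lemma schwartz_continuous_coord: "schwartz_continuous (\<lambda>f x. complex_of_real (x $ i) * f x)"
  by (intro schwartz_continuousI coord_dominated smooth_mult smooth_coord schwartz_smooth)

lemma schwartz_coord: "schwartz f \<Longrightarrow> schwartz (\<lambda>x. complex_of_real (x $ i) * f x)"
  using schwartz_continuous_coord[of i] unfolding schwartz_continuous_def by blast

lemma schwartz_add:
  assumes "schwartz f" "schwartz g"
  shows "schwartz (\<lambda>x. f x + g x)"
proof (rule schwartzI)
  show "smooth (\<lambda>x. f x + g x)" using assms by (intro smooth_add schwartz_smooth)
  fix n and "is" :: "3 list"
  let ?N = "max n (length is)"
  have "(1 + norm x) ^ n * cmod (iterated_deriv is (\<lambda>x. f x + g x) x)
      \<le> schwartz_seminorm ?N f + schwartz_seminorm ?N g" for x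
  proof -
    have "(1 + norm x) ^ n * cmod (iterated_deriv is (\<lambda>x. f x + g x) x) \<le>
      (1 + norm x) ^ n * (cmod (iterated_deriv is f x) + cmod (iterated_deriv is g x))"
      using assms by (intro mult_left_mono) (auto simp: iterated_deriv_add schwartz_smooth norm_triangle_ineq)
    then show ?thesis
      using seminorm_upper[OF assms(1), of n ?N "is" x] seminorm_upper[OF assms(2), of n ?N "is" x]
      by (simp add: distrib_left)
  qed
  then show "\<exists>B. \<forall>x. (1 + norm x) ^ n * cmod (iterated_deriv is (\<lambda>x. f x + g x) x) \<le> B" by blast
qed

lemma schwartz_cmult:
  assumes "schwartz f"
  shows "schwartz (\<lambda>x. c * f x)"
proof (rule schwartzI)
  show "smooth (\<lambda>x. c * f x)" using assms by (intro smooth_mult smooth_const schwartz_smooth)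
  fix n and "is" :: "3 list"
  let ?N = "max n (length is)"
  have "(1 + norm x) ^ n * cmod (iterated_deriv is (\<lambda>x. c * f x) x)
      \<le> cmod c * schwartz_seminorm ?N f" for x
    using mult_left_mono[OF seminorm_upper[OF assms(1), of n ?N "is" x], of "cmod c"] assms
    by (simp add: iterated_deriv_cmult schwartz_smooth norm_mult mult_ac)
  then show "\<exists>B. \<forall>x. (1 + norm x) ^ n * cmod (iterated_deriv is (\<lambda>x. c * f x) x) \<le> B" by blast
qed

section \<open>The Fourier transform on the Schwartz space\<close>

text \<open>The exponent 6 is twice the dimension: each of the three factors
  \<open>1 + (x \<bullet> b)\<^sup>2\<close> is at most \<open>(1 + norm x)\<^sup>2\<close>, and the
  inverse of their product integrates as a product of Cauchy densities on the line.\<close>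

lemma decay_integrable: "integrable lborel (\<lambda>x::real^3. 1 / (1 + norm x) ^ 6)"
proof (rule integrableI_bounded)
  have "(\<integral>\<^sup>+(x::real^3). ennreal (norm (1 / (1 + norm x) ^ 6)) \<partial>lborel)
      \<le> (\<integral>\<^sup>+(x::real^3). (\<Prod>b\<in>Basis. ennreal (inverse (1 + (x \<bullet> b)\<^sup>2))) \<partial>lborel)"
  proof (rule nn_integral_mono)
    fix x :: "real^3"
    have "(\<Prod>b\<in>Basis. 1 + (x \<bullet> b)\<^sup>2) \<le> (\<Prod>b\<in>(Basis :: (real^3) set). (1 + norm x)\<^sup>2)"
    proof (intro prod_mono conjI)
      fix b :: "real^3" assume "b \<in> Basis"
      then have "(x \<bullet> b)\<^sup>2 \<le> (norm x)\<^sup>2" by (metis Basis_le_norm abs_le_square_iff abs_norm_cancel)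
      then show "1 + (x \<bullet> b)\<^sup>2 \<le> (1 + norm x)\<^sup>2"
        using norm_ge_zero[of x] by (simp add: power2_sum del: norm_ge_zero)
    qed auto
    also have "\<dots> = (1 + norm x) ^ 6" by (simp flip: power_mult)
    finally have "1 / (1 + norm x) ^ 6 \<le> 1 / (\<Prod>b\<in>Basis. 1 + (x \<bullet> b)\<^sup>2)"
      by (intro divide_left_mono mult_pos_pos prod_pos zero_less_power add_pos_nonneg) auto
    then show "ennreal (norm (1 / (1 + norm x) ^ 6)) \<le> (\<Prod>b\<in>Basis. ennreal (inverse (1 + (x \<bullet> b)\<^sup>2)))"
      by (subst prod_ennreal) (auto intro!: ennreal_leI simp: prod_inversef[symmetric] inverse_eq_divide prod_dividef)
  qed
  also have "\<dots> = (\<Prod>b\<in>(Basis :: (real^3) set). \<integral>\<^sup>+x. ennreal (inverse (1 + x\<^sup>2)) \<partial>lborel)"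
    by (rule nn_integral_lborel_prod[where f = "\<lambda>b x. ennreal (inverse (1 + x\<^sup>2))"]) auto
  also have "\<dots> < \<infinity>"
  proof -
    have "integrable lborel (\<lambda>x::real. inverse (1 + x\<^sup>2))"
      using integrable_inverse_1_plus_square by (simp add: set_integrable_def einterval_def)
    then have "(\<integral>\<^sup>+(x::real). ennreal (inverse (1 + x\<^sup>2)) \<partial>lborel) < \<infinity>"
      by (auto simp: integrable_iff_bounded)
    then show ?thesis by (auto simp: power_less_top_ennreal)
  qed
  finally show "(\<integral>\<^sup>+(x::real^3). ennreal (norm (1 / (1 + norm x) ^ 6)) \<partial>lborel) < \<infinity>" .
qed measurable

lemma integrable_if_decay:
  fixes f :: "real^3 \<Rightarrow> complex"
  assumes "f \<in> borel_measurable borel" and "\<And>x. (1 + norm x) ^ 6 * cmod (f x) \<le> B"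
  shows "integrable lborel f" and "(LINT x|lborel. cmod (f x)) \<le> B * (LINT x::real^3|lborel. 1 / (1 + norm x) ^ 6)"
proof -
  have le: "cmod (f x) \<le> B * (1 / (1 + norm x) ^ 6)" for x
  proof -
    have "0 < (1 + norm x) ^ 6" by (intro zero_less_power add_pos_nonneg) auto
    then show ?thesis using assms(2)[of x] by (simp add: pos_le_divide_eq mult.commute)
  qed
  have int: "integrable lborel (\<lambda>x::real^3. B * (1 / (1 + norm x) ^ 6))"
    using decay_integrable by (rule integrable_mult_right)
  have le': "cmod (f x) \<le> norm (B * (1 / (1 + norm x) ^ 6))" for x
    unfolding real_norm_def by (rule order_trans[OF le abs_ge_self])
  show i: "integrable lborel f"
    by (rule Bochner_Integration.integrable_bound[OF int]) (use assms(1) le' in auto)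
  have "(LINT x|lborel. cmod (f x)) \<le> (LINT x::real^3|lborel. B * (1 / (1 + norm x) ^ 6))"
    by (intro integral_mono integrable_norm i int le)
  then show "(LINT x|lborel. cmod (f x)) \<le> B * (LINT x::real^3|lborel. 1 / (1 + norm x) ^ 6)"
    unfolding integral_mult_right_zero .
qed

lemma schwartz_measurable: "schwartz f \<Longrightarrow> f \<in> borel_measurable borel"
  by (intro smooth_measurable schwartz_smooth)

lemma schwartz_integrable:
  assumes "schwartz f" shows "integrable lborel f"
proof -
  obtain B where "\<And>x. (1 + norm x) ^ 6 * cmod (iterated_deriv [] f x) \<le> B"
    using schwartz_bound[OF assms] by blast
  then show ?thesis by (intro integrable_if_decay schwartz_measurable assms) simp
qed

lemma cis_mult_integrable:
  fixes f :: "real^3 \<Rightarrow> complex"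
  assumes "integrable lborel f"
  shows "integrable lborel (\<lambda>x. cis (- (x \<bullet> \<xi>)) * f x)"
  by (rule Bochner_Integration.integrable_bound[OF assms]) (use assms in \<open>auto simp: norm_mult cis_conv_exp\<close>)

lemma fourier_bound: "cmod (fourier f \<xi>) \<le> 1 / (2 * pi) ^ 3 * (LINT x|lborel. cmod (f x))"
proof -
  have "cmod (LINT x|lborel. cis (- (x \<bullet> \<xi>)) * f x) \<le> (LINT x|lborel. cmod (cis (- (x \<bullet> \<xi>)) * f x))"
    by (rule integral_norm_bound)
  then show ?thesis unfolding fourier_def
    by (simp add: norm_mult norm_divide norm_power divide_right_mono del: norm_cis) (simp add: divide_right_mono)
qed

lemma fourier_dominated: "seminorm_dominated (\<lambda>f \<xi>. cmod (fourier f \<xi>))"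
proof (rule dominatedI)
  fix f :: "real^3 \<Rightarrow> complex" and \<xi> assume f: "schwartz f"
  let ?I = "LINT x::real^3|lborel. 1 / (1 + norm x) ^ 6"
  have "(1 + norm x) ^ 6 * cmod (f x) \<le> schwartz_seminorm 6 f" for x
    using seminorm_upper[OF f, of 6 6 "[]"] by simp
  then have "(LINT x|lborel. cmod (f x)) \<le> schwartz_seminorm 6 f * ?I"
    by (intro integrable_if_decay schwartz_measurable f)
  then have "1 / (2 * pi) ^ 3 * (LINT x|lborel. cmod (f x)) \<le> 1 / (2 * pi) ^ 3 * (schwartz_seminorm 6 f * ?I)"
    by (intro mult_left_mono) auto
  then show "cmod (fourier f \<xi>) \<le> (1 / (2 * pi) ^ 3 * ?I) * schwartz_seminorm 6 f"
    using fourier_bound[of f \<xi>] by (simp add: mult_ac)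
qed

lemma fourier_add:
  assumes "integrable lborel f" "integrable lborel g"
  shows "fourier (\<lambda>x. f x + g x) = (\<lambda>\<xi>. fourier f \<xi> + fourier g \<xi>)"
  using assms[THEN cis_mult_integrable] by (simp add: fun_eq_iff fourier_def distrib_left)

lemma fourier_cmult: "fourier (\<lambda>x. c * f x) = (\<lambda>\<xi>. c * fourier f \<xi>)"
proof -
  have "cis a * (c * f x) = c * (cis a * f x)" for a x by (simp add: mult_ac)
  then show ?thesis by (simp add: fun_eq_iff fourier_def mult_ac)
qed

section \<open>Derivatives of the transform\<close>

lemma cis_approx: "cmod (cis y - 1 - \<i> * of_real y) \<le> y\<^sup>2 / 2"
  using iexp_approx1[of y 1] by (simp add: cis_conv_exp numeral_2_eq_2 diff_diff_eq)

lemma schwartz_weighted_integrable: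
  assumes "schwartz f"
  shows "integrable lborel (\<lambda>x. (norm x)\<^sup>2 * cmod (f x))"
proof -
  obtain B where B: "\<And>x. (1 + norm x) ^ 8 * cmod (iterated_deriv [] f x) \<le> B"
    using schwartz_bound[OF assms] by blast
  have "integrable lborel (\<lambda>x. of_real ((norm x)\<^sup>2) * f x)"
  proof (rule integrable_if_decay)
    fix x :: "real^3"
    have "(norm x)\<^sup>2 \<le> (1 + norm x)\<^sup>2" by (rule power_mono) auto
    then have "(1 + norm x) ^ 6 * ((norm x)\<^sup>2 * cmod (f x)) \<le> (1 + norm x) ^ 6 * ((1 + norm x)\<^sup>2 * cmod (f x))"
      by (intro mult_left_mono mult_right_mono) auto
    also have "\<dots> = (1 + norm x) ^ 8 * cmod (f x)" by (simp flip: power_add mult.assoc)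
    also have "\<dots> \<le> B" using B[of x] by simp
    finally show "(1 + norm x) ^ 6 * cmod (of_real ((norm x)\<^sup>2) * f x) \<le> B" by (simp add: norm_mult norm_power)
  qed (use schwartz_measurable[OF assms] in measurable)
  from integrable_norm[OF this] show ?thesis by (simp add: norm_mult norm_power)
qed

text \<open>Differentiation under the integral by hand: the exponential differs from its linear part
  by at most half a square, so the remainder is bounded by the square of \<open>norm h\<close> times
  the second moment of \<open>f\<close>, which Schwartz decay makes finite.\<close>

lemma fourier_has_derivative:
  assumes f: "schwartz f"
  shows "(fourier f has_derivative
    (\<lambda>h. \<Sum>j\<in>UNIV. h $ j *\<^sub>R fourier (\<lambda>x. - \<i> * (complex_of_real (x $ j) * f x)) \<xi>)) (at \<xi>)"
proof -
  let ?D = "\<lambda>h::real^3. \<Sum>j\<in>UNIV. h $ j *\<^sub>R fourier (\<lambda>x. - \<i> * (complex_of_real (x $ j) * f x)) \<xi>"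
  let ?k = "1 / (2 * pi) ^ 3 :: real"
  define K where "K = ?k * ((LINT x|lborel. (norm x)\<^sup>2 * cmod (f x)) / 2)"
  have i0: "integrable lborel (\<lambda>x. cis (- (x \<bullet> \<xi>)) * f x)" for \<xi>
    by (intro cis_mult_integrable schwartz_integrable f)
  have i1: "integrable lborel (\<lambda>x. cis (- (x \<bullet> \<xi>)) * (- \<i> * (complex_of_real (x $ j) * f x)))" for j
    by (intro cis_mult_integrable schwartz_integrable schwartz_cmult schwartz_coord f)
  have "bounded_linear ?D"
    by (intro bounded_linear_sum bounded_linear_compose[OF bounded_linear_scaleR_left] bounded_linear_vec_nth)
  moreover have rem: "cmod (fourier f (\<xi> + h) - fourier f \<xi> - ?D h) \<le> K * (norm h)\<^sup>2" for h
  proof -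
    have D: "?D h = of_real ?k * (LINT x|lborel. (\<Sum>j\<in>UNIV.
        of_real (h $ j) * (cis (- (x \<bullet> \<xi>)) * (- \<i> * (complex_of_real (x $ j) * f x)))))"
    proof -
      define G where "G j x = cis (- (x \<bullet> \<xi>)) * (- \<i> * (complex_of_real (x $ j) * f x))" for j x
      have G: "integrable lborel (G j)" for j unfolding G_def by (rule i1)
      have "(LINT x|lborel. (\<Sum>j\<in>UNIV. of_real (h $ j) * G j x)) = (\<Sum>j\<in>UNIV. of_real (h $ j) * (LINT x|lborel. G j x))"
        using G by (subst Bochner_Integration.integral_sum) auto
      moreover have "?D h = (\<Sum>j\<in>UNIV. of_real (h $ j) * (of_real ?k * (LINT x|lborel. G j x)))"
        unfolding fourier_def G_def scaleR_conv_of_real ..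
      ultimately show ?thesis
        unfolding G_def[symmetric] by (simp only: sum_distrib_left mult.left_commute)
    qed
    have S: "(\<Sum>j\<in>UNIV. of_real (h $ j) * (cis (- (x \<bullet> \<xi>)) * (- \<i> * (complex_of_real (x $ j) * f x))))
        = - \<i> * of_real (x \<bullet> h) * cis (- (x \<bullet> \<xi>)) * f x" for x
      by (simp add: inner_vec_def sum_distrib_left sum_distrib_right mult_ac sum_negf)
    have i2: "integrable lborel (\<lambda>x. - \<i> * of_real (x \<bullet> h) * cis (- (x \<bullet> \<xi>)) * f x)"
      unfolding S[symmetric] using i1 by auto
    have "fourier f (\<xi> + h) - fourier f \<xi> - ?D h = of_real ?k * (LINT x|lborel.
        cis (- (x \<bullet> (\<xi> + h))) * f x - cis (- (x \<bullet> \<xi>)) * f x - (- \<i> * of_real (x \<bullet> h) * cis (- (x \<bullet> \<xi>)) * f x))"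
      unfolding D S by (subst Bochner_Integration.integral_diff integral_diff,
          (intro Bochner_Integration.integrable_diff i0 i2)+)+ (simp add: fourier_def algebra_simps)
    also have "cmod \<dots> \<le> ?k * ((LINT x|lborel. (norm x)\<^sup>2 * cmod (f x)) / 2 * (norm h)\<^sup>2)"
    proof -
      have "cmod (LINT x|lborel.
        cis (- (x \<bullet> (\<xi> + h))) * f x - cis (- (x \<bullet> \<xi>)) * f x - (- \<i> * of_real (x \<bullet> h) * cis (- (x \<bullet> \<xi>)) * f x))
        \<le> (LINT x|lborel. (norm h)\<^sup>2 / 2 * ((norm x)\<^sup>2 * cmod (f x)))"
      proof (rule order_trans[OF integral_norm_bound], rule integral_mono)
        show "integrable lborel (\<lambda>x. (norm h)\<^sup>2 / 2 * ((norm x)\<^sup>2 * cmod (f x)))"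
          by (intro integrable_mult_right schwartz_weighted_integrable f)
        fix x :: "real^3"
        have "cis (- (x \<bullet> (\<xi> + h))) * f x - cis (- (x \<bullet> \<xi>)) * f x - (- \<i> * of_real (x \<bullet> h) * cis (- (x \<bullet> \<xi>)) * f x)
          = cis (- (x \<bullet> \<xi>)) * f x * (cis (- (x \<bullet> h)) - 1 - \<i> * of_real (- (x \<bullet> h)))"
        proof -
          have "cis (- (x \<bullet> (\<xi> + h))) = cis (- (x \<bullet> \<xi>)) * cis (- (x \<bullet> h))"
            by (simp add: inner_add_right cis_mult)
          then show ?thesis by (simp add: algebra_simps del: cis_mult)
        qed
        then have "cmod (cis (- (x \<bullet> (\<xi> + h))) * f x - cis (- (x \<bullet> \<xi>)) * f x - (- \<i> * of_real (x \<bullet> h) * cis (- (x \<bullet> \<xi>)) * f x))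
          = cmod (f x) * cmod (cis (- (x \<bullet> h)) - 1 - \<i> * of_real (- (x \<bullet> h)))"
          by (simp add: norm_mult)
        also have "\<dots> \<le> cmod (f x) * ((- (x \<bullet> h))\<^sup>2 / 2)" by (intro mult_left_mono cis_approx) auto
        also have "\<dots> \<le> cmod (f x) * ((norm x * norm h)\<^sup>2 / 2)"
          using Cauchy_Schwarz_ineq2[of x h] by (intro mult_left_mono divide_right_mono) (auto simp: abs_le_square_iff[symmetric] abs_mult)
        finally show "cmod (cis (- (x \<bullet> (\<xi> + h))) * f x - cis (- (x \<bullet> \<xi>)) * f x - (- \<i> * of_real (x \<bullet> h) * cis (- (x \<bullet> \<xi>)) * f x))
          \<le> (norm h)\<^sup>2 / 2 * ((norm x)\<^sup>2 * cmod (f x))" by (simp add: power_mult_distrib mult_ac)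
      qed (intro integrable_norm Bochner_Integration.integrable_diff i0 i2)
      also have "\<dots> = (norm h)\<^sup>2 / 2 * (LINT x|lborel. (norm x)\<^sup>2 * cmod (f x))" by simp
      also have "\<dots> = (LINT x|lborel. (norm x)\<^sup>2 * cmod (f x)) / 2 * (norm h)\<^sup>2" by simp
      finally show ?thesis unfolding norm_mult norm_of_real by (intro mult_mono) auto
    qed
    finally show ?thesis by (simp add: K_def mult_ac)
  qed
  moreover have "((\<lambda>h. cmod (fourier f (\<xi> + h) - fourier f \<xi> - ?D h) / norm h) \<longlongrightarrow> 0) (at 0)"
  proof (rule tendsto_sandwich[where f = "\<lambda>_. 0" and h = "\<lambda>h. K * norm h"])
    show "\<forall>\<^sub>F h in at 0. cmod (fourier f (\<xi> + h) - fourier f \<xi> - ?D h) / norm h \<le> K * norm h"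
      using rem by (intro always_eventually) (auto simp: divide_le_eq power2_eq_square mult_ac)
    show "((\<lambda>h::real^3. K * norm h) \<longlongrightarrow> 0) (at 0)" by (auto intro!: tendsto_eq_intros)
  qed auto
  ultimately show ?thesis by (simp add: has_derivative_at)
qed

lemma partial_deriv_fourier:
  assumes "schwartz f"
  shows "partial_deriv j (fourier f) = fourier (\<lambda>x. - \<i> * (complex_of_real (x $ j) * f x))"
proof
  fix \<xi>
  have "(\<Sum>i\<in>UNIV. axis j 1 $ i *\<^sub>R c i) = c j" for c :: "3 \<Rightarrow> complex"
    by (subst sum.remove[of _ j]) (auto simp: axis_def intro: sum.neutral)
  then show "partial_deriv j (fourier f) \<xi> = fourier (\<lambda>x. - \<i> * (complex_of_real (x $ j) * f x)) \<xi>"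
    using partial_deriv_eq[OF fourier_has_derivative[OF assms]] by simp
qed

lemma fourier_smooth: "schwartz f \<Longrightarrow> smooth (fourier f)"
proof (rule smooth_coinduct[where S = "fourier ` {f. schwartz f}"])
  fix g and i :: 3 and x assume "g \<in> fourier ` {f. schwartz f}"
  then obtain f where f: "schwartz f" and g: "g = fourier f" by auto
  show "g differentiable (at x)"
    unfolding g differentiable_def using fourier_has_derivative[OF f] by blast
  show "partial_deriv i g \<in> fourier ` {f. schwartz f}"
    unfolding g partial_deriv_fourier[OF f] using schwartz_cmult[OF schwartz_coord[OF f]] by blast
qed auto

section \<open>The transform of a derivative\<close>

lemma lborel_translate:
  fixes f :: "real^3 \<Rightarrow> complex"
  assumes [measurable]: "f \<in> borel_measurable borel"
  shows lborel_integral_translate: "(LINT x|lborel. f (v + x)) = (LINT x|lborel. f x)"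
    and lborel_integrable_translate: "integrable lborel (\<lambda>x. f (v + x)) \<longleftrightarrow> integrable lborel f"
proof -
  have "(LINT x|lborel. f x) = (LINT x|distr lborel borel ((+) v). f x)" by (simp add: lborel_distr_plus)
  also have "\<dots> = (LINT x|lborel. f (v + x))" by (subst integral_distr) auto
  finally show "(LINT x|lborel. f (v + x)) = (LINT x|lborel. f x)" ..
  have "integrable lborel f \<longleftrightarrow> integrable (distr lborel borel ((+) v)) f" by (simp add: lborel_distr_plus)
  also have "\<dots> \<longleftrightarrow> integrable lborel (\<lambda>x. f (v + x))" by (subst integrable_distr_eq) auto
  finally show "integrable lborel (\<lambda>x. f (v + x)) \<longleftrightarrow> integrable lborel f" ..
qed

lemma fourier_translate:
  assumes [measurable]: "f \<in> borel_measurable borel"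
  shows "fourier (\<lambda>x. f (v + x)) \<xi> = cis (v \<bullet> \<xi>) * fourier f \<xi>"
proof -
  have "(LINT x|lborel. cis (- (x \<bullet> \<xi>)) * f x) = (LINT x|lborel. cis (- ((v + x) \<bullet> \<xi>)) * f (v + x))"
    by (subst lborel_integral_translate[where f = "\<lambda>x. cis (- (x \<bullet> \<xi>)) * f x"]) (auto simp: cis_conv_exp)
  also have "\<dots> = (LINT x|lborel. cis (- (v \<bullet> \<xi>)) * (cis (- (x \<bullet> \<xi>)) * f (v + x)))"
  proof -
    have "cis (- ((v + x) \<bullet> \<xi>)) = cis (- (v \<bullet> \<xi>)) * cis (- (x \<bullet> \<xi>))" for x
      by (simp add: inner_add_left cis_mult)
    then show ?thesis by (simp only: mult.assoc)
  qed
  also have "\<dots> = cis (- (v \<bullet> \<xi>)) * (LINT x|lborel. cis (- (x \<bullet> \<xi>)) * f (v + x))" by simp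
  finally have "cis (v \<bullet> \<xi>) * (LINT x|lborel. cis (- (x \<bullet> \<xi>)) * f x)
      = (LINT x|lborel. cis (- (x \<bullet> \<xi>)) * f (v + x))"
    by (simp add: cis_mult flip: mult.assoc)
  then show ?thesis by (simp add: fourier_def mult_ac)
qed

lemma mean_value_line:
  fixes g :: "real \<Rightarrow> complex"
  assumes "\<And>t. 0 \<le> t \<Longrightarrow> t \<le> s \<Longrightarrow> (g has_vector_derivative g' t) (at t)"
    and "\<And>t. 0 \<le> t \<Longrightarrow> t \<le> s \<Longrightarrow> cmod (g' t) \<le> B" and "0 \<le> s"
  shows "cmod (g s - g 0) \<le> B * s"
proof -
  have "norm (g s - g 0) \<le> B * norm (s - 0)"
  proof (rule differentiable_bound[where S = "{0..s}" and f' = "\<lambda>t h. h *\<^sub>R g' t"])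
    show "(g has_derivative (\<lambda>h. h *\<^sub>R g' t)) (at t within {0..s})" if "t \<in> {0..s}" for t
      using assms(1)[of t] that by (auto simp: has_vector_derivative_def intro: has_derivative_at_withinI)
    show "onorm (\<lambda>h. h *\<^sub>R g' t) \<le> B" if "t \<in> {0..s}" for t
      using assms(2)[of t] that by (intro onorm_le) (auto simp: mult.commute[of B] mult_left_mono)
  qed (use assms in auto)
  then show ?thesis using assms(3) by simp
qed

lemma line_derivative:
  assumes "smooth f"
  shows "((\<lambda>t. f (t *\<^sub>R axis j 1 + x)) has_vector_derivative partial_deriv j f (t *\<^sub>R axis j 1 + x)) (at t)"
proof -
  let ?y = "t *\<^sub>R axis j 1 + x"
  have A: "((\<lambda>t. t *\<^sub>R axis j 1 + x) has_derivative (\<lambda>h. h *\<^sub>R axis j 1)) (at t)"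
    by (auto intro!: derivative_eq_intros)
  have B: "(f has_derivative frechet_derivative f (at ?y)) (at ?y)"
    using smooth_differentiable[OF assms] by (simp add: frechet_derivative_works)
  have "linear (frechet_derivative f (at ?y))"
    using smooth_differentiable[OF assms] linear_frechet_derivative by blast
  then show ?thesis
    using has_derivative_compose[OF A B]
    by (simp add: has_vector_derivative_def partial_deriv_def linear_scale)
qed


text \<open>Along a segment of length at most 1 the weight \<open>1 + norm x\<close> changes by at
  most a factor 2, whence the constant 64 = 2^6 in front of the bound on the second derivative. The
  mean value inequality, applied twice, then gives the quadratic remainder.\<close>

lemma schwartz_taylor:
  assumes f: "schwartz f"
  obtains B where "\<And>x s. 0 \<le> s \<Longrightarrow> s \<le> 1 \<Longrightarrow>
    (1 + norm x) ^ 6 * cmod (f (s *\<^sub>R axis j 1 + x) - f x - s *\<^sub>R partial_deriv j f x) \<le> B * s\<^sup>2"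
proof -
  let ?e = "axis j 1 :: real^3"
  obtain B where B: "\<And>x. (1 + norm x) ^ 6 * cmod (iterated_deriv [j, j] f x) \<le> B"
    using schwartz_bound[OF f] by blast
  have "(1 + norm x) ^ 6 * cmod (f (s *\<^sub>R ?e + x) - f x - s *\<^sub>R partial_deriv j f x) \<le> (64 * B) * s\<^sup>2"
    if s: "0 \<le> s" "s \<le> 1" for x s
  proof -
    define M where "M = 64 * B / (1 + norm x) ^ 6"
    have M: "cmod (partial_deriv j (partial_deriv j f) (t *\<^sub>R ?e + x)) \<le> M" if t: "0 \<le> t" "t \<le> s" for t
    proof -
      have "norm x \<le> norm (t *\<^sub>R ?e + x) + norm (t *\<^sub>R ?e)"
        by (metis add.commute add_diff_cancel_left' norm_triangle_ineq4 add_diff_cancel_right')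
      then have "1 + norm x \<le> 2 * (1 + norm (t *\<^sub>R ?e + x))"
      proof -
        have "norm (t *\<^sub>R ?e) = t" using t by simp
        then have "norm x \<le> norm (t *\<^sub>R ?e + x) + t" using \<open>norm x \<le> _\<close> by simp
        moreover have "t \<le> 1" using t s by simp
        moreover have "0 \<le> norm (t *\<^sub>R ?e + x)" by simp
        ultimately show ?thesis unfolding distrib_left by linarith
      qed
      then have "(1 + norm x) ^ 6 \<le> (2 * (1 + norm (t *\<^sub>R ?e + x))) ^ 6" by (rule power_mono) auto
      also have "\<dots> = 64 * (1 + norm (t *\<^sub>R ?e + x)) ^ 6" unfolding power_mult_distrib by simp
      finally have "(1 + norm x) ^ 6 * cmod (iterated_deriv [j, j] f (t *\<^sub>R ?e + x))
          \<le> 64 * (1 + norm (t *\<^sub>R ?e + x)) ^ 6 * cmod (iterated_deriv [j, j] f (t *\<^sub>R ?e + x))"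
        by (intro mult_right_mono) auto
      also have "\<dots> \<le> 64 * B" using B[of "t *\<^sub>R ?e + x"] by simp
      moreover have "0 < (1 + norm x) ^ 6" by (intro zero_less_power add_pos_nonneg) auto
      ultimately show ?thesis by (simp add: M_def pos_le_divide_eq mult.commute)
    qed
    have M0: "0 \<le> M" using M[of 0] s by (auto intro: order_trans[OF norm_ge_zero])
    have d1: "cmod (partial_deriv j f (t *\<^sub>R ?e + x) - partial_deriv j f x) \<le> M * s" if t: "0 \<le> t" "t \<le> s" for t
    proof -
      have "cmod (partial_deriv j f (t *\<^sub>R ?e + x) - partial_deriv j f (0 *\<^sub>R ?e + x)) \<le> M * t"
        by (rule mean_value_line[where g = "\<lambda>t. partial_deriv j f (t *\<^sub>R ?e + x)"])
          (use t M smooth_partial_deriv[OF schwartz_smooth[OF f]] in \<open>auto intro: line_derivative\<close>)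
      also have "\<dots> \<le> M * s" using t M0 by (intro mult_left_mono)
      finally show ?thesis by simp
    qed
    have "cmod ((f (s *\<^sub>R ?e + x) - s *\<^sub>R partial_deriv j f x) - (f (0 *\<^sub>R ?e + x) - 0 *\<^sub>R partial_deriv j f x)) \<le> (M * s) * s"
    proof (rule mean_value_line[where g = "\<lambda>t. f (t *\<^sub>R ?e + x) - t *\<^sub>R partial_deriv j f x"])
      show "((\<lambda>t. f (t *\<^sub>R ?e + x) - t *\<^sub>R partial_deriv j f x) has_vector_derivative
          (partial_deriv j f (t *\<^sub>R ?e + x) - partial_deriv j f x)) (at t)" for t
        by (rule has_vector_derivative_diff[OF line_derivative[OF schwartz_smooth[OF f]]])
          (auto intro!: derivative_eq_intros simp: has_vector_derivative_def)
    qed (use d1 s in auto)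
    then have "cmod (f (s *\<^sub>R ?e + x) - f x - s *\<^sub>R partial_deriv j f x) \<le> M * s\<^sup>2"
      by (simp add: power2_eq_square algebra_simps)
    then have "(1 + norm x) ^ 6 * cmod (f (s *\<^sub>R ?e + x) - f x - s *\<^sub>R partial_deriv j f x)
      \<le> (1 + norm x) ^ 6 * (M * s\<^sup>2)" by (intro mult_left_mono) auto
    also have "(1 + norm x) ^ 6 * M = 64 * B"
    proof -
      have "1 + norm x \<noteq> 0" using norm_ge_zero[of x] by linarith
      then show ?thesis by (simp add: M_def)
    qed
    then have "(1 + norm x) ^ 6 * (M * s\<^sup>2) = (64 * B) * s\<^sup>2" by (simp flip: mult.assoc)
    finally show ?thesis .
  qed
  then show ?thesis using that by blast
qed

text \<open>Integration by parts, obtained from the behaviour of the transform under small translations.\<close>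

lemma fourier_partial_deriv:
  assumes f: "schwartz f"
  shows "fourier (partial_deriv j f) \<xi> = \<i> * of_real (\<xi> $ j) * fourier f \<xi>"
proof -
  let ?e = "axis j 1 :: real^3"
  let ?I = "LINT x::real^3|lborel. 1 / (1 + norm x) ^ 6"
  obtain B where B: "\<And>x s. 0 \<le> s \<Longrightarrow> s \<le> 1 \<Longrightarrow>
    (1 + norm x) ^ 6 * cmod (f (s *\<^sub>R ?e + x) - f x - s *\<^sub>R partial_deriv j f x) \<le> B * s\<^sup>2"
    using schwartz_taylor[OF f] by blast
  have [measurable]: "f \<in> borel_measurable borel" "partial_deriv j f \<in> borel_measurable borel"
    using f by (auto intro: schwartz_measurable schwartz_partial)
  \<comment> \<open>The first summand bounds the transform of the Taylor remainder of
    \<open>f\<close>, the second the quadratic error of the exponential.\<close>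
  define K where "K = 1 / (2 * pi) ^ 3 * (B * ?I) + cmod (fourier f \<xi>) * (\<xi> $ j)\<^sup>2 / 2"
  have main: "s * cmod (\<i> * of_real (\<xi> $ j) * fourier f \<xi> - fourier (partial_deriv j f) \<xi>) \<le> K * s\<^sup>2"
    if s: "0 \<le> s" "s \<le> 1" for s
  proof -
    let ?r = "\<lambda>x. f (s *\<^sub>R ?e + x) + (-1 * f x + - of_real s * partial_deriv j f x)"
    have it: "integrable lborel (\<lambda>x. f (s *\<^sub>R ?e + x))" "integrable lborel (\<lambda>x. -1 * f x)"
        "integrable lborel (\<lambda>x. - of_real s * partial_deriv j f x)"
      using schwartz_integrable[OF f] schwartz_integrable[OF schwartz_partial[OF f]]
      by (auto simp: lborel_integrable_translate intro!: integrable_mult_right)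
    have a: "fourier ?r \<xi> = cis (s * \<xi> $ j) * fourier f \<xi> - fourier f \<xi> - of_real s * fourier (partial_deriv j f) \<xi>"
      by (subst fourier_add fourier_cmult, (intro it Bochner_Integration.integrable_add)+)+
        (simp add: fourier_cmult fourier_translate inner_axis' fourier_cmult[of "-1", simplified] fourier_cmult[of "- of_real s", simplified])
    have b: "cmod (fourier ?r \<xi>) \<le> 1 / (2 * pi) ^ 3 * (B * s\<^sup>2 * ?I)"
    proof -
      have "(LINT x|lborel. cmod (?r x)) \<le> B * s\<^sup>2 * ?I"
      proof (intro integrable_if_decay)
        fix x
        have "?r x = f (s *\<^sub>R ?e + x) - f x - s *\<^sub>R partial_deriv j f x"
          by (simp add: scaleR_conv_of_real)
        then show "(1 + norm x) ^ 6 * cmod (?r x) \<le> B * s\<^sup>2" using B[OF s, of x] by (simp only:)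
      qed measurable
      then have "1 / (2 * pi) ^ 3 * (LINT x|lborel. cmod (?r x)) \<le> 1 / (2 * pi) ^ 3 * (B * s\<^sup>2 * ?I)"
        by (intro mult_left_mono) auto
      then show ?thesis using fourier_bound[of ?r \<xi>] by linarith
    qed
    have c: "cmod ((cis (s * \<xi> $ j) - 1 - \<i> * of_real (s * \<xi> $ j)) * fourier f \<xi>)
        \<le> (s * \<xi> $ j)\<^sup>2 / 2 * cmod (fourier f \<xi>)"
      unfolding norm_mult by (intro mult_right_mono cis_approx) auto
    have "of_real s * (\<i> * of_real (\<xi> $ j) * fourier f \<xi> - fourier (partial_deriv j f) \<xi>)
      = (cis (s * \<xi> $ j) * fourier f \<xi> - fourier f \<xi> - of_real s * fourier (partial_deriv j f) \<xi>)
        - (cis (s * \<xi> $ j) - 1 - \<i> * of_real (s * \<xi> $ j)) * fourier f \<xi>"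
      by (simp add: algebra_simps)
    then have d: "s * cmod (\<i> * of_real (\<xi> $ j) * fourier f \<xi> - fourier (partial_deriv j f) \<xi>)
       \<le> cmod (cis (s * \<xi> $ j) * fourier f \<xi> - fourier f \<xi> - of_real s * fourier (partial_deriv j f) \<xi>)
        + cmod ((cis (s * \<xi> $ j) - 1 - \<i> * of_real (s * \<xi> $ j)) * fourier f \<xi>)"
      by (metis norm_triangle_ineq4 norm_mult norm_of_real abs_of_nonneg s(1))
    have "s * cmod (\<i> * of_real (\<xi> $ j) * fourier f \<xi> - fourier (partial_deriv j f) \<xi>)
      \<le> 1 / (2 * pi) ^ 3 * (B * s\<^sup>2 * ?I) + (s * \<xi> $ j)\<^sup>2 / 2 * cmod (fourier f \<xi>)"
      using b[unfolded a] c d by linarith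
    also have "\<dots> = K * s\<^sup>2"
      unfolding K_def distrib_right power_mult_distrib by (simp only: mult_ac times_divide_eq_left times_divide_eq_right)
    finally show ?thesis .
  qed
  define d where "d = cmod (\<i> * of_real (\<xi> $ j) * fourier f \<xi> - fourier (partial_deriv j f) \<xi>)"
  have "d = 0"
  proof (rule ccontr)
    assume "d \<noteq> 0"
    then have d: "d > 0" by (simp add: d_def)
    have K: "d \<le> K" using main[of 1] by (simp add: d_def)
    \<comment> \<open>Letting \<open>s\<close> tend to 0 in \<open>s * d \<le> K * s\<^sup>2\<close>
      would force \<open>d = 0\<close>. The value \<open>s = d / (2 * K)\<close> achieves this
      without a limit, and \<open>d \<le> K\<close> keeps it below 1.\<close>
    have "d / (2 * K) * d \<le> K * (d / (2 * K))\<^sup>2"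
      unfolding d_def by (rule main) (use d K in \<open>auto simp: d_def[symmetric] divide_le_eq\<close>)
    then show False using d K by (simp add: field_simps power2_eq_square)
  qed
  then show ?thesis by (simp add: d_def)
qed

text \<open>Polynomial decay is bought with derivatives: \<open>1 + norm \<xi>\<close> is at most
  one plus the absolute values of the coordinates, and each coordinate is, up to the factor
  \<open>\<i>\<close>, the symbol of a partial derivative.\<close>

lemma fourier_poly_dominated: "seminorm_dominated (\<lambda>f \<xi>. (1 + norm \<xi>) ^ n * cmod (fourier f \<xi>))"
proof (induction n)
  case 0
  then show ?case using fourier_dominated by simp
next
  case (Suc n)
  let ?Q = "\<lambda>f \<xi>. (1 + norm \<xi>) ^ n * cmod (fourier f \<xi>)"
  have "seminorm_dominated (\<lambda>f \<xi>. ?Q f \<xi> + (\<Sum>j\<in>UNIV. ?Q (partial_deriv j f) \<xi>))"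
    by (intro dominated_add dominated_sum dominated_compose[OF Suc schwartz_continuous_partial] Suc) auto
  then show ?case
  proof (rule dominated_mono)
    fix f :: "real^3 \<Rightarrow> complex" and \<xi> assume f: "schwartz f"
    have "(1 + norm \<xi>) * cmod (fourier f \<xi>) \<le> (1 + (\<Sum>j\<in>UNIV. \<bar>\<xi> $ j\<bar>)) * cmod (fourier f \<xi>)"
      using norm_le_l1_cart[of \<xi>] by (intro mult_right_mono) auto
    also have "\<dots> = cmod (fourier f \<xi>) + (\<Sum>j\<in>UNIV. cmod (fourier (partial_deriv j f) \<xi>))"
      by (simp add: fourier_partial_deriv[OF f] norm_mult distrib_right sum_distrib_right)
    finally have "(1 + norm \<xi>) ^ n * ((1 + norm \<xi>) * cmod (fourier f \<xi>))
      \<le> (1 + norm \<xi>) ^ n * (cmod (fourier f \<xi>) + (\<Sum>j\<in>UNIV. cmod (fourier (partial_deriv j f) \<xi>)))"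
      by (intro mult_left_mono) auto
    then show "\<exists>\<eta>. (1 + norm \<xi>) ^ Suc n * cmod (fourier f \<xi>)
        \<le> ?Q f \<eta> + (\<Sum>j\<in>UNIV. ?Q (partial_deriv j f) \<eta>)"
      by (intro exI[of _ \<xi>]) (simp add: distrib_left sum_distrib_left mult_ac)
  qed
qed

lemma schwartz_continuous_coord_cmult: "schwartz_continuous (\<lambda>f x. c * (complex_of_real (x $ i) * f x))"
proof (rule schwartz_continuousI)
  fix n "is"
  show "seminorm_dominated (\<lambda>f x. (1 + norm x) ^ n *
      cmod (iterated_deriv is (\<lambda>x. c * (complex_of_real (x $ i) * f x)) x))"
  proof (rule dominated_mono[OF dominated_cmult[OF coord_dominated[of n "is" i], of "cmod c"]])
    fix f :: "real^3 \<Rightarrow> complex" and x assume f: "schwartz f"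
    show "\<exists>y. (1 + norm x) ^ n * cmod (iterated_deriv is (\<lambda>x. c * (complex_of_real (x $ i) * f x)) x)
      \<le> cmod c * ((1 + norm y) ^ n * cmod (iterated_deriv is (\<lambda>x. complex_of_real (x $ i) * f x) y))"
      unfolding iterated_deriv_cmult[OF schwartz_smooth[OF schwartz_coord[OF f]]] norm_mult
      by (intro exI[of _ x]) (simp only: mult.left_commute order_refl)
  qed simp
qed (intro schwartz_smooth schwartz_cmult schwartz_coord)

text \<open>The innermost derivative of a transform is the transform of a coordinate times
  \<open>f\<close>, so the estimate with fewer derivatives is reused for another Schwartz
  function.\<close>

lemma fourier_deriv_dominated:
  "seminorm_dominated (\<lambda>f \<xi>. (1 + norm \<xi>) ^ n * cmod (iterated_deriv is (fourier f) \<xi>))"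
proof (induction "is" rule: rev_induct)
  case Nil
  then show ?case using fourier_poly_dominated by simp
next
  case (snoc j "is")
  show ?case
    by (rule dominated_mono[OF dominated_compose[OF snoc schwartz_continuous_coord_cmult[of "- \<i>" j]]])
      (auto simp: iterated_deriv_snoc partial_deriv_fourier)
qed

lemma schwartz_continuous_fourier: "schwartz_continuous fourier"
  by (intro schwartz_continuousI fourier_smooth fourier_deriv_dominated)

lemma schwartz_fourier: "schwartz f \<Longrightarrow> schwartz (fourier f)"
  using schwartz_continuous_fourier by (auto simp: schwartz_continuous_def)

section \<open>Test functions\<close>

text \<open>The classical flat function \<open>exp (- (1 / x))\<close> is given a polynomial factor
  in \<open>1 / x\<close> because the resulting family is closed under differentiation:
  \<open>P\<close> turns into \<open>[:0, 0, 1:] * (P - pderiv P)\<close>.\<close>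

definition bump :: "real poly \<Rightarrow> real \<Rightarrow> real" where
  "bump P x = (if 0 < x then poly P (1 / x) * exp (- (1 / x)) else 0)"

lemma poly_exp_tendsto_0: "((\<lambda>y::real. poly P y * exp (- y)) \<longlongrightarrow> 0) at_top"
proof -
  have "((\<lambda>y::real. \<Sum>i\<le>degree P. coeff P i * (y ^ i / exp y)) \<longlongrightarrow> (\<Sum>i\<le>degree P. coeff P i * 0)) at_top"
    by (intro tendsto_intros tendsto_power_div_exp_0)
  then show ?thesis by (simp add: poly_altdef sum_distrib_right exp_minus divide_inverse mult.assoc)
qed

lemma bump_right_limit: "(bump P \<longlongrightarrow> 0) (at_right 0)"
proof -
  have "((\<lambda>x. poly P (inverse x) * exp (- inverse x)) \<longlongrightarrow> 0) (at_right (0::real))"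
    using filterlim_compose[OF poly_exp_tendsto_0 filterlim_inverse_at_top_right] by simp
  then show ?thesis
    by (rule Lim_transform_eventually) (auto simp: eventually_at_filter bump_def inverse_eq_divide)
qed

lemma bump_has_derivative:
  "(bump P has_real_derivative bump ([:0, 0, 1:] * (P - pderiv P)) x) (at x)"
proof -
  consider "x > 0" | "x < 0" | "x = 0" by linarith
  then show ?thesis
  proof cases
    case 1
    have "((\<lambda>x. poly P (1 / x) * exp (- (1 / x))) has_real_derivative
        bump ([:0, 0, 1:] * (P - pderiv P)) x) (at x)"
      using 1 by (auto intro!: derivative_eq_intros simp: bump_def power2_eq_square algebra_simps)
    then show ?thesis
      by (rule has_field_derivative_transform_within_open[of _ _ _ "{0<..}"]) (use 1 in \<open>auto simp: bump_def\<close>)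
  next
    case 2
    have "((\<lambda>x. 0) has_real_derivative bump ([:0, 0, 1:] * (P - pderiv P)) x) (at x)"
      using 2 by (simp add: bump_def)
    then show ?thesis
      by (rule has_field_derivative_transform_within_open[of _ _ _ "{..<0}"]) (use 2 in \<open>auto simp: bump_def\<close>)
  next
    case 3
    have "((\<lambda>y. (bump P y - bump P 0) / (y - 0)) \<longlongrightarrow> 0) (at 0)"
    proof (rule filterlim_split_at)
      show "((\<lambda>y. (bump P y - bump P 0) / (y - 0)) \<longlongrightarrow> 0) (at_left 0)"
        by (rule tendsto_eventually) (auto simp: eventually_at_filter bump_def)
      \<comment> \<open>From the right, the difference quotient at 0 is itself a bump, with one more
        factor \<open>1 / y\<close>.\<close>
      show "((\<lambda>y. (bump P y - bump P 0) / (y - 0)) \<longlongrightarrow> 0) (at_right 0)"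
        by (rule Lim_transform_eventually[OF bump_right_limit[of "[:0, 1:] * P"]])
          (auto simp: eventually_at_filter bump_def)
    qed
    then show ?thesis using 3 by (simp add: has_field_derivative_iff bump_def[of _ 0])
  qed
qed

text \<open>The members of the invariant class carry a constant \<open>c\<close> because each
  partial derivative brings out the inner factor \<open>a * axis j 1 $ i\<close>.\<close>

lemma smooth_bump: "smooth (\<lambda>x. complex_of_real (bump P (a * x $ i + b)))"
proof (rule smooth_coinduct[where S = "{(\<lambda>x. complex_of_real (c * bump P (a * x $ i + b))) | c P. True}"])
  show "(\<lambda>x. complex_of_real (bump P (a * x $ i + b))) \<in> {(\<lambda>x. complex_of_real (c * bump P (a * x $ i + b))) | c P. True}"
    by (intro CollectI exI[of _ 1] exI[of _ P]) simp
next
  fix g and j :: 3 and x :: "real^3"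
  assume "g \<in> {(\<lambda>x. complex_of_real (c * bump P (a * x $ i + b))) | c P. True}"
  then obtain c P where g: "g = (\<lambda>x. complex_of_real (c * bump P (a * x $ i + b)))" by blast
  let ?Q = "[:0, 0, 1:] * (P - pderiv P)"
  have D: "(g has_derivative (\<lambda>h. complex_of_real (c * ((a * h $ i) * bump ?Q (a * x $ i + b))))) (at x)" for x
  proof -
    have l: "((\<lambda>x::real^3. a * x $ i + b) has_derivative (\<lambda>h. a * h $ i)) (at x)"
      by (auto intro!: derivative_eq_intros bounded_linear_imp_has_derivative bounded_linear_vec_nth)
    have r: "(bump P has_derivative (\<lambda>h. h * bump ?Q (a * x $ i + b))) (at (a * x $ i + b))"
      by (rule has_derivative_eq_rhs[OF bump_has_derivative[unfolded has_field_derivative_def]])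
        (auto simp: fun_eq_iff)
    have "((\<lambda>x. c * bump P (a * x $ i + b)) has_derivative (\<lambda>h. c * ((a * h $ i) * bump ?Q (a * x $ i + b)))) (at x)"
      by (rule has_derivative_mult_right[OF has_derivative_compose[OF l r]])
    then show ?thesis
      unfolding g by (rule bounded_linear.has_derivative[OF bounded_linear_of_real])
  qed
  then show "g differentiable (at x)" unfolding differentiable_def by blast
  have "partial_deriv j g = (\<lambda>x. complex_of_real ((c * (a * axis j 1 $ i)) * bump ?Q (a * x $ i + b)))"
    using partial_deriv_eq[OF D, of j] by (auto simp: fun_eq_iff mult.assoc)
  then show "partial_deriv j g \<in> {(\<lambda>x. complex_of_real (c * bump P (a * x $ i + b))) | c P. True}"
    by blast
qed

text \<open>These functions vanish off the open box and tend pointwise to its indicator as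
  \<open>n\<close> grows: inside, the distances to the faces are multiplied by \<open>n\<close> and
  go to infinity, where \<open>bump 1\<close> tends to 1.\<close>

definition box_bump :: "nat \<Rightarrow> real^3 \<Rightarrow> real^3 \<Rightarrow> real^3 \<Rightarrow> real" where
  "box_bump n a b x = (\<Prod>i\<in>UNIV. bump 1 (real n * (x $ i - a $ i)) * bump 1 (real n * (b $ i - x $ i)))"

lemma bump_1_bounds: "0 \<le> bump 1 x" "bump 1 x \<le> 1"
  by (auto simp: bump_def)

lemma box_bump_bounds: "0 \<le> box_bump n a b x" "box_bump n a b x \<le> 1"
  by (auto simp: box_bump_def bump_1_bounds intro!: prod_nonneg prod_le_1 mult_le_one)

lemma smooth_box_bump: "smooth (\<lambda>x. complex_of_real (box_bump n a b x))"
proof -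
  have "smooth (\<lambda>x. complex_of_real (bump 1 (real n * x $ i + - (real n * a $ i))) *
      complex_of_real (bump 1 (- real n * x $ i + real n * b $ i)))" for i
    by (intro smooth_mult smooth_bump)
  then have "smooth (\<lambda>x. \<Prod>i\<in>UNIV. complex_of_real (bump 1 (real n * x $ i + - (real n * a $ i))) *
      complex_of_real (bump 1 (- real n * x $ i + real n * b $ i)))"
    by (intro smooth_prod)
  then show ?thesis by (simp add: box_bump_def algebra_simps)
qed

lemma box_bump_eq_0: "x \<notin> box a b \<Longrightarrow> box_bump n a b x = 0"
proof -
  assume "x \<notin> box a b"
  then obtain i where "\<not> (a $ i < x $ i \<and> x $ i < b $ i)" by (auto simp: mem_box_cart)
  then have "bump 1 (real n * (x $ i - a $ i)) * bump 1 (real n * (b $ i - x $ i)) = 0"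
    by (auto simp: bump_def zero_less_mult_iff)
  then show ?thesis unfolding box_bump_def by (intro prod_zero) auto
qed

lemma test_function_box_bump: "test_function (\<lambda>x. complex_of_real (box_bump n a b x))"
proof -
  have "{x. complex_of_real (box_bump n a b x) \<noteq> 0} \<subseteq> cbox a b"
    using box_bump_eq_0 box_subset_cbox by fastforce
  then have "bounded {x. complex_of_real (box_bump n a b x) \<noteq> 0}"
    using bounded_cbox bounded_subset by blast
  then show ?thesis by (simp add: test_function_def smooth_box_bump compact_closure)
qed

lemma box_bump_limit: "(\<lambda>n. box_bump n a b x) \<longlonglongrightarrow> indicat_real (box a b) x"
proof (cases "x \<in> box a b")
  case True
  have *: "(\<lambda>n. bump 1 (real n * y)) \<longlonglongrightarrow> 1" if "0 < y" for y
  proof -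
    have "(\<lambda>n. exp (- (1 / y * inverse (real n)))) \<longlonglongrightarrow> exp (- (1 / y * 0))"
      by (intro tendsto_intros lim_inverse_n)
    then have "(\<lambda>n. exp (- (1 / y * inverse (real n)))) \<longlonglongrightarrow> 1" by simp
    then show ?thesis
    proof (rule Lim_transform_eventually)
      show "\<forall>\<^sub>F n in sequentially. exp (- (1 / y * inverse (real n))) = bump 1 (real n * y)"
        using eventually_gt_at_top[of 0] by eventually_elim (use that in \<open>auto simp: bump_def field_simps\<close>)
    qed
  qed
  have "(\<lambda>n. box_bump n a b x) \<longlonglongrightarrow> (\<Prod>i\<in>(UNIV :: 3 set). 1 * 1)"
    unfolding box_bump_def using True by (intro tendsto_intros *) (auto simp: mem_box_cart)
  then show ?thesis using True by simp
qed (simp add: box_bump_eq_0)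

text \<open>Open boxes generate the Borel sets and are stable under intersection, so Dynkin's
  argument extends equality of the integrals from boxes to all Borel sets. Equality of the total
  integrals serves the complement step, since the whole space is not a box.\<close>

lemma AE_eq_of_boxes:
  fixes g h :: "real^3 \<Rightarrow> complex"
  assumes g: "integrable lborel g" and h: "integrable lborel h"
    and total: "(LINT x|lborel. g x) = (LINT x|lborel. h x)"
    and boxes: "\<And>a b. (LINT x:box a b|lborel. g x) = (LINT x:box a b|lborel. h x)"
  shows "AE x in lborel. g x = h x"
proof (rule sigma_finite_measure.density_unique_banach[OF sigma_finite_lborel g h])
  have si: "set_integrable lborel A g" "set_integrable lborel A h" if "A \<in> sets borel" for A
    using g h that by (auto simp: set_integrable_def intro!: integrable_mult_indicator)
  fix A assume "A \<in> sets (lborel :: (real^3) measure)"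
  then have A: "A \<in> sigma_sets UNIV (range (\<lambda>(a, b). box a b :: (real^3) set))"
    by (simp add: borel_eq_box)
  have stable: "Int_stable (range (\<lambda>(a, b). box a b :: (real^3) set))"
    by (auto simp: Int_stable_def box_Int_box)
  have "range (\<lambda>(a, b). box a b :: (real^3) set) \<subseteq> Pow UNIV" by simp
  from stable this A show "(LINT x:A|lborel. g x) = (LINT x:A|lborel. h x)"
  proof (induction rule: sigma_sets_induct_disjoint)
    case (basic A)
    then show ?case using boxes by auto
  next
    case (compl A)
    then have A: "A \<in> sets borel" by (simp add: borel_eq_box)
    have "(LINT x:UNIV - A|lborel. f x) = (LINT x|lborel. f x) - (LINT x:A|lborel. f x)"
      if "integrable lborel f" for f :: "real^3 \<Rightarrow> complex"
    proof -
      have "(LINT x:A \<union> (UNIV - A)|lborel. f x) = (LINT x:A|lborel. f x) + (LINT x:UNIV - A|lborel. f x)"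
        using A that by (intro set_integral_Un) (auto simp: set_integrable_def intro!: integrable_mult_indicator)
      then show ?thesis by (simp add: set_lebesgue_integral_def)
    qed
    then show ?case using g h total compl by simp
  next
    case (union A)
    then have A: "A i \<in> sets borel" for i by (auto simp: borel_eq_box)
    have "(LINT x:(\<Union>i. A i)|lborel. f x) = (\<Sum>i. (LINT x:A i|lborel. f x))"
      if "integrable lborel f" for f :: "real^3 \<Rightarrow> complex"
      using A that union(1)
      by (intro lebesgue_integral_countable_add)
        (auto simp: set_integrable_def disjoint_family_on_def intro!: integrable_mult_indicator)
    then show ?case using g h union by simp
  qed (auto simp: set_lebesgue_integral_def)
qed

lemma locally_integrable_bounded:
  assumes "locally_integrable g" "bounded A" "A \<in> sets borel"
  shows "set_integrable lborel A g"
proof (rule set_integrable_subset)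
  show "set_integrable lborel (closure A) g"
    using assms by (auto simp: locally_integrable_def compact_closure)
qed (use assms closure_subset in auto)

text \<open>This is the fundamental lemma of the calculus of variations. The functions
  \<open>box_bump\<close> are test functions and converge boundedly to indicators, which gives equal
  integrals over boxes. Since integrability is only local, \<open>AE_eq_of_boxes\<close> is applied
  inside boxes that exhaust the space, and boxes meet in boxes.\<close>

lemma locally_integrable_AE_eq:
  assumes g: "locally_integrable g" and h: "locally_integrable h"
    and eq: "\<And>\<psi>. test_function \<psi> \<Longrightarrow> (LINT x|lborel. g x * \<psi> x) = (LINT x|lborel. h x * \<psi> x)"
  shows "AE x in lborel. g x = h x"
proof -
  have lim: "(\<lambda>n. LINT x|lborel. f x * of_real (box_bump n a b x)) \<longlonglongrightarrow> (LINT x:box a b|lborel. f x)"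
    if f: "locally_integrable f" for f a b
    unfolding set_lebesgue_integral_def
  proof (rule integral_dominated_convergence)
    show "integrable lborel (\<lambda>x. norm (indicat_real (box a b) x *\<^sub>R f x))"
      using locally_integrable_bounded[OF f bounded_box]
      unfolding set_integrable_def by (intro integrable_norm) auto
    have m: "f \<in> borel_measurable borel" using f by (simp add: locally_integrable_def)
    then show "(\<lambda>x. f x * of_real (box_bump n a b x)) \<in> borel_measurable lborel" for n
      using smooth_measurable[OF smooth_box_bump] by auto
    show "(\<lambda>x. indicat_real (box a b) x *\<^sub>R f x) \<in> borel_measurable lborel"
      using m by auto
    show "AE x in lborel. (\<lambda>n. f x * of_real (box_bump n a b x)) \<longlonglongrightarrow> indicat_real (box a b) x *\<^sub>R f x"
    proof (rule AE_I2)
      fix x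
      have "(\<lambda>n. f x * of_real (box_bump n a b x)) \<longlonglongrightarrow> f x * of_real (indicat_real (box a b) x)"
        by (intro tendsto_intros box_bump_limit)
      then show "(\<lambda>n. f x * of_real (box_bump n a b x)) \<longlonglongrightarrow> indicat_real (box a b) x *\<^sub>R f x"
        by (simp add: scaleR_conv_of_real mult.commute)
    qed
    show "AE x in lborel. norm (f x * of_real (box_bump n a b x)) \<le> norm (indicat_real (box a b) x *\<^sub>R f x)" for n
    proof (rule AE_I2)
      fix x show "norm (f x * of_real (box_bump n a b x)) \<le> norm (indicat_real (box a b) x *\<^sub>R f x)"
        using box_bump_bounds[of n a b x] mult_left_le[of "box_bump n a b x" "norm (f x)"]
        by (cases "x \<in> box a b") (auto simp: norm_mult box_bump_eq_0)
    qed
  qed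
  have boxes: "(LINT x:box a b|lborel. g x) = (LINT x:box a b|lborel. h x)" for a b
    using lim[OF g, of a b] lim[OF h, of a b] eq[OF test_function_box_bump] LIMSEQ_unique by simp
  have "AE x in lborel. indicat_real (box (- (real n *\<^sub>R One)) (real n *\<^sub>R One)) x *\<^sub>R g x =
      indicat_real (box (- (real n *\<^sub>R One)) (real n *\<^sub>R One)) x *\<^sub>R h x" for n
  proof (rule AE_eq_of_boxes)
    let ?B = "box (- (real n *\<^sub>R One)) (real n *\<^sub>R One) :: (real^3) set"
    show "integrable lborel (\<lambda>x. indicat_real ?B x *\<^sub>R g x)" "integrable lborel (\<lambda>x. indicat_real ?B x *\<^sub>R h x)"
      using locally_integrable_bounded[OF g bounded_box] locally_integrable_bounded[OF h bounded_box]
      by (auto simp: set_integrable_def)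
    show "(LINT x|lborel. indicat_real ?B x *\<^sub>R g x) = (LINT x|lborel. indicat_real ?B x *\<^sub>R h x)"
      using boxes by (simp add: set_lebesgue_integral_def)
    fix a b
    have *: "(LINT x:box a b|lborel. indicat_real ?B x *\<^sub>R f x) = (LINT x:box a b \<inter> ?B|lborel. f x)"
      for f :: "real^3 \<Rightarrow> complex"
      by (simp add: set_lebesgue_integral_def indicator_inter_arith)
    show "(LINT x:box a b|lborel. indicat_real ?B x *\<^sub>R g x) = (LINT x:box a b|lborel. indicat_real ?B x *\<^sub>R h x)"
      unfolding * unfolding box_Int_box by (rule boxes)
  qed
  then have "AE x in lborel. \<forall>n. indicat_real (box (- (real n *\<^sub>R One)) (real n *\<^sub>R One)) x *\<^sub>R g x =
      indicat_real (box (- (real n *\<^sub>R One)) (real n *\<^sub>R One)) x *\<^sub>R h x"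
    unfolding AE_all_countable by blast
  then show ?thesis
  proof eventually_elim
    case (elim x)
    have "x \<in> (\<Union>n::nat. box (- (real n *\<^sub>R One)) (real n *\<^sub>R One))"
      unfolding UN_box_eq_UNIV by simp
    then obtain n :: nat where "x \<in> box (- (real n *\<^sub>R One)) (real n *\<^sub>R One)" by blast
    then show ?case using elim[rule_format, of n] by simp
  qed
qed

section \<open>Test functions as Schwartz functions\<close>

lemma partial_deriv_support:
  assumes "x \<notin> closure {x. f x \<noteq> 0}"
  shows "partial_deriv i f x = 0"
proof -
  have "((\<lambda>x. 0) has_derivative (\<lambda>_. 0)) (at x)" by simp
  then have "(f has_derivative (\<lambda>_. 0)) (at x)"
    by (rule has_derivative_transform_within_open[of _ _ _ _ "- closure {x. f x \<noteq> 0}"])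
      (use assms closure_subset[of "{x. f x \<noteq> 0}"] in auto)
  from partial_deriv_eq[OF this] show ?thesis .
qed

lemma iterated_deriv_support: "{x. iterated_deriv is f x \<noteq> 0} \<subseteq> closure {x. f x \<noteq> 0}"
proof (induction "is")
  case (Cons i "is")
  have "closure {x. iterated_deriv is f x \<noteq> 0} \<subseteq> closure {x. f x \<noteq> 0}"
    using closure_minimal[OF Cons] by simp
  then show ?case using partial_deriv_support[of _ "iterated_deriv is f"] by auto
qed (simp add: closure_subset)

lemma compact_support_bound:
  assumes "test_function f" "continuous_on UNIV u" "\<And>x. iterated_deriv is f x = 0 \<Longrightarrow> u x = (0::real)"
  obtains B where "\<And>x. \<bar>u x\<bar> \<le> B"
proof -
  let ?K = "closure {x. f x \<noteq> 0}"
  have "continuous_on ?K u" by (rule continuous_on_subset[OF assms(2)]) simp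
  moreover have "compact ?K" using assms(1) by (simp add: test_function_def)
  ultimately have "bounded (u ` ?K)" by (intro compact_imp_bounded compact_continuous_image)
  then obtain B where B: "\<And>y. y \<in> ?K \<Longrightarrow> \<bar>u y\<bar> \<le> B" by (auto simp: bounded_iff)
  have "\<bar>u x\<bar> \<le> max B 0" for x
  proof (cases "iterated_deriv is f x = 0")
    case False
    then have "x \<in> ?K" using iterated_deriv_support[of "is" f] by blast
    from B[OF this] show ?thesis by simp
  qed (simp add: assms(3))
  then show ?thesis by (rule that)
qed

lemma test_function_schwartz:
  assumes f: "test_function f"
  shows "schwartz f"
proof (rule schwartzI)
  show s: "smooth f" using f by (simp add: test_function_def)
  fix n and "is" :: "3 list"
  obtain B where "\<And>x. \<bar>(1 + norm x) ^ n * cmod (iterated_deriv is f x)\<bar> \<le> B"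
    by (rule compact_support_bound[OF f, of "\<lambda>x. (1 + norm x) ^ n * cmod (iterated_deriv is f x)" "is"])
      (auto intro!: continuous_intros smooth_continuous smooth_iterated_deriv s)
  then show "\<exists>B. \<forall>x. (1 + norm x) ^ n * cmod (iterated_deriv is f x) \<le> B"
    by (intro exI[of _ B]) (auto intro: order_trans[OF abs_ge_self])
qed

lemma test_function_mult:
  assumes "smooth f" "test_function g"
  shows "test_function (\<lambda>x. f x * g x)"
proof -
  have "{x. f x * g x \<noteq> 0} \<subseteq> {x. g x \<noteq> 0}" by auto
  then have "closure {x. f x * g x \<noteq> 0} \<subseteq> closure {x. g x \<noteq> 0}" by (rule closure_mono)
  then have "compact (closure {x. g x \<noteq> 0} \<inter> closure {x. f x * g x \<noteq> 0})"
      "closure {x. g x \<noteq> 0} \<inter> closure {x. f x * g x \<noteq> 0} = closure {x. f x * g x \<noteq> 0}"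
    using assms by (auto simp: test_function_def intro: compact_Int_closed)
  then show ?thesis using assms by (simp add: test_function_def smooth_mult)
qed

section \<open>Fourier inversion\<close>

lemma lborel_integral_scale:
  fixes f :: "real^3 \<Rightarrow> complex"
  assumes [measurable]: "f \<in> borel_measurable borel" and c: "c \<noteq> 0"
  shows "(LINT x|lborel. f (c *\<^sub>R x)) = of_real (1 / \<bar>c\<bar> ^ 3) * (LINT x|lborel. f x)"
proof -
  have "(LINT x|lborel. f x) = (LINT x|density (distr lborel borel (\<lambda>x. 0 + c *\<^sub>R x)) (\<lambda>_. ennreal (\<bar>c\<bar> ^ DIM(real^3))). f x)"
    using lborel_affine[OF c, of "0 :: real^3"] by simp
  also have "\<dots> = (LINT x|distr lborel borel (\<lambda>x. 0 + c *\<^sub>R x). (\<bar>c\<bar> ^ DIM(real^3)) *\<^sub>R f x)"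
    by (subst integral_density) auto
  also have "\<dots> = (LINT x|lborel. (\<bar>c\<bar> ^ 3) *\<^sub>R f (c *\<^sub>R x))"
    by (subst integral_distr) auto
  finally show ?thesis using c by (simp add: scaleR_conv_of_real)
qed

text \<open>Fubini's theorem for a kernel that is symmetric in its two variables and of modulus
  one.\<close>

lemma fourier_mult_formula:
  assumes f: "integrable lborel f" and g: "integrable lborel g"
  shows "(LINT \<xi>|lborel. fourier f \<xi> * g \<xi>) = (LINT x|lborel. f x * fourier g x)"
proof -
  let ?F = "\<lambda>x \<xi>. cis (- (x \<bullet> \<xi>)) * f x * g \<xi>"
  have [measurable]: "f \<in> borel_measurable borel" "g \<in> borel_measurable borel" using f g by auto
  have cis [measurable]: "(\<lambda>p::(real^3) \<times> (real^3). cis (- (fst p \<bullet> snd p))) \<in> borel_measurable (borel \<Otimes>\<^sub>M borel)"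
    unfolding cis_conv_exp by measurable
  have "integrable (lborel \<Otimes>\<^sub>M lborel) (case_prod ?F)"
  proof (rule lborel_pair.Fubini_integrable)
    show "case_prod ?F \<in> borel_measurable (lborel \<Otimes>\<^sub>M lborel)"
      unfolding case_prod_unfold by measurable
    show "integrable lborel (\<lambda>x. LINT y|lborel. norm (case (x, y) of (x, \<xi>) \<Rightarrow> ?F x \<xi>))"
      using f by (simp add: norm_mult)
    show "AE x in lborel. integrable lborel (\<lambda>y. case (x, y) of (x, \<xi>) \<Rightarrow> ?F x \<xi>)"
    proof (rule AE_I2)
      fix x :: "real^3"
      have "integrable lborel (\<lambda>\<xi>. f x * (cis (- (\<xi> \<bullet> x)) * g \<xi>))"
        by (intro integrable_mult_right cis_mult_integrable g)
      then show "integrable lborel (\<lambda>y. case (x, y) of (x, \<xi>) \<Rightarrow> ?F x \<xi>)"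
        by (simp add: mult_ac inner_commute)
    qed
  qed
  then have "(LINT \<xi>|lborel. LINT x|lborel. ?F x \<xi>) = (LINT x|lborel. LINT \<xi>|lborel. ?F x \<xi>)"
    by (rule lborel_pair.Fubini_integral)
  moreover have "(LINT x|lborel. ?F x \<xi>) = (LINT x|lborel. cis (- (x \<bullet> \<xi>)) * f x) * g \<xi>" for \<xi>
    by simp
  moreover have "(LINT \<xi>|lborel. ?F x \<xi>) = f x * (LINT \<xi>|lborel. cis (- (\<xi> \<bullet> x)) * g \<xi>)" for x
    by (subst integral_mult_right_zero[symmetric]) (simp add: mult_ac inner_commute)
  ultimately have "(LINT \<xi>|lborel. (LINT x|lborel. cis (- (x \<bullet> \<xi>)) * f x) * g \<xi>)
      = (LINT x|lborel. f x * (LINT \<xi>|lborel. cis (- (\<xi> \<bullet> x)) * g \<xi>))" by simp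
  then show ?thesis
    unfolding fourier_def mult.assoc mult.left_commute[of "f _" "complex_of_real _"] by simp
qed

lemma integrable_scale:
  fixes f :: "real^3 \<Rightarrow> complex"
  assumes "integrable lborel f" "c \<noteq> 0"
  shows "integrable lborel (\<lambda>x. f (c *\<^sub>R x))"
proof -
  have [measurable]: "f \<in> borel_measurable borel" using assms(1) by auto
  have "integrable (density (distr lborel borel (\<lambda>x. 0 + c *\<^sub>R x)) (\<lambda>_. ennreal (\<bar>c\<bar> ^ DIM(real^3)))) f"
    using assms(1) lborel_affine[OF assms(2), of "0 :: real^3"] by simp
  then have "integrable (distr lborel borel (\<lambda>x. 0 + c *\<^sub>R x)) (\<lambda>x. (\<bar>c\<bar> ^ DIM(real^3)) *\<^sub>R f x)"
    by (subst (asm) integrable_density) auto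
  then have "integrable lborel (\<lambda>x. (\<bar>c\<bar> ^ 3) *\<^sub>R f (c *\<^sub>R x))"
    by (subst (asm) integrable_distr_eq) auto
  from integrable_scaleR_right[OF this, of "1 / \<bar>c\<bar> ^ 3"] show ?thesis using assms(2) by simp
qed

text \<open>Dilating \<open>g\<close> by \<open>c\<close> dilates its transform by
  \<open>1 / c\<close> with a factor \<open>1 / c ^ 3\<close>, which the substitution
  \<open>x = c *\<^sub>R y\<close> cancels. In effect the dilation moves from \<open>g\<close> to
  \<open>f\<close>.\<close>

lemma fourier_exchange:
  assumes f: "integrable lborel f" and g: "integrable lborel g" and c: "0 < c"
  shows "(LINT \<xi>|lborel. fourier f \<xi> * g (c *\<^sub>R \<xi>)) = (LINT y|lborel. f (c *\<^sub>R y) * fourier g y)"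
proof -
  have [measurable]: "f \<in> borel_measurable borel" "g \<in> borel_measurable borel" using f g by auto
  have mg [measurable]: "fourier g \<in> borel_measurable borel"
    unfolding fourier_def cis_conv_exp by measurable
  have "fourier (\<lambda>\<xi>. g (c *\<^sub>R \<xi>)) x = of_real (1 / c ^ 3) * fourier g ((1 / c) *\<^sub>R x)" for x
  proof -
    have "(LINT \<xi>|lborel. cis (- (\<xi> \<bullet> x)) * g (c *\<^sub>R \<xi>)) =
        (LINT \<xi>|lborel. cis (- ((c *\<^sub>R \<xi>) \<bullet> ((1 / c) *\<^sub>R x))) * g (c *\<^sub>R \<xi>))"
      using c by simp
    also have "\<dots> = of_real (1 / c ^ 3) * (LINT \<xi>|lborel. cis (- (\<xi> \<bullet> ((1 / c) *\<^sub>R x))) * g \<xi>)"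
      using c by (subst lborel_integral_scale[where f = "\<lambda>\<xi>. cis (- (\<xi> \<bullet> ((1 / c) *\<^sub>R x))) * g \<xi>"])
        (auto simp: cis_conv_exp)
    finally show ?thesis by (simp add: fourier_def mult_ac)
  qed
  moreover have "(LINT \<xi>|lborel. fourier f \<xi> * g (c *\<^sub>R \<xi>)) = (LINT x|lborel. f x * fourier (\<lambda>\<xi>. g (c *\<^sub>R \<xi>)) x)"
    using f g c by (intro fourier_mult_formula integrable_scale) auto
  ultimately have "(LINT \<xi>|lborel. fourier f \<xi> * g (c *\<^sub>R \<xi>)) =
      of_real (1 / c ^ 3) * (LINT x|lborel. f (c *\<^sub>R ((1 / c) *\<^sub>R x)) * fourier g ((1 / c) *\<^sub>R x))"
    using c by (subst integral_mult_right_zero[symmetric]) (simp add: mult_ac)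
  also have "\<dots> = (LINT y|lborel. f (c *\<^sub>R y) * fourier g y)"
    using c by (subst lborel_integral_scale[where f = "\<lambda>y. f (c *\<^sub>R y) * fourier g y"]) (auto simp: power_divide)
  finally show ?thesis .
qed

text \<open>Evaluating the exchange formula at scale \<open>c\<close> and letting \<open>c \<rightarrow> 0\<close> compares the transforms of
  two arbitrary functions at the origin; no explicit Gaussian is needed.\<close>

lemma inversion_at_0:
  assumes f: "integrable lborel f" "integrable lborel (fourier f)" "isCont f 0" "\<And>x. cmod (f x) \<le> M"
    and g: "schwartz g"
  shows "(LINT \<xi>|lborel. fourier f \<xi>) * g 0 = f 0 * (LINT \<xi>|lborel. fourier g \<xi>)"
proof -
  let ?c = "\<lambda>n. inverse (real (Suc n))"
  have c0: "?c \<longlonglongrightarrow> 0" by (rule LIMSEQ_inverse_real_of_nat)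
  have [measurable]: "f \<in> borel_measurable borel" "g \<in> borel_measurable borel" 
      "fourier f \<in> borel_measurable borel" "fourier g \<in> borel_measurable borel"
    using f schwartz_measurable[OF g] schwartz_measurable[OF schwartz_fourier[OF g]] by auto
  have cont: "isCont g 0"
    using schwartz_smooth[OF g] smooth_differentiable differentiable_imp_continuous_within by blast
  have lim0: "(\<lambda>n. h (?c n *\<^sub>R x)) \<longlonglongrightarrow> h 0" if "isCont h 0" for h :: "real^3 \<Rightarrow> complex" and x
  proof -
    have "(\<lambda>n. ?c n *\<^sub>R x) \<longlonglongrightarrow> 0 *\<^sub>R x" by (intro tendsto_intros c0)
    then show ?thesis using that by (auto simp: isCont_def intro: isCont_tendsto_compose[OF that])
  qed
  obtain B where B: "\<And>x. cmod (g x) \<le> B"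
    using schwartz_bound[OF g, of 0 "[]"] by auto
  have "(\<lambda>n. LINT \<xi>|lborel. fourier f \<xi> * g (?c n *\<^sub>R \<xi>)) \<longlonglongrightarrow> (LINT \<xi>|lborel. fourier f \<xi> * g 0)"
  proof (rule integral_dominated_convergence[where w = "\<lambda>\<xi>. cmod (fourier f \<xi>) * B"])
    show "integrable lborel (\<lambda>\<xi>. cmod (fourier f \<xi>) * B)" using f by auto
    show "AE \<xi> in lborel. norm (fourier f \<xi> * g (?c n *\<^sub>R \<xi>)) \<le> cmod (fourier f \<xi>) * B" for n
      using B by (auto simp: norm_mult intro!: mult_left_mono)
    show "AE \<xi> in lborel. (\<lambda>n. fourier f \<xi> * g (?c n *\<^sub>R \<xi>)) \<longlonglongrightarrow> fourier f \<xi> * g 0"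
      by (intro AE_I2 tendsto_mult_left lim0 cont)
  qed measurable
  moreover have "(\<lambda>n. LINT y|lborel. f (?c n *\<^sub>R y) * fourier g y) \<longlonglongrightarrow> (LINT y|lborel. f 0 * fourier g y)"
  proof (rule integral_dominated_convergence[where w = "\<lambda>\<xi>. M * cmod (fourier g \<xi>)"])
    show "integrable lborel (\<lambda>\<xi>. M * cmod (fourier g \<xi>))"
      using schwartz_integrable[OF schwartz_fourier[OF g]] by auto
    show "AE \<xi> in lborel. norm (f (?c n *\<^sub>R \<xi>) * fourier g \<xi>) \<le> M * cmod (fourier g \<xi>)" for n
      using f(4) by (auto simp: norm_mult intro!: mult_right_mono)
    show "AE \<xi> in lborel. (\<lambda>n. f (?c n *\<^sub>R \<xi>) * fourier g \<xi>) \<longlonglongrightarrow> f 0 * fourier g \<xi>"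
      by (intro AE_I2 tendsto_mult_right lim0 f)
  qed measurable
  moreover have "(LINT \<xi>|lborel. fourier f \<xi> * g (?c n *\<^sub>R \<xi>)) = (LINT y|lborel. f (?c n *\<^sub>R y) * fourier g y)" for n
    by (intro fourier_exchange f schwartz_integrable g) simp
  ultimately have "(LINT \<xi>|lborel. fourier f \<xi> * g 0) = (LINT y|lborel. f 0 * fourier g y)"
    using LIMSEQ_unique by simp
  then show ?thesis by simp
qed

text \<open>Translation turns the value of \<open>f\<close> at \<open>- x\<close> into a value at
  the origin and modulates the transform. The integral of the modulated transform is, up to
  normalisation, the second transform at \<open>x\<close>.\<close>

lemma fourier_fourier_mult:
  assumes f: "schwartz f" and g: "schwartz g"
  shows "fourier (fourier f) x * g 0 = f (- x) * (of_real (1 / (2 * pi) ^ 3) * (LINT \<xi>|lborel. fourier g \<xi>))"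
proof -
  let ?h = "\<lambda>y. f (- x + y)"
  have mf: "f \<in> borel_measurable borel" by (rule schwartz_measurable[OF f])
  have Fh: "fourier ?h \<xi> = cis (- (\<xi> \<bullet> x)) * fourier f \<xi>" for \<xi>
    using fourier_translate[OF mf, of "- x" \<xi>] by (simp add: inner_commute)
  obtain B where B: "\<And>x. cmod (f x) \<le> B" using schwartz_bound[OF f, of 0 "[]"] by auto
  have "(LINT \<xi>|lborel. fourier ?h \<xi>) * g 0 = ?h 0 * (LINT \<xi>|lborel. fourier g \<xi>)"
  proof (rule inversion_at_0[OF _ _ _ _ g])
    show "integrable lborel ?h" using schwartz_integrable[OF f] lborel_integrable_translate[OF mf] by blast
    show "integrable lborel (fourier ?h)"
      unfolding Fh by (intro cis_mult_integrable schwartz_integrable schwartz_fourier f)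
    have c: "isCont f (- x + 0)"
      using schwartz_smooth[OF f] smooth_differentiable differentiable_imp_continuous_within by blast
    have "isCont (\<lambda>y. - x + y) 0" by (intro continuous_intros)
    from isCont_o2[OF this c] show "isCont ?h 0" .
    show "cmod (?h y) \<le> B" for y by (rule B)
  qed
  then have "(LINT \<xi>|lborel. cis (- (\<xi> \<bullet> x)) * fourier f \<xi>) * g 0 = f (- x) * (LINT \<xi>|lborel. fourier g \<xi>)"
    unfolding Fh by simp
  then show ?thesis unfolding fourier_def[of "fourier f"] by simp
qed

lemma continuous_AE_zero:
  fixes f :: "real^3 \<Rightarrow> complex"
  assumes "continuous_on UNIV f" "AE x in lborel. f x = 0"
  shows "f x = 0"
proof -
  have o: "open {x. f x \<noteq> 0}" using assms(1) by (intro open_Collect_neq continuous_on_const)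
  have "{x. f x \<noteq> 0} \<in> null_sets lborel"
    using assms(2) o by (simp add: AE_iff_null)
  then have "{x. f x \<noteq> 0} \<in> null_sets lebesgue" by (rule null_sets_completionI)
  then have "negligible {x. f x \<noteq> 0}" by (simp add: negligible_iff_null_sets)
  then show ?thesis using o open_not_negligible by blast
qed

text \<open>The value of \<open>c\<close> is left open: later arguments divide by it, and rely only
  on its being nonzero and common to all Schwartz functions.\<close>

lemma fourier_inversion:
  obtains c where "c \<noteq> 0" and "\<And>f x. schwartz f \<Longrightarrow> fourier (fourier f) x = c * f (- x)"
proof -
  define r where "r = box_bump 1 (- 1) 1"
  define g where "g x = complex_of_real (r x)" for x
  define J where "J = of_real (1 / (2 * pi) ^ 3) * (LINT \<xi>|lborel. fourier g \<xi>)"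
  have g: "schwartz g" unfolding g_def r_def by (intro test_function_schwartz test_function_box_bump)
  have g0: "g 0 \<noteq> 0" by (simp add: g_def r_def box_bump_def bump_def)
  have even: "g (- x) = g x" for x
    by (simp add: g_def r_def box_bump_def mult.commute) (simp add: add.commute)
  have J: "fourier (fourier f) x * g 0 = f (- x) * J" if "schwartz f" for f x
    unfolding J_def by (rule fourier_fourier_mult[OF that g])
  \<comment> \<open>If \<open>J = 0\<close>, the second transform of \<open>g\<close> vanishes. As
    \<open>g\<close> is real and even, its transform is real, so the multiplication formula makes
    the integral of its square zero, and the transform itself is zero. At the origin it is a
    positive multiple of the integral of \<open>g\<close>, which is then a contradiction to
    \<open>g\<close> being nonnegative, continuous and nonzero at 0.\<close>
  have "J \<noteq> 0"
  proof
    assume J0: "J = 0"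
    have mg: "g \<in> borel_measurable borel" by (rule schwartz_measurable[OF g])
    have real: "cnj (fourier g \<xi>) = fourier g \<xi>" for \<xi>
    proof -
      have "cnj (LINT x|lborel. cis (- (x \<bullet> \<xi>)) * g x) = (LINT x|lborel. cis (x \<bullet> \<xi>) * g x)"
        by (subst Bochner_Integration.integral_cnj[symmetric]) (simp add: cis_cnj g_def)
      also have "\<dots> = (LINT x|lborel. cis ((-1 *\<^sub>R x) \<bullet> \<xi>) * g (-1 *\<^sub>R x))"
        using lborel_integral_scale[of "\<lambda>x. cis (x \<bullet> \<xi>) * g x" "-1"] mg by (simp add: cis_conv_exp)
      also have "\<dots> = (LINT x|lborel. cis (- (x \<bullet> \<xi>)) * g x)" by (simp add: even)
      finally show ?thesis by (simp add: fourier_def)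
    qed
    have "fourier (fourier g) x = 0" for x using J[OF g, of x] J0 g0 by simp
    then have "(LINT \<xi>|lborel. fourier g \<xi> * fourier g \<xi>) = 0"
      using fourier_mult_formula[OF schwartz_integrable[OF g] schwartz_integrable[OF schwartz_fourier[OF g]]] by simp
    moreover have sq: "fourier g \<xi> * fourier g \<xi> = of_real ((cmod (fourier g \<xi>))\<^sup>2)" for \<xi>
      using complex_norm_square[of "fourier g \<xi>"] by (simp add: real)
    ultimately have "(LINT \<xi>|lborel. complex_of_real ((cmod (fourier g \<xi>))\<^sup>2)) = 0" by (simp only:)
    then have zero: "(LINT \<xi>|lborel. (cmod (fourier g \<xi>))\<^sup>2) = 0"
      by (simp only: integral_complex_of_real of_real_eq_0_iff)
    have "integrable lborel (\<lambda>\<xi>. (cmod (fourier g \<xi>))\<^sup>2)"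
    proof -
      obtain B where B: "\<And>\<xi>. cmod (fourier g \<xi>) \<le> B"
        using schwartz_bound[OF schwartz_fourier[OF g], of 0 "[]"] by auto
      have m: "fourier g \<in> borel_measurable borel" by (intro schwartz_measurable schwartz_fourier g)
      show ?thesis
      proof (rule Bochner_Integration.integrable_bound[where f = "\<lambda>\<xi>. B * cmod (fourier g \<xi>)"])
        show "integrable lborel (\<lambda>\<xi>. B * cmod (fourier g \<xi>))"
          by (intro integrable_mult_right integrable_norm schwartz_integrable schwartz_fourier g)
        have "0 \<le> B" using B[of 0] norm_ge_zero order_trans by blast
        then show "AE \<xi> in lborel. norm ((cmod (fourier g \<xi>))\<^sup>2) \<le> norm (B * cmod (fourier g \<xi>))"
          using B by (auto simp: power2_eq_square abs_mult intro!: mult_right_mono)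
      qed (use m in measurable)
    qed
    then have "AE \<xi> in lborel. fourier g \<xi> = 0"
      using integral_nonneg_eq_0_iff_AE[of lborel "\<lambda>\<xi>. (cmod (fourier g \<xi>))\<^sup>2"] zero by simp
    then have "fourier g 0 = 0"
      by (rule continuous_AE_zero[rotated]) (intro smooth_continuous fourier_smooth g)
    then have "(LINT x|lborel. g x) = 0" by (simp add: fourier_def)
    then have "(LINT x|lborel. r x) = 0" by (simp add: g_def)
    moreover have "integrable lborel r" using integrable_norm[OF schwartz_integrable[OF g]] box_bump_bounds
      by (simp add: g_def r_def)
    ultimately have "AE x in lborel. g x = 0"
      using integral_nonneg_eq_0_iff_AE[of lborel r] box_bump_bounds by (simp add: g_def r_def)
    then have "g 0 = 0" by (rule continuous_AE_zero[rotated]) (intro smooth_continuous schwartz_smooth g)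
    then show False using g0 by simp
  qed
  show ?thesis
  proof (rule that[of "J / g 0"])
    show "J / g 0 \<noteq> 0" using \<open>J \<noteq> 0\<close> g0 by simp
    show "fourier (fourier f) x = J / g 0 * f (- x)" if "schwartz f" for f x
      using J[OF that, of x] g0 by (simp add: field_simps)
  qed
qed

section \<open>Tempered distributions with a given Fourier transform\<close>


definition vanishing :: "(nat \<Rightarrow> real^3 \<Rightarrow> complex) \<Rightarrow> bool" where
  "vanishing m \<longleftrightarrow> (\<forall>n. smooth (m n)) \<and>
     (\<forall>is. \<exists>B. \<forall>n x. cmod (iterated_deriv is (m n) x) \<le> B * (1 + norm x) / real (Suc n))"

lemma vanishing_partial:
  assumes "vanishing m"
  shows "vanishing (\<lambda>n. partial_deriv j (m n))"
  unfolding vanishing_def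
proof (intro conjI allI)
  show "smooth (partial_deriv j (m n))" for n
    using assms by (auto simp: vanishing_def intro: smooth_partial_deriv)
  fix "is"
  show "\<exists>B. \<forall>n x. cmod (iterated_deriv is (partial_deriv j (m n)) x) \<le> B * (1 + norm x) / real (Suc n)"
    using assms unfolding vanishing_def iterated_deriv_snoc[symmetric] by blast
qed

text \<open>The Leibniz rule, by induction on the innermost derivative. Both \<open>f\<close> and
  \<open>m\<close> stay arbitrary because either of them may be the one that is differentiated. The
  linear growth of the multipliers is paid for in the base case by one more power of the
  weight.\<close>

lemma vanishing_mult_schwartz:
  assumes "schwartz f" "vanishing m"
  shows "\<exists>B. \<forall>n x. (1 + norm x) ^ k * cmod (iterated_deriv is (\<lambda>x. f x * m n x) x) \<le> B / real (Suc n)"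
  using assms
proof (induction "is" arbitrary: f m rule: rev_induct)
  case Nil
  obtain A where A: "\<And>x. (1 + norm x) ^ (k + 1) * cmod (iterated_deriv [] f x) \<le> A"
    using schwartz_bound[OF Nil(1)] by blast
  obtain B where B: "\<And>n x. cmod (iterated_deriv [] (m n) x) \<le> B * (1 + norm x) / real (Suc n)"
    using Nil(2) unfolding vanishing_def by metis
  have "0 \<le> B" using order_trans[OF norm_ge_zero B[of 0 0]] by simp
  have "(1 + norm x) ^ k * cmod (f x * m n x) \<le> (A * B) / real (Suc n)" for n x
  proof -
    have "(1 + norm x) ^ k * cmod (f x * m n x) \<le> (1 + norm x) ^ k * (cmod (f x) * (B * (1 + norm x) / real (Suc n)))"
      unfolding norm_mult using B[of n x] by (intro mult_left_mono) auto
    also have "\<dots> = ((1 + norm x) ^ (k + 1) * cmod (f x)) * (B / real (Suc n))" by simp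
    also have "\<dots> \<le> A * (B / real (Suc n))"
      using A[of x] \<open>0 \<le> B\<close> by (intro mult_right_mono) auto
    finally show ?thesis by simp
  qed
  then show ?case by (intro exI[of _ "A * B"]) simp
next
  case (snoc j "is")
  note fs = schwartz_smooth[OF snoc(2)]
  have ms: "smooth (m n)" for n using snoc(3) by (simp add: vanishing_def)
  obtain A where A: "\<And>n x. (1 + norm x) ^ k * cmod (iterated_deriv is (\<lambda>x. partial_deriv j f x * m n x) x) \<le> A / real (Suc n)"
    using snoc(1)[OF schwartz_partial[OF snoc(2)] snoc(3)] by blast
  obtain B where B: "\<And>n x. (1 + norm x) ^ k * cmod (iterated_deriv is (\<lambda>x. f x * partial_deriv j (m n) x) x) \<le> B / real (Suc n)"
    using snoc(1)[OF snoc(2) vanishing_partial[OF snoc(3)]] by blast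
  have "(1 + norm x) ^ k * cmod (iterated_deriv (is @ [j]) (\<lambda>x. f x * m n x) x) \<le> (A + B) / real (Suc n)" for n x
  proof -
    have "partial_deriv j (\<lambda>x. f x * m n x) = (\<lambda>x. partial_deriv j f x * m n x + f x * partial_deriv j (m n) x)"
      by (intro ext partial_deriv_mult smooth_differentiable fs ms)
    then have "iterated_deriv (is @ [j]) (\<lambda>x. f x * m n x) x =
        iterated_deriv is (\<lambda>x. partial_deriv j f x * m n x) x + iterated_deriv is (\<lambda>x. f x * partial_deriv j (m n) x) x"
      unfolding iterated_deriv_snoc by (simp add: iterated_deriv_add smooth_mult smooth_partial_deriv fs ms)
    then have "(1 + norm x) ^ k * cmod (iterated_deriv (is @ [j]) (\<lambda>x. f x * m n x) x) \<le>
      (1 + norm x) ^ k * (cmod (iterated_deriv is (\<lambda>x. partial_deriv j f x * m n x) x) +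
        cmod (iterated_deriv is (\<lambda>x. f x * partial_deriv j (m n) x) x))"
      by (intro mult_left_mono) (auto intro: norm_triangle_ineq)
    also have "\<dots> \<le> A / real (Suc n) + B / real (Suc n)"
      unfolding distrib_left by (intro add_mono A B)
    finally show ?thesis by (simp add: add_divide_distrib)
  qed
  then show ?case by blast
qed

lemma schwartz_lipschitz:
  assumes "schwartz f"
  obtains L where "\<And>x y. cmod (f x - f y) \<le> L * norm (x - y)"
proof -
  have "\<forall>i. \<exists>B. \<forall>x. cmod (partial_deriv i f x) \<le> B"
  proof
    fix i show "\<exists>B. \<forall>x. cmod (partial_deriv i f x) \<le> B"
      using schwartz_bound[OF assms, of 0 "[i]"] by simp
  qed
  then obtain B where B: "\<And>i x. cmod (partial_deriv i f x) \<le> B i" by metis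
  have D: "(f has_derivative frechet_derivative f (at x)) (at x)" for x
    using smooth_differentiable[OF schwartz_smooth[OF assms]] by (simp add: frechet_derivative_works)
  have on: "onorm (frechet_derivative f (at x)) \<le> (\<Sum>i\<in>UNIV. B i)" for x
  proof (rule onorm_le)
    fix h :: "real^3"
    have lin: "linear (frechet_derivative f (at x))" using D has_derivative_linear by blast
    have "h = (\<Sum>i\<in>UNIV. h $ i *\<^sub>R axis i 1)"
      using basis_expansion[of h] by (simp add: scalar_mult_eq_scaleR)
    then have "frechet_derivative f (at x) h = frechet_derivative f (at x) (\<Sum>i\<in>UNIV. h $ i *\<^sub>R axis i 1)"
      by simp
    also have "\<dots> = (\<Sum>i\<in>UNIV. h $ i *\<^sub>R partial_deriv i f x)"
      unfolding linear_sum[OF lin] linear_scale[OF lin] partial_deriv_def ..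
    also have "norm \<dots> \<le> (\<Sum>i\<in>UNIV. norm h * B i)"
      by (intro sum_norm_le) (auto intro!: mult_mono B component_le_norm_cart)
    finally show "norm (frechet_derivative f (at x) h) \<le> (\<Sum>i\<in>UNIV. B i) * norm h"
      by (simp add: sum_distrib_left mult.commute)
  qed
  have "cmod (f x - f y) \<le> (\<Sum>i\<in>UNIV. B i) * norm (x - y)" for x y
    by (rule differentiable_bound[where S = UNIV and f' = "\<lambda>x. frechet_derivative f (at x)"])
      (use D on in auto)
  then show ?thesis by (rule that)
qed

lemma iterated_deriv_const: "is \<noteq> [] \<Longrightarrow> iterated_deriv is (\<lambda>x. c) = (\<lambda>x. 0)"
proof (induction "is")
  case (Cons i "is")
  then show ?case by (cases "is = []") auto
qed simp

text \<open>The cut-offs are dilates of one bump \<open>h\<close> with \<open>h 0 = 1\<close>.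
  Without derivatives, 1 minus the dilate is controlled by the Lipschitz bound at the origin;
  otherwise every derivative contributes a factor \<open>1 / real (Suc n)\<close>, of which one is
  kept.\<close>

lemma cutoff_exists:
  obtains \<theta> where "\<And>n. test_function (\<theta> n)" and "vanishing (\<lambda>n x. 1 + -1 * \<theta> n x)"
proof -
  define g where "g = (\<lambda>x. complex_of_real (box_bump 1 (- 1) 1 x))"
  define h where "h = (\<lambda>x. (1 / g 0) * g x)"
  have g: "test_function g" unfolding g_def by (rule test_function_box_bump)
  have g0: "g 0 \<noteq> 0" by (simp add: g_def box_bump_def bump_def)
  have h: "test_function h" unfolding h_def by (intro test_function_mult g smooth_const)
  have h0: "h 0 = 1" using g0 by (simp add: h_def)
  have hs: "schwartz h" by (rule test_function_schwartz[OF h])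
  define c where "c n = 1 / real (Suc n)" for n
  have c: "0 < c n" "c n \<le> 1" for n by (auto simp: c_def)
  define \<theta> where "\<theta> n x = h (c n *\<^sub>R x)" for n x
  have smooth: "smooth (\<theta> n)" for n
    unfolding \<theta>_def by (intro smooth_scale schwartz_smooth hs)
  have "test_function (\<theta> n)" for n
  proof -
    have "{x. \<theta> n x \<noteq> 0} \<subseteq> (\<lambda>y. (1 / c n) *\<^sub>R y) ` {y. h y \<noteq> 0}"
    proof
      fix x assume "x \<in> {x. \<theta> n x \<noteq> 0}"
      then show "x \<in> (\<lambda>y. (1 / c n) *\<^sub>R y) ` {y. h y \<noteq> 0}"
        using c[of n] by (intro image_eqI[of _ _ "c n *\<^sub>R x"]) (auto simp: \<theta>_def)
    qed
    moreover have "bounded {y. h y \<noteq> 0}"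
      using h compact_imp_bounded bounded_subset[OF _ closure_subset] unfolding test_function_def by blast
    ultimately have "bounded {x. \<theta> n x \<noteq> 0}"
      using bounded_scaling bounded_subset by blast
    then show ?thesis by (simp add: test_function_def smooth compact_closure)
  qed
  moreover have "vanishing (\<lambda>n x. 1 + -1 * \<theta> n x)"
    unfolding vanishing_def
  proof (intro conjI allI)
    show "smooth (\<lambda>x. 1 + -1 * \<theta> n x)" for n by (intro smooth_add smooth_mult smooth_const smooth)
    fix "is" :: "3 list"
    show "\<exists>B. \<forall>n x. cmod (iterated_deriv is (\<lambda>x. 1 + -1 * \<theta> n x) x) \<le> B * (1 + norm x) / real (Suc n)"
    proof (cases "is = []")
      case True
      obtain L where L: "\<And>x y. cmod (h x - h y) \<le> L * norm (x - y)" using schwartz_lipschitz[OF hs] by blast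
      have "0 \<le> L" using order_trans[OF norm_ge_zero L[of "axis 1 1" 0]] by simp
      have "cmod (1 + -1 * \<theta> n x) \<le> L * (1 + norm x) / real (Suc n)" for n x
      proof -
        have "cmod (1 + -1 * \<theta> n x) \<le> L * norm (0 - c n *\<^sub>R x)"
          using L[of 0 "c n *\<^sub>R x"] by (simp add: h0 \<theta>_def)
        also have "\<dots> = L * norm x / real (Suc n)" by (simp add: c_def)
        also have "\<dots> \<le> L * (1 + norm x) / real (Suc n)"
          using \<open>0 \<le> L\<close> by (intro divide_right_mono mult_left_mono) auto
        finally show ?thesis .
      qed
      then show ?thesis unfolding True by (intro exI[of _ L]) simp
    next
      case False
      then obtain l where l: "length is = Suc l" by (cases "is") auto
      obtain B where B: "\<And>x. cmod (iterated_deriv is h x) \<le> B"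
        using schwartz_bound[OF hs, of 0 "is"] by auto
      have "0 \<le> B" using B norm_ge_zero order_trans by blast
      have "cmod (iterated_deriv is (\<lambda>x. 1 + -1 * \<theta> n x) x) \<le> B * (1 + norm x) / real (Suc n)" for n x
      proof -
        have "iterated_deriv is (\<lambda>x. 1 + -1 * \<theta> n x) x = iterated_deriv is (\<lambda>x. 1) x + -1 * iterated_deriv is (\<theta> n) x"
          by (simp only: iterated_deriv_add[OF smooth_const smooth_mult[OF smooth_const smooth]]
              iterated_deriv_cmult[OF smooth])
        also have "\<dots> = - (c n ^ length is *\<^sub>R iterated_deriv is h (c n *\<^sub>R x))"
          using iterated_deriv_scale[OF schwartz_smooth[OF hs], of "is" "c n"] False
          by (simp add: iterated_deriv_const \<theta>_def[abs_def])
        also have "cmod \<dots> = c n * (c n ^ l * cmod (iterated_deriv is h (c n *\<^sub>R x)))"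
          using c[of n] by (simp add: l)
        also have "\<dots> \<le> c n * (1 * (B * (1 + norm x)))"
        proof (intro mult_left_mono mult_mono)
          show "c n ^ l \<le> 1" using c[of n] by (intro power_le_one) auto
          have "B \<le> B * (1 + norm x)" using \<open>0 \<le> B\<close> by (simp add: distrib_left)
          then show "cmod (iterated_deriv is h (c n *\<^sub>R x)) \<le> B * (1 + norm x)" using B order_trans by blast
        qed (use c[of n] in auto)
        finally show ?thesis by (simp add: c_def)
      qed
      then show ?thesis by blast
    qed
  qed
  ultimately show ?thesis by (rule that)
qed

text \<open>Multiplying \<open>f\<close> by the cut-offs leaves an error that is \<open>f\<close>
  times a vanishing multiplier.\<close>

lemma test_functions_dense:
  assumes f: "schwartz f"
  obtains g where "\<And>n. test_function (g n)"
    and "\<And>N. (\<lambda>n. schwartz_seminorm N (\<lambda>x. f x + -1 * g n x)) \<longlonglongrightarrow> 0"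
proof -
  obtain \<theta> where \<theta>: "\<And>n. test_function (\<theta> n)" and v: "vanishing (\<lambda>n x. 1 + -1 * \<theta> n x)"
    using cutoff_exists by blast
  have t: "test_function (\<lambda>x. f x * \<theta> n x)" for n
    by (intro test_function_mult schwartz_smooth f \<theta>)
  have "(\<lambda>n. schwartz_seminorm N (\<lambda>x. f x + -1 * (f x * \<theta> n x))) \<longlonglongrightarrow> 0" for N
  proof -
    have eq: "(\<lambda>x. f x + -1 * (f x * \<theta> n x)) = (\<lambda>x. f x * (1 + -1 * \<theta> n x))" for n
      by (auto simp: algebra_simps)
    have s: "schwartz (\<lambda>x. f x + -1 * (f x * \<theta> n x))" for n
      by (intro schwartz_add schwartz_cmult f test_function_schwartz t)
    have "\<forall>is. \<exists>B. \<forall>n x. (1 + norm x) ^ N * cmod (iterated_deriv is (\<lambda>x. f x * (1 + -1 * \<theta> n x)) x) \<le> B / real (Suc n)"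
      using vanishing_mult_schwartz[OF f v] by blast
    then obtain B where B: "\<And>is n x. (1 + norm x) ^ N * cmod (iterated_deriv is (\<lambda>x. f x * (1 + -1 * \<theta> n x)) x) \<le> B is / real (Suc n)"
      by metis
    define M where "M = Max (B ` {is. length is \<le> N})"
    have le: "schwartz_seminorm N (\<lambda>x. f x + -1 * (f x * \<theta> n x)) \<le> M * inverse (real (Suc n))" for n
    proof (rule seminorm_least)
      fix "is" x assume "length (is :: 3 list) \<le> N"
      then have "B is \<le> M" unfolding M_def using finite_lists_le by (intro Max_ge) auto
      then have "B is / real (Suc n) \<le> M * inverse (real (Suc n))" by (simp add: divide_inverse mult_right_mono)
      then show "(1 + norm x) ^ N * cmod (iterated_deriv is (\<lambda>x. f x + -1 * (f x * \<theta> n x)) x) \<le> M * inverse (real (Suc n))"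
        unfolding eq using B[of x "is" n] by linarith
    qed
    have "(\<lambda>n. M * inverse (real (Suc n))) \<longlonglongrightarrow> M * 0"
      by (intro tendsto_mult_left LIMSEQ_inverse_real_of_nat)
    then have "(\<lambda>n. M * inverse (real (Suc n))) \<longlonglongrightarrow> 0" by simp
    moreover have "\<forall>n. norm (schwartz_seminorm N (\<lambda>x. f x + -1 * (f x * \<theta> n x))) \<le> M * inverse (real (Suc n))"
      using le seminorm_nonneg[OF s, of N] by (simp only: real_norm_def abs_of_nonneg) blast
    ultimately show ?thesis by (rule Lim_null_comparison[OF always_eventually, rotated])
  qed
  with t show ?thesis by (rule that)
qed

section \<open>Distributions are determined by their transforms\<close>

lemma tempered_linear:
  "tempered T \<Longrightarrow> schwartz f \<Longrightarrow> schwartz g \<Longrightarrow> T (\<lambda>x. a * f x + b * g x) = a * T f + b * T g"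
  by (simp add: tempered_def)

lemma tempered_fourier_limit:
  assumes T: "tempered T" and f: "schwartz f" and g: "\<And>n. schwartz (g n)"
    and lim: "\<And>N. (\<lambda>n. schwartz_seminorm N (\<lambda>x. f x + -1 * g n x)) \<longlonglongrightarrow> 0"
  shows "(\<lambda>n. T (fourier (g n))) \<longlonglongrightarrow> T (fourier f)"
proof -
  obtain C N where C: "\<And>f. schwartz f \<Longrightarrow> cmod (T f) \<le> C * schwartz_seminorm N f"
    using T unfolding tempered_def by blast
  have "seminorm_dominated (\<lambda>f (x::unit). schwartz_seminorm N (fourier f))"
    using schwartz_continuous_fourier by (auto simp: schwartz_continuous_def)
  then obtain D M where D: "\<And>f. schwartz f \<Longrightarrow> schwartz_seminorm N (fourier f) \<le> D * schwartz_seminorm M f"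
    unfolding seminorm_dominated_def by blast
  have le: "cmod (T (fourier f) - T (fourier (g n))) \<le> \<bar>C\<bar> * (D * schwartz_seminorm M (\<lambda>x. f x + -1 * g n x))" for n
  proof -
    let ?d = "\<lambda>x. f x + -1 * g n x"
    have d: "schwartz ?d" by (intro schwartz_add schwartz_cmult f g)
    have "fourier ?d = (\<lambda>\<xi>. 1 * fourier f \<xi> + -1 * fourier (g n) \<xi>)"
      using fourier_add[OF schwartz_integrable[OF f] schwartz_integrable[OF schwartz_cmult[OF g[of n], of "-1"]]]
        fourier_cmult[of "-1" "g n"] by simp
    then have "T (fourier ?d) = T (fourier f) - T (fourier (g n))"
      using tempered_linear[OF T schwartz_fourier[OF f] schwartz_fourier[OF g[of n]], of 1 "-1"] by simp
    then have "cmod (T (fourier f) - T (fourier (g n))) = cmod (T (fourier ?d))" by simp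
    also have "\<dots> \<le> C * schwartz_seminorm N (fourier ?d)" by (intro C schwartz_fourier d)
    also have "\<dots> \<le> \<bar>C\<bar> * schwartz_seminorm N (fourier ?d)"
      by (intro mult_right_mono seminorm_nonneg schwartz_fourier d) auto
    also have "\<dots> \<le> \<bar>C\<bar> * (D * schwartz_seminorm M ?d)" by (intro mult_left_mono D d) auto
    finally show ?thesis .
  qed
  have "(\<lambda>n. \<bar>C\<bar> * (D * schwartz_seminorm M (\<lambda>x. f x + -1 * g n x))) \<longlonglongrightarrow> \<bar>C\<bar> * (D * 0)"
    by (intro tendsto_mult_left lim)
  then have "(\<lambda>n. \<bar>C\<bar> * (D * schwartz_seminorm M (\<lambda>x. f x + -1 * g n x))) \<longlonglongrightarrow> 0"
    unfolding mult_zero_right .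
  moreover have "\<forall>n. cmod (T (fourier f) - T (fourier (g n))) \<le> \<bar>C\<bar> * (D * schwartz_seminorm M (\<lambda>x. f x + -1 * g n x))"
    using le by blast
  ultimately have "(\<lambda>n. T (fourier f) - T (fourier (g n))) \<longlonglongrightarrow> 0"
    by (rule Lim_null_comparison[OF always_eventually, rotated])
  from tendsto_diff[OF tendsto_const[of "T (fourier f)"] this] show ?thesis by simp
qed

lemma tempered_eqI:
  assumes T: "tempered T" and U: "tempered U"
    and eq: "\<And>\<psi>. test_function \<psi> \<Longrightarrow> fourier_dist T \<psi> = fourier_dist U \<psi>"
  shows "T = U"
proof
  fix f
  have F: "T (fourier f) = U (fourier f)" if f: "schwartz f" for f
  proof -
    obtain g where g: "\<And>n. test_function (g n)"
      "\<And>N. (\<lambda>n. schwartz_seminorm N (\<lambda>x. f x + -1 * g n x)) \<longlonglongrightarrow> 0"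
      using test_functions_dense[OF f] by blast
    note gs = test_function_schwartz[OF g(1)]
    have "T (fourier (g n)) = U (fourier (g n))" for n
      using eq[OF g(1)] by (simp add: fourier_dist_def gs)
    then show ?thesis
      using tempered_fourier_limit[OF T f gs g(2)] tempered_fourier_limit[OF U f gs g(2)] LIMSEQ_unique by simp
  qed
  show "T f = U f"
  proof (cases "schwartz f")
    case False
    then show ?thesis using T U by (simp add: tempered_def)
  next
    case True
    obtain c where c: "c \<noteq> 0" "\<And>f x. schwartz f \<Longrightarrow> fourier (fourier f) x = c * f (- x)"
      using fourier_inversion by blast
    \<comment> \<open>Four transforms amount to multiplication by \<open>c\<^sup>2\<close>, so
      \<open>f\<close> is, up to this factor, the transform of its threefold transform.\<close>
    define h where "h = fourier (fourier (fourier f))"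
    have h: "schwartz h" unfolding h_def by (intro schwartz_fourier True)
    have "fourier h x = c\<^sup>2 * f x" for x
      using c(2)[OF schwartz_fourier[OF schwartz_fourier[OF True]], of x] c(2)[OF True, of "- x"]
      by (simp add: h_def power2_eq_square)
    \<comment> \<open>The second summand has coefficient 0; it brings \<open>f\<close> into the
      two-term form in which linearity is stated.\<close>
    then have eq: "(\<lambda>x. 1 / c\<^sup>2 * fourier h x + 0 * fourier h x) = f"
      using c(1) by (simp add: fun_eq_iff)
    have "V f = 1 / c\<^sup>2 * V (fourier h)" if "tempered V" for V
      using tempered_linear[OF that schwartz_fourier[OF h] schwartz_fourier[OF h], of "1 / c\<^sup>2" 0, unfolded eq] by simp
    from this[OF T] this[OF U] show ?thesis using F[OF h] by simp
  qed
qed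

lemma locally_integrable_if_moderate:
  assumes [measurable]: "v \<in> borel_measurable borel"
    and int: "integrable lborel (\<lambda>\<xi>. v \<xi> / of_real ((1 + norm \<xi>) ^ M))"
  shows "locally_integrable v"
  unfolding locally_integrable_def
proof (intro conjI allI impI)
  fix K :: "(real^3) set" assume K: "compact K"
  then have "bounded K" by (rule compact_imp_bounded)
  then obtain R where R: "\<And>x. x \<in> K \<Longrightarrow> norm x \<le> R" by (auto simp: bounded_iff)
  have [measurable]: "K \<in> sets borel" using K by (simp add: borel_compact)
  show "set_integrable lborel K v"
    unfolding set_integrable_def
  proof (rule Bochner_Integration.integrable_bound)
    show "integrable lborel (\<lambda>\<xi>. of_real ((1 + R) ^ M) * (v \<xi> / of_real ((1 + norm \<xi>) ^ M)))"
      by (rule integrable_mult_right[OF int])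
    show "AE \<xi> in lborel. norm (indicat_real K \<xi> *\<^sub>R v \<xi>) \<le> norm (of_real ((1 + R) ^ M) * (v \<xi> / of_real ((1 + norm \<xi>) ^ M)))"
    proof (rule AE_I2)
      fix \<xi> :: "real^3"
      have pos: "0 < (1 + norm \<xi>) ^ M" by (intro zero_less_power add_pos_nonneg) auto
      show "norm (indicat_real K \<xi> *\<^sub>R v \<xi>) \<le> norm (of_real ((1 + R) ^ M) * (v \<xi> / of_real ((1 + norm \<xi>) ^ M)))"
      proof (cases "\<xi> \<in> K")
        case True
        have "(1 + norm \<xi>) ^ M \<le> (1 + R) ^ M" using R[OF True] by (intro power_mono) auto
        then have "1 \<le> (1 + R) ^ M / (1 + norm \<xi>) ^ M" using pos by simp
        then have "1 \<le> \<bar>(1 + R) ^ M / (1 + norm \<xi>) ^ M\<bar>" by linarith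
        then have "1 * norm (v \<xi>) \<le> \<bar>(1 + R) ^ M / (1 + norm \<xi>) ^ M\<bar> * norm (v \<xi>)"
          by (intro mult_right_mono) auto
        then show ?thesis
          using True pos unfolding norm_mult norm_divide norm_of_real by (simp add: abs_divide)
      qed simp
    qed
  qed measurable
qed simp

text \<open>\<open>T\<close> is dictated by inversion: on a transform \<open>fourier \<psi>\<close>,
  the reflection and the constant \<open>c\<close> cancel, and what remains is the integral of
  \<open>\<psi>\<close> against \<open>v\<close>. Continuity holds because the weight of order
  \<open>M\<close> is absorbed by a weighted bound on \<open>fourier f\<close>.\<close>

lemma tempered_of_fourier_transform:
  assumes [measurable]: "v \<in> borel_measurable borel"
    and int: "integrable lborel (\<lambda>\<xi>. v \<xi> / of_real ((1 + norm \<xi>) ^ M))"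
  obtains T where "tempered T" "represents v (fourier_dist T)"
proof -
  obtain c where c: "c \<noteq> 0" "\<And>f x. schwartz f \<Longrightarrow> fourier (fourier f) x = c * f (- x)"
    using fourier_inversion by blast
  define T where "T f = (if schwartz f then (1 / c) * (LINT \<xi>|lborel. v \<xi> * fourier f (- \<xi>)) else 0)" for f
  let ?I = "LINT \<xi>|lborel. norm (v \<xi> / of_real ((1 + norm \<xi>) ^ M))"
  have pos: "0 < (1 + norm \<xi>) ^ M" for \<xi> :: "real^3" by (intro zero_less_power add_pos_nonneg) auto
  have bound: "norm (v \<xi> * fourier f (- \<xi>)) \<le> B * norm (v \<xi> / of_real ((1 + norm \<xi>) ^ M))"
    if "\<And>\<xi>. (1 + norm \<xi>) ^ M * cmod (fourier f \<xi>) \<le> B" for f B \<xi>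
  proof -
    have "cmod (fourier f (- \<xi>)) \<le> B / (1 + norm \<xi>) ^ M"
      using that[of "- \<xi>"] pos[of \<xi>] by (simp add: pos_le_divide_eq mult.commute)
    then have "cmod (v \<xi>) * cmod (fourier f (- \<xi>)) \<le> cmod (v \<xi>) * (B / (1 + norm \<xi>) ^ M)"
      by (intro mult_left_mono) auto
    also have "\<dots> = B * norm (v \<xi> / of_real ((1 + norm \<xi>) ^ M))"
      using pos[of \<xi>] unfolding norm_divide norm_of_real by simp
    finally show ?thesis by (simp add: norm_mult)
  qed
  have integ: "integrable lborel (\<lambda>\<xi>. v \<xi> * fourier f (- \<xi>))" if f: "schwartz f" for f
  proof -
    obtain B where B: "\<And>\<xi>. (1 + norm \<xi>) ^ M * cmod (fourier f \<xi>) \<le> B"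
      using schwartz_bound[OF schwartz_fourier[OF f], of M "[]"] by auto
    have [measurable]: "fourier f \<in> borel_measurable borel" by (intro schwartz_measurable schwartz_fourier f)
    show ?thesis
    proof (rule Bochner_Integration.integrable_bound)
      show "integrable lborel (\<lambda>\<xi>. B * norm (v \<xi> / of_real ((1 + norm \<xi>) ^ M)))"
        by (intro integrable_mult_right integrable_norm int)
      show "AE \<xi> in lborel. norm (v \<xi> * fourier f (- \<xi>)) \<le> norm (B * norm (v \<xi> / of_real ((1 + norm \<xi>) ^ M)))"
        unfolding real_norm_def by (intro AE_I2 order_trans[OF bound[OF B] abs_ge_self])
    qed measurable
  qed
  have "tempered T"
    unfolding tempered_def
  proof (intro conjI allI impI)
    show "T f = 0" if "\<not> schwartz f" for f using that by (simp add: T_def)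
  next
    fix a b and f g :: "real^3 \<Rightarrow> complex" assume fg: "schwartz f" "schwartz g"
    have "fourier (\<lambda>x. a * f x + b * g x) = (\<lambda>\<xi>. a * fourier f \<xi> + b * fourier g \<xi>)"
      using fg by (simp add: fourier_add fourier_cmult schwartz_integrable schwartz_cmult)
    then have "(LINT \<xi>|lborel. v \<xi> * fourier (\<lambda>x. a * f x + b * g x) (- \<xi>)) =
        (LINT \<xi>|lborel. a * (v \<xi> * fourier f (- \<xi>)) + b * (v \<xi> * fourier g (- \<xi>)))"
      by (simp add: algebra_simps)
    also have "\<dots> = a * (LINT \<xi>|lborel. v \<xi> * fourier f (- \<xi>)) + b * (LINT \<xi>|lborel. v \<xi> * fourier g (- \<xi>))"
      using integ[OF fg(1)] integ[OF fg(2)] by simp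
    finally show "T (\<lambda>x. a * f x + b * g x) = a * T f + b * T g"
      using fg by (simp add: T_def schwartz_add schwartz_cmult algebra_simps add_divide_distrib)
  next
    obtain C N where C: "0 \<le> C" "\<And>f \<xi>. schwartz f \<Longrightarrow> (1 + norm \<xi>) ^ M * cmod (fourier f \<xi>) \<le> C * schwartz_seminorm N f"
      using fourier_poly_dominated[of M] unfolding seminorm_dominated_def by blast
    show "\<exists>C N. \<forall>f. schwartz f \<longrightarrow> cmod (T f) \<le> C * schwartz_seminorm N f"
    proof (intro exI allI impI)
      fix f :: "real^3 \<Rightarrow> complex" assume f: "schwartz f"
      have "cmod (LINT \<xi>|lborel. v \<xi> * fourier f (- \<xi>)) \<le>
          (LINT \<xi>|lborel. C * schwartz_seminorm N f * norm (v \<xi> / of_real ((1 + norm \<xi>) ^ M)))"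
        by (intro order_trans[OF integral_norm_bound] integral_mono integrable_norm integ f
            integrable_mult_right int bound C)
      also have "\<dots> = C * schwartz_seminorm N f * ?I" by (rule integral_mult_right_zero)
      finally have "cmod (1 / c) * cmod (LINT \<xi>|lborel. v \<xi> * fourier f (- \<xi>)) \<le> cmod (1 / c) * (C * schwartz_seminorm N f * ?I)"
        by (intro mult_left_mono) auto
      then show "cmod (T f) \<le> (cmod (1 / c) * C * ?I) * schwartz_seminorm N f"
        using f unfolding T_def by (simp only: if_True norm_mult mult_ac)
    qed
  qed
  moreover have "represents v (fourier_dist T)"
    unfolding represents_def
  proof (intro conjI allI impI)
    show "locally_integrable v" by (rule locally_integrable_if_moderate[OF assms])
    fix \<psi> :: "real^3 \<Rightarrow> complex" assume "test_function \<psi>"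
    then have \<psi>: "schwartz \<psi>" by (rule test_function_schwartz)
    have "fourier_dist T \<psi> = (1 / c) * (LINT \<xi>|lborel. v \<xi> * (c * \<psi> \<xi>))"
      using c(2)[OF \<psi>] by (simp add: fourier_dist_def T_def \<psi> schwartz_fourier)
    also have "(LINT \<xi>|lborel. v \<xi> * (c * \<psi> \<xi>)) = c * (LINT \<xi>|lborel. v \<xi> * \<psi> \<xi>)"
      by (subst integral_mult_right_zero[symmetric]) (simp add: mult_ac)
    finally show "fourier_dist T \<psi> = (LINT \<xi>|lborel. v \<xi> * \<psi> \<xi>)" using c(1) by simp
  qed
  ultimately show ?thesis by (rule that)
qed

section \<open>Representatives of the transform\<close>

lemma represents_unique:
  assumes "represents g T" "represents h T"
  shows "AE \<xi> in lborel. g \<xi> = h \<xi>"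
proof (rule locally_integrable_AE_eq)
  show "(LINT x|lborel. g x * \<psi> x) = (LINT x|lborel. h x * \<psi> x)" if "test_function \<psi>" for \<psi>
    using assms that unfolding represents_def by metis
qed (use assms in \<open>auto simp: represents_def\<close>)

lemma fourier_fun_represents:
  assumes "\<exists>g. represents g (fourier_dist (f $ k))"
  shows "represents (\<lambda>\<xi>. fourier_fun f \<xi> $ k) (fourier_dist (f $ k))"
  using someI_ex[OF assms] by (simp add: fourier_fun_def)

text \<open>The choice in \<open>fourier_fun\<close> is made among representatives that agree almost
  everywhere, so a prescribed one is recovered up to a null set.\<close>

lemma fourier_fun_AE_eq:
  assumes "\<And>k. represents (\<lambda>\<xi>. v \<xi> $ k) (fourier_dist (f $ k))"
  shows "AE \<xi> in lborel. fourier_fun f \<xi> = v \<xi>"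
proof -
  have "\<forall>k. AE \<xi> in lborel. fourier_fun f \<xi> $ k = v \<xi> $ k"
    using assms fourier_fun_represents represents_unique by blast
  then have "AE \<xi> in lborel. \<forall>k\<in>UNIV. fourier_fun f \<xi> $ k = v \<xi> $ k"
    by (intro AE_finite_allI) auto
  then show ?thesis by (simp add: vec_eq_iff)
qed

text \<open>Integrals against test functions do not see null sets, which reduces this to
  \<open>tempered_eqI\<close>. It turns uniqueness of transforms into uniqueness of
  solutions.\<close>

lemma fourier_fun_injective:
  assumes f: "\<And>k. tempered (f $ k)" "\<And>k. \<exists>h. represents h (fourier_dist (f $ k))"
    and g: "\<And>k. tempered (g $ k)" "\<And>k. \<exists>h. represents h (fourier_dist (g $ k))"
    and eq: "AE \<xi> in lborel. fourier_fun f \<xi> = fourier_fun g \<xi>"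
  shows "f = g"
proof -
  have "f $ k = g $ k" for k
  proof (rule tempered_eqI[OF f(1) g(1)])
    fix \<psi> :: "real^3 \<Rightarrow> complex" assume \<psi>: "test_function \<psi>"
    note rf = fourier_fun_represents[OF f(2), of k] and rg = fourier_fun_represents[OF g(2), of k]
    have [measurable]: "(\<lambda>\<xi>. fourier_fun f \<xi> $ k) \<in> borel_measurable borel" "(\<lambda>\<xi>. fourier_fun g \<xi> $ k) \<in> borel_measurable borel"
      "\<psi> \<in> borel_measurable borel"
      using rf rg \<psi> by (auto simp: represents_def locally_integrable_def test_function_def intro: smooth_measurable)
    have "(LINT \<xi>|lborel. fourier_fun f \<xi> $ k * \<psi> \<xi>) = (LINT \<xi>|lborel. fourier_fun g \<xi> $ k * \<psi> \<xi>)"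
      by (intro integral_cong_AE) (use eq in auto)
    then show "fourier_dist (f $ k) \<psi> = fourier_dist (g $ k) \<psi>"
      using rf rg \<psi> by (simp add: represents_def)
  qed
  then show ?thesis by (simp add: vec_eq_iff)
qed

section \<open>Lebesgue norms\<close>

lemma ennreal_pow_0 [simp]: "ennreal_pow 0 a = 0"
  and ennreal_pow_top [simp]: "ennreal_pow top a = top"
  by (simp_all add: ennreal_pow_def)

lemma ennreal_pow_ennreal: "0 \<le> r \<Longrightarrow> ennreal_pow (ennreal r) a = ennreal (r powr a)"
  by (simp add: ennreal_pow_def)

lemma ennreal_pow_1 [simp]: "ennreal_pow x 1 = x"
  by (cases x) (auto simp: ennreal_pow_def)

lemma ennreal_pow_one_left [simp]: "ennreal_pow 1 a = 1"
  by (simp add: ennreal_pow_def)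

lemma ennreal_pow_eq_0_iff [simp]: "ennreal_pow x a = 0 \<longleftrightarrow> x = 0"
  by (cases x) (auto simp: ennreal_pow_def ennreal_eq_0_iff)


lemma ennreal_pow_mono: "0 \<le> a \<Longrightarrow> x \<le> y \<Longrightarrow> ennreal_pow x a \<le> ennreal_pow y a"
  by (cases x; cases y) (auto simp: ennreal_pow_def top_unique intro!: ennreal_leI powr_mono2)

lemma ennreal_pow_mult: "ennreal_pow (x * y) a = ennreal_pow x a * ennreal_pow y a"
proof (cases "x = 0 \<or> y = 0 \<or> x = \<infinity> \<or> y = \<infinity>")
  case True
  then show ?thesis
  proof (elim disjE)
    assume "x = \<infinity>"
    then show ?thesis by (cases "y = 0") (auto simp: ennreal_top_mult)
  next
    assume "y = \<infinity>"
    then show ?thesis by (cases "x = 0") (auto simp: ennreal_mult_top)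
  qed auto
next
  case False
  then obtain r s where "x = ennreal r" "y = ennreal s" "0 \<le> r" "0 \<le> s"
    by (cases x; cases y) auto
  then show ?thesis by (simp add: ennreal_pow_ennreal powr_mult flip: ennreal_mult)
qed

lemma ennreal_pow_pow: "ennreal_pow (ennreal_pow x a) b = ennreal_pow x (a * b)"
  by (cases x) (auto simp: ennreal_pow_def powr_powr)

lemma ennreal_pow_le_iff:
  assumes "0 < a"
  shows "ennreal_pow x a \<le> ennreal_pow y a \<longleftrightarrow> x \<le> y"
proof
  assume "ennreal_pow x a \<le> ennreal_pow y a"
  then have "ennreal_pow (ennreal_pow x a) (1 / a) \<le> ennreal_pow (ennreal_pow y a) (1 / a)"
    by (rule ennreal_pow_mono[rotated]) (use assms in auto)
  then show "x \<le> y" using assms by (simp add: ennreal_pow_pow)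
qed (use assms in \<open>auto intro: ennreal_pow_mono\<close>)

text \<open>A power with positive exponent has a monotone inverse; applying that inverse gives the
  inequality which monotonicity alone does not.\<close>

lemma ennreal_pow_SUP:
  assumes "0 < a"
  shows "ennreal_pow (SUP n::nat. f n) a = (SUP n. ennreal_pow (f n) a)"
proof (rule antisym)
  have "f n \<le> ennreal_pow (SUP n. ennreal_pow (f n) a) (1 / a)" for n
  proof -
    have "ennreal_pow (ennreal_pow (f n) a) (1 / a) \<le> ennreal_pow (SUP n. ennreal_pow (f n) a) (1 / a)"
      using assms by (intro ennreal_pow_mono SUP_upper) auto
    then show ?thesis using assms by (simp add: ennreal_pow_pow)
  qed
  then have "ennreal_pow (SUP n. f n) a \<le> ennreal_pow (ennreal_pow (SUP n. ennreal_pow (f n) a) (1 / a)) a"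
    using assms by (intro ennreal_pow_mono SUP_least) auto
  then show "ennreal_pow (SUP n::nat. f n) a \<le> (SUP n. ennreal_pow (f n) a)"
    using assms by (simp add: ennreal_pow_pow)
qed (use assms in \<open>auto intro!: SUP_least ennreal_pow_mono SUP_upper\<close>)

lemma borel_measurable_ennreal_pow [measurable]:
  "(\<lambda>x. ennreal_pow x a) \<in> borel_measurable borel"
  unfolding ennreal_pow_def by measurable

text \<open>With the power on the side of the bound, estimates can be made under the integral and no
  root appears. The essential supremum at \<open>p = \<infinity>\<close> is treated apart
  throughout.\<close>

lemma Lp_norm_le_iff:
  assumes "1 \<le> p" "p \<noteq> \<infinity>"
  shows "Lp_norm M p f \<le> B \<longleftrightarrow> (\<integral>\<^sup>+x. ennreal_pow (f x) (enn2real p) \<partial>M) \<le> ennreal_pow B (enn2real p)"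
proof -
  have p: "0 < enn2real p" using assms by (cases p) (auto simp: enn2real_positive_iff intro: less_le_trans[of 0 1])
  have "Lp_norm M p f \<le> B \<longleftrightarrow> ennreal_pow (Lp_norm M p f) (enn2real p) \<le> ennreal_pow B (enn2real p)"
    using p by (simp add: ennreal_pow_le_iff)
  then show ?thesis using p assms(2) by (simp add: Lp_norm_def ennreal_pow_pow)
qed

lemma Lp_norm_pow:
  assumes "1 \<le> p" "p \<noteq> \<infinity>"
  shows "ennreal_pow (Lp_norm M p f) (enn2real p) = (\<integral>\<^sup>+x. ennreal_pow (f x) (enn2real p) \<partial>M)"
proof -
  have p: "0 < enn2real p" using assms by (cases p) (auto simp: enn2real_positive_iff intro: less_le_trans[of 0 1])
  then show ?thesis using assms(2) by (simp add: Lp_norm_def ennreal_pow_pow)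
qed

lemma one_le_enn2real: "1 \<le> p \<Longrightarrow> p \<noteq> \<infinity> \<Longrightarrow> 1 \<le> enn2real p"
  by (cases p) auto

lemma Lp_norm_mono_AE:
  assumes "1 \<le> p" "f \<in> borel_measurable M" "AE x in M. f x \<le> g x"
  shows "Lp_norm M p f \<le> Lp_norm M p g"
proof (cases "p = \<infinity>")
  case True
  then show ?thesis using esssup_AE_mono[OF assms(2,3)] by (simp add: Lp_norm_def)
next
  case False
  then show ?thesis
    using assms one_le_enn2real[OF assms(1)]
    by (simp add: Lp_norm_le_iff Lp_norm_pow) (auto intro!: nn_integral_mono_AE ennreal_pow_mono elim: eventually_mono)
qed

lemma Lp_norm_cmult:
  assumes p: "1 \<le> p" and [measurable]: "f \<in> borel_measurable M"
  shows "Lp_norm M p (\<lambda>x. c * f x) \<le> c * Lp_norm M p f"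
proof (cases "p = \<infinity>")
  case True
  have "AE x in M. c * f x \<le> c * esssup M f"
    using esssup_AE[of f M] by eventually_elim (rule mult_left_mono, auto)
  then show ?thesis using True by (simp add: Lp_norm_def esssup_I)
next
  case False
  then show ?thesis
    using p by (simp add: Lp_norm_le_iff ennreal_pow_mult nn_integral_cmult Lp_norm_pow)
qed

lemma Lp_norm_eq_0:
  assumes p: "1 \<le> p" and [measurable]: "f \<in> borel_measurable M" and "Lp_norm M p f = 0"
  shows "AE x in M. f x = 0"
proof (cases "p = \<infinity>")
  case True
  then show ?thesis using esssup_AE[of f M] assms(3) by (simp add: Lp_norm_def)
next
  case False
  have "(\<integral>\<^sup>+x. ennreal_pow (f x) (enn2real p) \<partial>M) = 0"
    using Lp_norm_pow[OF p, of M f] False assms(3) by simp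
  then show ?thesis by (simp add: nn_integral_0_iff_AE)
qed

lemma Lp_norm_SUP:
  assumes p: "1 \<le> p" and [measurable]: "\<And>n::nat. f n \<in> borel_measurable M"
    and inc: "\<And>n x. f n x \<le> f (Suc n) x" and B: "\<And>n. Lp_norm M p (f n) \<le> B"
  shows "Lp_norm M p (\<lambda>x. SUP n. f n x) \<le> B"
proof (cases "p = \<infinity>")
  case True
  have "AE x in M. \<forall>n. f n x \<le> B"
    unfolding AE_all_countable
  proof
    fix n show "AE x in M. f n x \<le> B"
      using esssup_AE[of "f n" M] B[of n] True by (auto simp: Lp_norm_def elim!: eventually_mono)
  qed
  then have "AE x in M. (SUP n. f n x) \<le> B" by eventually_elim (auto intro: SUP_least)
  then show ?thesis using True by (simp add: Lp_norm_def esssup_I)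
next
  case False
  note p1 = one_le_enn2real[OF p False]
  have "(\<integral>\<^sup>+x. (SUP n. ennreal_pow (f n x) (enn2real p)) \<partial>M) = (SUP n. \<integral>\<^sup>+x. ennreal_pow (f n x) (enn2real p) \<partial>M)"
  proof (rule nn_integral_monotone_convergence_SUP)
    show "incseq (\<lambda>n x. ennreal_pow (f n x) (enn2real p))"
      using p1 by (intro incseq_SucI) (auto simp: le_fun_def intro!: ennreal_pow_mono inc)
  qed measurable
  also have "\<dots> \<le> ennreal_pow B (enn2real p)"
    using B p False by (intro SUP_least) (simp add: Lp_norm_le_iff)
  finally show ?thesis using p False p1 by (simp add: Lp_norm_le_iff ennreal_pow_SUP)
qed

lemma Lp_norm_measure_preserving:
  assumes p: "1 \<le> p" and T: "T \<in> measurable M M" "distr M M T = M" and f [measurable]: "f \<in> borel_measurable M"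
  shows "Lp_norm M p (\<lambda>x. f (T x)) \<le> Lp_norm M p f"
proof (cases "p = \<infinity>")
  case True
  have "AE x in distr M M T. f x \<le> esssup M f" using esssup_AE T(2) by metis
  then have "AE x in M. f (T x) \<le> esssup M f" by (rule AE_distrD[OF T(1)])
  moreover have "(\<lambda>x. f (T x)) \<in> borel_measurable M" using T(1) f by (rule measurable_compose)
  ultimately show ?thesis using True by (simp add: Lp_norm_def esssup_I)
next
  case False
  have "(\<integral>\<^sup>+x. ennreal_pow (f (T x)) (enn2real p) \<partial>M) = (\<integral>\<^sup>+x. ennreal_pow (f x) (enn2real p) \<partial>distr M M T)"
    by (rule nn_integral_distr[symmetric, OF T(1)]) measurable
  then show ?thesis using p False by (simp add: Lp_norm_le_iff Lp_norm_pow T(2))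
qed

section \<open>Jensen, Minkowski and Hoelder inequalities\<close>

lemma tangent_powr:
  fixes p t l :: real
  assumes "1 \<le> p" "0 \<le> t" "0 < l"
  shows "t \<le> l powr (1 - p) / p * t powr p + l * (1 - 1 / p)"
proof (cases "t = 0")
  case True
  then show ?thesis using assms by simp
next
  case False
  \<comment> \<open>The weighted inequality of arithmetic and geometric means. The outcome is the
    tangent line to \<open>t powr p\<close> at \<open>l\<close>, solved for
    \<open>t\<close>.\<close>
  have "((t / l) powr p) powr (1 / p) * 1 powr (1 - 1 / p) \<le> 1 / p * ((t / l) powr p) + (1 - 1 / p) * 1"
    using assms False by (intro Youngs_inequality_0) auto
  then have "t / l \<le> 1 / p * (t / l) powr p + (1 - 1 / p)"
    using assms by (simp add: powr_powr)
  then have "t / l * l \<le> (1 / p * (t / l) powr p + (1 - 1 / p)) * l"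
    using assms by (intro mult_right_mono) auto
  then show ?thesis
    using assms by (simp add: powr_divide powr_diff field_simps)
qed

text \<open>Jensen's inequality for the weight \<open>w\<close>, obtained by integrating the tangent
  bound at one well chosen point. The other cases set aside zero and infinite integrals, for which
  that point would not be a positive real.\<close>

lemma power_mean_nn_integral:
  fixes p :: real
  assumes p: "1 \<le> p" and [measurable]: "w \<in> borel_measurable M" "f \<in> borel_measurable M"
    and fin: "(\<integral>\<^sup>+x. w x \<partial>M) < \<infinity>"
  shows "ennreal_pow (\<integral>\<^sup>+x. w x * f x \<partial>M) p
    \<le> ennreal_pow (\<integral>\<^sup>+x. w x \<partial>M) (p - 1) * (\<integral>\<^sup>+x. w x * ennreal_pow (f x) p \<partial>M)"
    (is "_ \<le> ennreal_pow ?m _ * ?I")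
proof -
  consider "?m = 0" | "?m \<noteq> 0" "?I = \<infinity>" | "?I = 0" | "?m \<noteq> 0" "?I \<noteq> 0" "?I \<noteq> \<infinity>" by blast
  then show ?thesis
  proof cases
    case 1
    then have "AE x in M. w x = 0" by (simp add: nn_integral_0_iff_AE)
    then have "(\<integral>\<^sup>+x. w x * f x \<partial>M) = 0"
      by (subst nn_integral_0_iff_AE) (auto elim: eventually_mono)
    then show ?thesis by simp
  next
    case 2
    then show ?thesis by (simp add: ennreal_mult_top)
  next
    case 3
    then have "AE x in M. w x * ennreal_pow (f x) p = 0" by (simp add: nn_integral_0_iff_AE)
    then have "(\<integral>\<^sup>+x. w x * f x \<partial>M) = 0"
      by (subst nn_integral_0_iff_AE) (auto elim: eventually_mono)
    then show ?thesis by simp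
  next
    case 4
    obtain r where r: "?m = ennreal r" "0 < r" using 4 fin by (cases ?m) (auto simp: less_le)
    obtain i where i: "?I = ennreal i" "0 < i" using 4 by (cases ?I) (auto simp: less_le)
    \<comment> \<open>The weighted mean of order \<open>p\<close> of \<open>f\<close>. With this
      point of tangency the integrated bound collapses to \<open>l * r\<close>.\<close>
    define l where "l = (i / r) powr (1 / p)"
    have l: "0 < l" "l powr p = i / r" using r i p by (auto simp: l_def powr_powr)
    have pt: "f x \<le> ennreal (l powr (1 - p) / p) * ennreal_pow (f x) p + ennreal (l * (1 - 1 / p))" for x
    proof (cases "f x")
      case (real t)
      then show ?thesis
        using tangent_powr[OF p real(1) l(1)] p l
        by (simp add: ennreal_pow_ennreal flip: ennreal_mult ennreal_plus)
    next
      case top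
      have "ennreal (l powr (1 - p) / p) \<noteq> 0" using p l by (simp add: ennreal_eq_0_iff not_le)
      then have "ennreal (l powr (1 - p) / p) * ennreal_pow (f x) p = \<infinity>"
        using top by (simp add: ennreal_mult_top ennreal_pow_def)
      then show ?thesis by simp
    qed
    have "(\<integral>\<^sup>+x. w x * f x \<partial>M)
        \<le> (\<integral>\<^sup>+x. ennreal (l powr (1 - p) / p) * (w x * ennreal_pow (f x) p) + ennreal (l * (1 - 1 / p)) * w x \<partial>M)"
    proof (rule nn_integral_mono)
      fix x
      have "w x * f x \<le> w x * (ennreal (l powr (1 - p) / p) * ennreal_pow (f x) p + ennreal (l * (1 - 1 / p)))"
        by (intro mult_left_mono pt) auto
      then show "w x * f x \<le> ennreal (l powr (1 - p) / p) * (w x * ennreal_pow (f x) p) + ennreal (l * (1 - 1 / p)) * w x"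
        by (simp add: distrib_left mult_ac)
    qed
    also have "\<dots> = ennreal (l powr (1 - p) / p) * ?I + ennreal (l * (1 - 1 / p)) * ?m"
      by (simp add: nn_integral_add nn_integral_cmult)
    also have "\<dots> = ennreal (l powr (1 - p) / p * i + l * (1 - 1 / p) * r)"
    proof -
      have "ennreal a * ennreal i + ennreal b * ennreal r = ennreal (a * i + b * r)" if "0 \<le> a" "0 \<le> b" for a b
        using that r i by (simp add: ennreal_mult ennreal_plus)
      from this[of "l powr (1 - p) / p" "l * (1 - 1 / p)"] show ?thesis using p l r i by simp
    qed
    also have "l powr (1 - p) / p * i + l * (1 - 1 / p) * r = l * r"
    proof -
      have "l powr (1 - p) * (i / r) = l"
        using l by (simp flip: powr_add l(2))
      then have "l powr (1 - p) * i = l * r" using r by (simp add: field_simps)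
      then show ?thesis using p by (simp add: field_simps)
    qed
    finally have "ennreal_pow (\<integral>\<^sup>+x. w x * f x \<partial>M) p \<le> ennreal_pow (ennreal (l * r)) p"
      using p by (intro ennreal_pow_mono) auto
    also have "\<dots> = ennreal (r powr (p - 1) * i)"
      using l r i p by (simp add: ennreal_pow_ennreal powr_mult powr_diff field_simps)
    also have "\<dots> = ennreal_pow ?m (p - 1) * ?I"
      using r i by (simp add: ennreal_pow_ennreal ennreal_mult)
    finally show ?thesis .
  qed
qed

text \<open>Minkowski's integral inequality for slices with a common bound \<open>R\<close>: Jensen
  in \<open>y\<close>, then Tonelli, then the bound in \<open>x\<close>. Slices of different sizes
  have to be normalised first, which is how \<open>Lp_norm_countable_sum\<close> uses it.\<close>

lemma Lp_norm_average:
  assumes M: "sigma_finite_measure M" and N: "sigma_finite_measure N" and p: "1 \<le> p"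
    and [measurable]: "f \<in> borel_measurable (N \<Otimes>\<^sub>M M)" "w \<in> borel_measurable N"
    and fin: "(\<integral>\<^sup>+y. w y \<partial>N) < \<infinity>"
    and R: "\<And>y. y \<in> space N \<Longrightarrow> Lp_norm M p (\<lambda>x. f (y, x)) \<le> R"
  shows "Lp_norm M p (\<lambda>x. \<integral>\<^sup>+y. w y * f (y, x) \<partial>N) \<le> (\<integral>\<^sup>+y. w y \<partial>N) * R"
proof -
  interpret M: sigma_finite_measure M by fact
  interpret N: sigma_finite_measure N by fact
  interpret NM: pair_sigma_finite N M ..
  show ?thesis
  proof (cases "p = \<infinity>")
    case True
    have "AE y in N. AE x in M. f (y, x) \<le> R"
    proof (rule AE_I2)
      fix y assume y: "y \<in> space N"
      have "esssup M (\<lambda>x. f (y, x)) \<le> R" using R[OF y] True by (simp add: Lp_norm_def)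
      then show "AE x in M. f (y, x) \<le> R"
        using esssup_AE[of "\<lambda>x. f (y, x)" M] by (auto elim!: eventually_mono)
    qed
    then have "AE x in M. AE y in N. f (y, x) \<le> R" by (subst (asm) NM.AE_commute) auto
    then have "AE x in M. (\<integral>\<^sup>+y. w y * f (y, x) \<partial>N) \<le> (\<integral>\<^sup>+y. w y \<partial>N) * R"
    proof eventually_elim
      case (elim x)
      have "(\<integral>\<^sup>+y. w y * f (y, x) \<partial>N) \<le> (\<integral>\<^sup>+y. w y * R \<partial>N)"
        using elim by (intro nn_integral_mono_AE) (auto elim!: eventually_mono intro: mult_left_mono)
      then show ?case by (simp add: nn_integral_multc)
    qed
    then show ?thesis using True by (simp add: Lp_norm_def esssup_I)
  next
    case False
    let ?p = "enn2real p" and ?m = "\<integral>\<^sup>+y. w y \<partial>N"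
    note p1 = one_le_enn2real[OF p False]
    have "(\<integral>\<^sup>+x. ennreal_pow (\<integral>\<^sup>+y. w y * f (y, x) \<partial>N) ?p \<partial>M)
        \<le> (\<integral>\<^sup>+x. ennreal_pow ?m (?p - 1) * (\<integral>\<^sup>+y. w y * ennreal_pow (f (y, x)) ?p \<partial>N) \<partial>M)"
      by (intro nn_integral_mono power_mean_nn_integral p1 fin) measurable
    also have "\<dots> = ennreal_pow ?m (?p - 1) * (\<integral>\<^sup>+x. \<integral>\<^sup>+y. w y * ennreal_pow (f (y, x)) ?p \<partial>N \<partial>M)"
      by (rule nn_integral_cmult) measurable
    also have "(\<integral>\<^sup>+x. \<integral>\<^sup>+y. w y * ennreal_pow (f (y, x)) ?p \<partial>N \<partial>M)
        = (\<integral>\<^sup>+y. \<integral>\<^sup>+x. w y * ennreal_pow (f (y, x)) ?p \<partial>M \<partial>N)"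
      by (rule NM.Fubini') measurable
    also have "\<dots> \<le> (\<integral>\<^sup>+y. w y * ennreal_pow R ?p \<partial>N)"
    proof (rule nn_integral_mono)
      fix y assume y: "y \<in> space N"
      have "(\<integral>\<^sup>+x. w y * ennreal_pow (f (y, x)) ?p \<partial>M) = w y * (\<integral>\<^sup>+x. ennreal_pow (f (y, x)) ?p \<partial>M)"
        using y by (intro nn_integral_cmult) measurable
      also have "\<dots> \<le> w y * ennreal_pow R ?p"
        using R[OF y] p False by (intro mult_left_mono) (auto simp: Lp_norm_le_iff)
      finally show "(\<integral>\<^sup>+x. w y * ennreal_pow (f (y, x)) ?p \<partial>M) \<le> w y * ennreal_pow R ?p" .
    qed
    also have "\<dots> = ?m * ennreal_pow R ?p" by (rule nn_integral_multc) measurable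
    also have "ennreal_pow ?m (?p - 1) * (?m * ennreal_pow R ?p) = ennreal_pow (?m * R) ?p"
    proof -
      have "ennreal_pow ?m (?p - 1) * ?m = ennreal_pow ?m ?p"
      proof (cases "?m = 0")
        case False
        then obtain r where r: "?m = ennreal r" "0 < r" using fin by (cases ?m) (auto simp: less_le)
        then show ?thesis by (simp add: ennreal_pow_ennreal powr_diff flip: ennreal_mult)
      qed simp
      then show ?thesis by (simp add: ennreal_pow_mult flip: mult.assoc)
    qed
    finally show ?thesis
      using p False by (simp add: Lp_norm_le_iff mult_left_mono)
  qed
qed

text \<open>Each \<open>F i\<close> is its norm times a function \<open>G i\<close> of norm at most
  one. The sum is thus an average with the norms as weights, to which \<open>Lp_norm_average\<close>
  applies.\<close>

lemma Lp_norm_countable_sum: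
  fixes F :: "'i::countable \<Rightarrow> 'a \<Rightarrow> ennreal"
  assumes M: "sigma_finite_measure M" and p: "1 \<le> p" and [measurable]: "\<And>i. F i \<in> borel_measurable M"
  shows "Lp_norm M p (\<lambda>x. \<integral>\<^sup>+i. F i x \<partial>count_space UNIV) \<le> (\<integral>\<^sup>+i. Lp_norm M p (F i) \<partial>count_space UNIV)"
    (is "_ \<le> ?S")
proof -
  have meas [measurable]: "(\<lambda>x. \<integral>\<^sup>+i. G i x \<partial>count_space UNIV) \<in> borel_measurable M"
    if "\<And>i. G i \<in> borel_measurable M" for G :: "'i \<Rightarrow> 'a \<Rightarrow> ennreal"
  proof -
    interpret sigma_finite_measure "count_space (UNIV :: 'i set)"
      by (rule sigma_finite_measure_count_space_countable) simp
    have [measurable]: "(\<lambda>p. G (fst p) (snd p)) \<in> borel_measurable (count_space UNIV \<Otimes>\<^sub>M M)"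
      using that by (intro measurable_pair_measure_countable1) auto
    have [measurable]: "(\<lambda>p. G (snd p) (fst p)) \<in> borel_measurable (M \<Otimes>\<^sub>M count_space UNIV)"
      using measurable_compose[OF measurable_pair_swap' \<open>(\<lambda>p. G (fst p) (snd p)) \<in> _\<close>]
      by (simp add: case_prod_unfold)
    show ?thesis by (rule borel_measurable_nn_integral_fst[of "\<lambda>p. G (snd p) (fst p)", simplified]) measurable
  qed
  show ?thesis
  proof (cases "p = \<infinity>")
    case True
    have "AE x in M. \<forall>i. F i x \<le> Lp_norm M p (F i)"
      unfolding AE_all_countable
    proof
      fix i show "AE x in M. F i x \<le> Lp_norm M p (F i)"
        using esssup_AE[of "F i" M] True by (simp add: Lp_norm_def)
    qed
    then have "AE x in M. (\<integral>\<^sup>+i. F i x \<partial>count_space UNIV) \<le> ?S"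
      by eventually_elim (auto intro: nn_integral_mono)
    then show ?thesis using True esssup_I[OF meas[of F]] by (simp add: Lp_norm_def)
  next
    case False
    show ?thesis
    proof (cases "?S = \<infinity>")
      case fin: False
      have Rfin: "Lp_norm M p (F i) \<noteq> \<infinity>" for i
        using nn_integral_ge_point[of i UNIV "\<lambda>i. Lp_norm M p (F i)"] fin by (auto simp: top_unique)
      \<comment> \<open>A function of norm zero vanishes almost everywhere and is replaced by 0,
        since the inverse of 0 is infinite in \<open>ennreal\<close>.\<close>
      define G where "G i x = (if Lp_norm M p (F i) = 0 then 0 else inverse (Lp_norm M p (F i)) * F i x)" for i x
      have G [measurable]: "G i \<in> borel_measurable M" for i unfolding G_def by measurable
      have le1: "Lp_norm M p (G i) \<le> 1" for i
      proof (cases "Lp_norm M p (F i) = 0")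
        case True
        then show ?thesis using p False by (simp add: G_def Lp_norm_le_iff)
      next
        case nz: False
        have "Lp_norm M p (G i) \<le> inverse (Lp_norm M p (F i)) * Lp_norm M p (F i)"
        proof -
          have "G i = (\<lambda>x. inverse (Lp_norm M p (F i)) * F i x)" using nz by (auto simp: G_def)
          then show ?thesis using Lp_norm_cmult[OF p, of "F i" M "inverse (Lp_norm M p (F i))"] by simp
        qed
        also have "\<dots> = 1" using nz Rfin[of i] by (simp add: mult.commute less_top ennreal_divide_self flip: divide_ennreal_def)
        finally show ?thesis .
      qed
      have "AE x in M. \<forall>i. F i x = Lp_norm M p (F i) * G i x"
        unfolding AE_all_countable
      proof
        fix i
        show "AE x in M. F i x = Lp_norm M p (F i) * G i x"
        proof (cases "Lp_norm M p (F i) = 0")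
          case True
          then show ?thesis using Lp_norm_eq_0[OF p _ True] by simp
        next
          case nz: False
          have "Lp_norm M p (F i) * inverse (Lp_norm M p (F i)) = 1"
            using nz Rfin[of i] by (simp add: mult.commute less_top ennreal_divide_self flip: divide_ennreal_def)
          then have "F i x = Lp_norm M p (F i) * G i x" for x
            using nz by (simp add: G_def flip: mult.assoc)
          then show ?thesis by simp
        qed
      qed
      then have "AE x in M. (\<integral>\<^sup>+i. F i x \<partial>count_space UNIV) \<le> (\<integral>\<^sup>+i. Lp_norm M p (F i) * G i x \<partial>count_space UNIV)"
        by eventually_elim (simp cong: nn_integral_cong)
      then have "Lp_norm M p (\<lambda>x. \<integral>\<^sup>+i. F i x \<partial>count_space UNIV)
          \<le> Lp_norm M p (\<lambda>x. \<integral>\<^sup>+i. Lp_norm M p (F i) * G i x \<partial>count_space UNIV)"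
        by (intro Lp_norm_mono_AE p meas) measurable
      also have "\<dots> \<le> ?S * 1"
      proof -
        have "(\<lambda>q. G (fst q) (snd q)) \<in> borel_measurable (count_space UNIV \<Otimes>\<^sub>M M)"
          by (intro measurable_pair_measure_countable1) auto
        then show ?thesis
          using Lp_norm_average[OF M sigma_finite_measure_count_space_countable[of "UNIV :: 'i set"] p,
              of "\<lambda>q. G (fst q) (snd q)" "\<lambda>i. Lp_norm M p (F i)" 1] le1 fin
          by (simp add: less_top)
      qed
      finally show ?thesis by simp
    qed simp
  qed
qed

lemma Lp_norm_add:
  assumes M: "sigma_finite_measure M" and p: "1 \<le> p"
    and f [measurable]: "f \<in> borel_measurable M" "g \<in> borel_measurable M"
  shows "Lp_norm M p (\<lambda>x. f x + g x) \<le> Lp_norm M p f + Lp_norm M p g"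
proof -
  have sum: "(\<integral>\<^sup>+b. (if b then u else v) \<partial>count_space UNIV) = u + v" for u v :: ennreal
    by (simp add: nn_integral_count_space_finite UNIV_bool add.commute)
  have "Lp_norm M p (\<lambda>x. \<integral>\<^sup>+b. (if b then f else g) x \<partial>count_space UNIV)
      \<le> (\<integral>\<^sup>+b. Lp_norm M p (if b then f else g) \<partial>count_space UNIV)"
    by (intro Lp_norm_countable_sum M p) auto
  then show ?thesis by (simp add: if_distrib[of "\<lambda>h. h _"] if_distrib[of "Lp_norm M p"] sum cong: if_cong)
qed

lemma Lp_norm_point:
  assumes p: "1 \<le> p"
  shows "c j \<le> Lp_norm (count_space UNIV) p c"
proof (cases "p = \<infinity>")
  case True
  then show ?thesis using esssup_AE[of c "count_space UNIV"] by (simp add: Lp_norm_def AE_count_space)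
next
  case False
  note p1 = one_le_enn2real[OF p False]
  have "ennreal_pow (c j) (enn2real p) \<le> ennreal_pow (Lp_norm (count_space UNIV) p c) (enn2real p)"
    unfolding Lp_norm_pow[OF p False] by (rule nn_integral_ge_point) simp
  then show ?thesis using p1 by (simp add: ennreal_pow_le_iff)
qed

text \<open>Hoelder's inequality on a set of finite measure, as Jensen with the indicator for a
  weight. The exponent is 1 - 1/p, written through \<open>3 / p\<close> to match the indices of the
  spaces; at \<open>p = \<infinity>\<close> it is 1.\<close>

lemma nn_integral_le_Lp_norm:
  assumes p: "1 < p" and f [measurable]: "f \<in> borel_measurable M" and A [measurable]: "A \<in> sets M"
    and fin: "emeasure M A < \<infinity>"
  shows "(\<integral>\<^sup>+x. f x * indicator A x \<partial>M)
    \<le> ennreal_pow (emeasure M A) (1 - enn2real (3 / p) / 3) * Lp_norm M p (\<lambda>x. f x * indicator A x)"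
proof (cases "p = \<infinity>")
  case True
  have "AE x in M. f x * indicator A x \<le> esssup M (\<lambda>x. f x * indicator A x)" by (rule esssup_AE)
  then have "AE x in M. f x * indicator A x \<le> esssup M (\<lambda>x. f x * indicator A x) * indicator A x"
    by eventually_elim (auto split: split_indicator)
  then have "(\<integral>\<^sup>+x. f x * indicator A x \<partial>M) \<le> (\<integral>\<^sup>+x. esssup M (\<lambda>x. f x * indicator A x) * indicator A x \<partial>M)"
    by (rule nn_integral_mono_AE)
  also have "\<dots> = emeasure M A * esssup M (\<lambda>x. f x * indicator A x)"
    by (subst nn_integral_cmult_indicator) (auto simp: mult.commute)
  finally show ?thesis using True by (simp add: Lp_norm_def)
next
  case False
  let ?p = "enn2real p"
  have p1: "1 < ?p" using p False by (cases p) (auto simp: ennreal_less_iff one_ennreal.rep_eq simp flip: ennreal_1)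
  have e: "1 - enn2real (3 / p) / 3 = (?p - 1) * (1 / ?p)"
  proof -
    have "3 / p = ennreal (3 / ?p)"
      using False p1 by (cases p) (auto simp: divide_ennreal[of 3, simplified])
    then show ?thesis using p1 by (simp add: field_simps)
  qed
  have "ennreal_pow (\<integral>\<^sup>+x. indicator A x * f x \<partial>M) ?p
      \<le> ennreal_pow (\<integral>\<^sup>+x. indicator A x \<partial>M) (?p - 1) * (\<integral>\<^sup>+x. indicator A x * ennreal_pow (f x) ?p \<partial>M)"
    using p1 fin by (intro power_mean_nn_integral) auto
  also have "(\<integral>\<^sup>+x. indicator A x * ennreal_pow (f x) ?p \<partial>M) = (\<integral>\<^sup>+x. ennreal_pow (f x * indicator A x) ?p \<partial>M)"
    by (intro nn_integral_cong) (auto split: split_indicator)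
  also have "\<dots> = ennreal_pow (Lp_norm M p (\<lambda>x. f x * indicator A x)) ?p"
    using p False by (intro Lp_norm_pow[symmetric]) auto
  finally have "ennreal_pow (ennreal_pow (\<integral>\<^sup>+x. f x * indicator A x \<partial>M) ?p) (1 / ?p)
      \<le> ennreal_pow (ennreal_pow (emeasure M A) (?p - 1) * ennreal_pow (Lp_norm M p (\<lambda>x. f x * indicator A x)) ?p) (1 / ?p)"
    using p1 by (intro ennreal_pow_mono) (auto simp: mult.commute)
  then show ?thesis
    unfolding e using p1 by (simp add: ennreal_pow_mult ennreal_pow_pow)
qed

section \<open>Dyadic annuli\<close>

lemma enn2real_3_div_bounds:
  assumes "1 < (p::ennreal)"
  shows "0 \<le> enn2real (3 / p)" "enn2real (3 / p) < 3"
proof -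
  show "enn2real (3 / p) < 3"
  proof (cases p)
    case (real r)
    then have r: "1 < r" using assms by (simp add: ennreal_less_iff flip: ennreal_1)
    then have "3 / p = ennreal (3 / r)"
      using divide_ennreal[of 3 r] real by simp
    then show ?thesis using r by (simp add: pos_divide_less_eq)
  qed simp
qed simp

text \<open>Half-open, so that the annuli partition the nonzero frequencies. Unlike the smooth
  dyadic pieces they do not overlap, and indicators take the place of the partition of
  unity.\<close>

definition ann :: "int \<Rightarrow> (real^3) set" where
  "ann j = {\<xi>. 2 powr real_of_int j \<le> norm \<xi> \<and> norm \<xi> < 2 powr (real_of_int j + 1)}"

lemma ann_measurable [measurable]: "ann j \<in> sets borel"
  unfolding ann_def by measurable

lemma ex_ann: "\<xi> \<noteq> 0 \<Longrightarrow> \<exists>j. \<xi> \<in> ann j"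
proof -
  assume "\<xi> \<noteq> 0"
  then have pos: "0 < norm \<xi>" by simp
  let ?j = "\<lfloor>log 2 (norm \<xi>)\<rfloor>"
  have "real_of_int ?j \<le> log 2 (norm \<xi>)" "log 2 (norm \<xi>) < real_of_int ?j + 1" by linarith+
  then have "2 powr real_of_int ?j \<le> norm \<xi>" "norm \<xi> < 2 powr (real_of_int ?j + 1)"
    using le_log_iff[of 2 "norm \<xi>" "real_of_int ?j"] log_less_iff[of 2 "norm \<xi>" "real_of_int ?j + 1"] pos
    by (simp_all del: floor_less_iff le_floor_iff of_int_floor_le)
  then show "\<exists>j. \<xi> \<in> ann j" by (auto simp: ann_def)
qed

text \<open>The annulus fits into a cube whose side is four times the inner radius, hence the factor
  64 = 4^3.\<close>

lemma emeasure_ann_le: "emeasure lborel (ann j) \<le> ennreal (64 * 2 powr (3 * real_of_int j))"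
proof -
  define a where "a = 2 powr (real_of_int j + 1)"
  have a: "0 \<le> a" by (simp add: a_def)
  have "ann j \<subseteq> cbox (- (a *\<^sub>R One)) (a *\<^sub>R One)"
  proof
    fix \<xi> assume "\<xi> \<in> ann j"
    then have n: "norm \<xi> < a" by (simp add: ann_def a_def)
    have "- a \<le> \<xi> \<bullet> b" "\<xi> \<bullet> b \<le> a" if "b \<in> Basis" for b
      using Basis_le_norm[OF that, of \<xi>] n by linarith+
    then show "\<xi> \<in> cbox (- (a *\<^sub>R One)) (a *\<^sub>R One)" by (simp add: mem_box)
  qed
  then have "emeasure lborel (ann j) \<le> emeasure lborel (cbox (- (a *\<^sub>R One)) (a *\<^sub>R One) :: (real^3) set)"
    by (intro emeasure_mono) auto
  also have "\<dots> = ennreal (\<Prod>b\<in>(Basis :: (real^3) set). 2 * a)"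
  proof (subst emeasure_lborel_cbox)
    have d: "(a *\<^sub>R One - - (a *\<^sub>R One)) \<bullet> b = 2 * a" if "b \<in> Basis" for b :: "real^3"
      using that by (simp only: inner_diff_left inner_minus_left inner_scaleR_left inner_sum_left_Basis) simp
    then show "ennreal (\<Prod>b\<in>Basis. (a *\<^sub>R One - - (a *\<^sub>R One) :: real^3) \<bullet> b) = ennreal (\<Prod>b\<in>(Basis :: (real^3) set). 2 * a)"
      by (simp only: cong: prod.cong)
    show "- (a *\<^sub>R One) \<bullet> b \<le> a *\<^sub>R One \<bullet> b" if "b \<in> Basis" for b :: "real^3"
      using that a by (simp only: inner_minus_left inner_scaleR_left inner_sum_left_Basis) simp
  qed
  also have "(\<Prod>b\<in>(Basis :: (real^3) set). 2 * a) = 64 * 2 powr (3 * real_of_int j)"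
    by (simp add: a_def power_mult_distrib powr_add powr_powr mult.commute flip: powr_numeral)
  finally show ?thesis .
qed

section \<open>Fourier-Besov norms over sharp annuli\<close>

definition ann_norm :: "ennreal \<Rightarrow> (real^3 \<Rightarrow> ennreal) \<Rightarrow> int \<Rightarrow> ennreal" where
  "ann_norm p f j = Lp_norm lborel p (\<lambda>\<xi>. f \<xi> * indicator (ann j) \<xi>)"

definition weighted_norm :: "real \<Rightarrow> ennreal \<Rightarrow> (int \<Rightarrow> ennreal) \<Rightarrow> ennreal" where
  "weighted_norm s q c = Lp_norm (count_space UNIV) q (\<lambda>j. ennreal (2 powr (real_of_int j * s)) * c j)"

text \<open>The Fourier-Besov norm with sharp annuli in place of the dyadic pieces, applied to
  absolute values. Being \<open>ennreal\<close>-valued, it can be estimated before it is known to be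
  finite.\<close>

definition besov :: "real \<Rightarrow> ennreal \<Rightarrow> ennreal \<Rightarrow> (real^3 \<Rightarrow> ennreal) \<Rightarrow> ennreal" where
  "besov s p q f = weighted_norm s q (ann_norm p f)"

lemma sigma_finite_count_int: "sigma_finite_measure (count_space (UNIV :: int set))"
  by (rule sigma_finite_measure_count_space_countable) simp

text \<open>Young's inequality for sequences: a shift by \<open>m\<close> changes the weighted norm
  by the factor \<open>2 powr (- real_of_int m * s)\<close>, and the triangle inequality sums over
  the shifts. It serves the interaction of frequencies in \<open>high_low_bound\<close> as well as
  the comparison with smooth pieces.\<close>

lemma weighted_norm_shift_sum:
  assumes q: "1 \<le> q" and le: "\<And>j. c j \<le> (\<integral>\<^sup>+m. w m * d (j + m) \<partial>count_space UNIV)"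
  shows "weighted_norm s q c
    \<le> (\<integral>\<^sup>+m. w m * ennreal (2 powr (- real_of_int m * s)) \<partial>count_space UNIV) * weighted_norm s q d"
proof -
  define e where "e i = ennreal (2 powr (real_of_int i * s)) * d i" for i :: int
  define v where "v m = w m * ennreal (2 powr (- real_of_int m * s))" for m :: int
  have "ennreal (2 powr (real_of_int j * s)) * c j \<le> (\<integral>\<^sup>+m. v m * e (j + m) \<partial>count_space UNIV)" for j
  proof -
    have "ennreal (2 powr (real_of_int j * s)) * c j
        \<le> ennreal (2 powr (real_of_int j * s)) * (\<integral>\<^sup>+m. w m * d (j + m) \<partial>count_space UNIV)"
      by (intro mult_left_mono le) simp
    also have "\<dots> = (\<integral>\<^sup>+m. ennreal (2 powr (real_of_int j * s)) * (w m * d (j + m)) \<partial>count_space UNIV)"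
      by (rule nn_integral_cmult[symmetric]) simp
    also have "\<dots> = (\<integral>\<^sup>+m. v m * e (j + m) \<partial>count_space UNIV)"
    proof (rule nn_integral_cong)
      fix m :: int
      have "ennreal (2 powr (real_of_int j * s)) =
          ennreal (2 powr (- real_of_int m * s)) * ennreal (2 powr (real_of_int (j + m) * s))"
        by (simp add: distrib_right flip: ennreal_mult powr_add)
      then show "ennreal (2 powr (real_of_int j * s)) * (w m * d (j + m)) = v m * e (j + m)"
        unfolding v_def e_def by (simp only: mult_ac)
    qed
    finally show ?thesis .
  qed
  then have "weighted_norm s q c \<le> Lp_norm (count_space UNIV) q (\<lambda>j. \<integral>\<^sup>+m. v m * e (j + m) \<partial>count_space UNIV)"
    unfolding weighted_norm_def by (intro Lp_norm_mono_AE q) auto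
  also have "\<dots> \<le> (\<integral>\<^sup>+m. Lp_norm (count_space UNIV) q (\<lambda>j. v m * e (j + m)) \<partial>count_space UNIV)"
    by (intro Lp_norm_countable_sum sigma_finite_count_int q) simp
  also have "\<dots> \<le> (\<integral>\<^sup>+m. v m * Lp_norm (count_space UNIV) q e \<partial>count_space UNIV)"
  proof (rule nn_integral_mono)
    fix m :: int
    have "bij (\<lambda>j. j + m)" by (rule bij_betw_byWitness[where f' = "\<lambda>j. j - m"]) auto
    then have "distr (count_space UNIV) (count_space UNIV) (\<lambda>j. j + m) = count_space UNIV"
      by (rule distr_bij_count_space)
    then have "Lp_norm (count_space UNIV) q (\<lambda>j. e (j + m)) \<le> Lp_norm (count_space UNIV) q e"
      by (intro Lp_norm_measure_preserving q) auto
    then show "Lp_norm (count_space UNIV) q (\<lambda>j. v m * e (j + m)) \<le> v m * Lp_norm (count_space UNIV) q e"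
      by (intro order_trans[OF Lp_norm_cmult[OF q]] mult_left_mono) auto
  qed
  also have "\<dots> = (\<integral>\<^sup>+m. v m \<partial>count_space UNIV) * Lp_norm (count_space UNIV) q e"
    by (rule nn_integral_multc) simp
  finally show ?thesis by (simp add: v_def e_def[abs_def] weighted_norm_def)
qed

definition geom :: "int \<Rightarrow> real \<Rightarrow> ennreal" where
  "geom a \<sigma> = (\<integral>\<^sup>+m. (if a \<le> m then ennreal (2 powr (- real_of_int m * \<sigma>)) else 0) \<partial>count_space UNIV)"

lemma geom_finite:
  assumes "0 < \<sigma>" shows "geom a \<sigma> < \<infinity>"
proof -
  have "geom a \<sigma> = (\<integral>\<^sup>+m. ennreal (2 powr (- real_of_int m * \<sigma>)) * indicator {a..} m \<partial>count_space UNIV)"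
    unfolding geom_def by (intro nn_integral_cong) (auto split: split_indicator)
  also have "\<dots> = (\<integral>\<^sup>+m. ennreal (2 powr (- real_of_int m * \<sigma>)) \<partial>count_space {a..})"
    by (subst nn_integral_count_space_indicator) auto
  also have "\<dots> = (\<integral>\<^sup>+n. ennreal (2 powr (- real_of_int (a + int n) * \<sigma>)) \<partial>count_space UNIV)"
    by (rule nn_integral_bij_count_space[symmetric])
      (rule bij_betw_byWitness[where f' = "\<lambda>m. nat (m - a)"], auto)
  also have "\<dots> = (\<Sum>n. ennreal (2 powr (- real_of_int (a + int n) * \<sigma>)))"
    by (rule nn_integral_count_space_nat)
  also have "\<dots> < \<infinity>"
  proof -
    have "2 powr (- \<sigma>) < 1" using assms by (simp add: powr_less_one)
    then have "summable (\<lambda>n. 2 powr (- real_of_int a * \<sigma>) * (2 powr (- \<sigma>)) ^ n)"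
      by (intro summable_mult summable_geometric) simp
    moreover have "2 powr (- real_of_int (a + int n) * \<sigma>) = 2 powr (- real_of_int a * \<sigma>) * (2 powr (- \<sigma>)) ^ n" for n
    proof -
      have "(2 powr (- \<sigma>)) ^ n = 2 powr (- \<sigma> * real n)" by (simp add: powr_powr flip: powr_realpow)
      then show ?thesis by (simp add: algebra_simps flip: powr_add)
    qed
    ultimately have "summable (\<lambda>n. 2 powr (- real_of_int (a + int n) * \<sigma>))" by simp
    then show ?thesis by (simp add: suminf_ennreal2 less_top)
  qed
  finally show ?thesis .
qed

text \<open>The reflection \<open>m = i - k\<close> turns the sum over all scales up to
  \<open>i\<close> into a geometric series starting at 0.\<close>

lemma geom_below:
  "(\<integral>\<^sup>+k. (if k \<le> i then ennreal (2 powr (real_of_int k * \<beta>)) else 0) \<partial>count_space UNIV)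
    = ennreal (2 powr (real_of_int i * \<beta>)) * geom 0 \<beta>"
proof -
  have "(\<integral>\<^sup>+k. (if k \<le> i then ennreal (2 powr (real_of_int k * \<beta>)) else 0) \<partial>count_space UNIV)
      = (\<integral>\<^sup>+m. (if i - m \<le> i then ennreal (2 powr (real_of_int (i - m) * \<beta>)) else 0) \<partial>count_space UNIV)"
    by (rule nn_integral_bij_count_space[symmetric])
      (rule bij_betw_byWitness[where f' = "\<lambda>m. i - m"], auto)
  also have "\<dots> = (\<integral>\<^sup>+m. ennreal (2 powr (real_of_int i * \<beta>)) *
      (if 0 \<le> m then ennreal (2 powr (- real_of_int m * \<beta>)) else 0) \<partial>count_space UNIV)"
    by (intro nn_integral_cong) (auto simp: left_diff_distrib simp flip: ennreal_mult powr_add)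
  also have "\<dots> = ennreal (2 powr (real_of_int i * \<beta>)) * geom 0 \<beta>"
    unfolding geom_def by (rule nn_integral_cmult) simp
  finally show ?thesis .
qed

lemma nn_integral_countable_sum_le:
  fixes F :: "'i::countable \<Rightarrow> 'a \<Rightarrow> ennreal"
  assumes "sigma_finite_measure M" "\<And>i. F i \<in> borel_measurable M"
  shows "(\<integral>\<^sup>+x. \<integral>\<^sup>+i. F i x \<partial>count_space UNIV \<partial>M) \<le> (\<integral>\<^sup>+i. \<integral>\<^sup>+x. F i x \<partial>M \<partial>count_space UNIV)"
  using Lp_norm_countable_sum[OF assms(1) order_refl[of 1], of F] assms(2) by (simp add: Lp_norm_def)

context
  fixes p q :: ennreal
  assumes p: "1 < p" and q: "1 \<le> q"
begin

lemma p1: "1 \<le> p" using p by simp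

lemma besov_mono_AE:
  assumes [measurable]: "f \<in> borel_measurable borel" and "AE \<xi> in lborel. f \<xi> \<le> g \<xi>"
  shows "besov s p q f \<le> besov s p q g"
proof -
  have "ann_norm p f j \<le> ann_norm p g j" for j
    unfolding ann_norm_def using assms(2)
    by (intro Lp_norm_mono_AE p1) (auto elim!: eventually_mono intro!: mult_right_mono)
  then show ?thesis
    unfolding besov_def weighted_norm_def by (intro Lp_norm_mono_AE q) (auto intro!: mult_left_mono)
qed

lemma besov_mono:
  "f \<in> borel_measurable borel \<Longrightarrow> (\<And>\<xi>. f \<xi> \<le> g \<xi>) \<Longrightarrow> besov s p q f \<le> besov s p q g"
  by (intro besov_mono_AE) auto

lemma besov_add:
  assumes [measurable]: "f \<in> borel_measurable borel" "g \<in> borel_measurable borel"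
  shows "besov s p q (\<lambda>\<xi>. f \<xi> + g \<xi>) \<le> besov s p q f + besov s p q g"
proof -
  have a: "ann_norm p (\<lambda>\<xi>. f \<xi> + g \<xi>) j \<le> ann_norm p f j + ann_norm p g j" for j
    using Lp_norm_add[OF sigma_finite_lborel p1, of "\<lambda>\<xi>. f \<xi> * indicator (ann j) \<xi>" "\<lambda>\<xi>. g \<xi> * indicator (ann j) \<xi>"]
    by (simp add: ann_norm_def distrib_right)
  have "besov s p q (\<lambda>\<xi>. f \<xi> + g \<xi>) \<le> Lp_norm (count_space UNIV) q
      (\<lambda>j. ennreal (2 powr (real_of_int j * s)) * ann_norm p f j + ennreal (2 powr (real_of_int j * s)) * ann_norm p g j)"
    unfolding besov_def weighted_norm_def using a
    by (intro Lp_norm_mono_AE q) (auto simp flip: distrib_left intro!: mult_left_mono)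
  also have "\<dots> \<le> besov s p q f + besov s p q g"
    unfolding besov_def weighted_norm_def by (intro Lp_norm_add sigma_finite_count_int q) auto
  finally show ?thesis .
qed

lemma besov_cmult:
  assumes [measurable]: "f \<in> borel_measurable borel"
  shows "besov s p q (\<lambda>\<xi>. c * f \<xi>) \<le> c * besov s p q f"
proof -
  have a: "ann_norm p (\<lambda>\<xi>. c * f \<xi>) j \<le> c * ann_norm p f j" for j
    using Lp_norm_cmult[OF p1, of "\<lambda>\<xi>. f \<xi> * indicator (ann j) \<xi>" lborel c]
    by (simp add: ann_norm_def mult.assoc)
  have "besov s p q (\<lambda>\<xi>. c * f \<xi>) \<le> Lp_norm (count_space UNIV) q
      (\<lambda>j. c * (ennreal (2 powr (real_of_int j * s)) * ann_norm p f j))"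
    unfolding besov_def weighted_norm_def mult.left_commute[of c] using a
    by (intro Lp_norm_mono_AE q) (auto intro!: mult_left_mono)
  also have "\<dots> \<le> c * besov s p q f"
    unfolding besov_def weighted_norm_def by (intro Lp_norm_cmult q) auto
  finally show ?thesis .
qed

text \<open>Monotone convergence twice, inside each annulus and over the scales. It carries a
  uniform bound on the majorants to their supremum.\<close>

lemma besov_SUP:
  assumes [measurable]: "\<And>n::nat. f n \<in> borel_measurable borel"
    and inc: "\<And>n \<xi>. f n \<xi> \<le> f (Suc n) \<xi>" and B: "\<And>n. besov s p q (f n) \<le> B"
  shows "besov s p q (\<lambda>\<xi>. SUP n. f n \<xi>) \<le> B"
proof -
  have mono: "ann_norm p (f n) j \<le> ann_norm p (f (Suc n)) j" for n j
    unfolding ann_norm_def by (intro Lp_norm_mono_AE p1) (auto intro!: mult_right_mono inc)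
  have a: "ann_norm p (\<lambda>\<xi>. SUP n. f n \<xi>) j \<le> (SUP n. ann_norm p (f n) j)" for j
  proof -
    have "Lp_norm lborel p (\<lambda>\<xi>. SUP n. f n \<xi> * indicator (ann j) \<xi>) \<le> (SUP n. ann_norm p (f n) j)"
      by (intro Lp_norm_SUP p1) (auto intro!: mult_right_mono inc SUP_upper2 simp: ann_norm_def)
    then show ?thesis by (simp add: ann_norm_def SUP_mult_right_ennreal)
  qed
  have "besov s p q (\<lambda>\<xi>. SUP n. f n \<xi>) \<le> Lp_norm (count_space UNIV) q
      (\<lambda>j. SUP n. ennreal (2 powr (real_of_int j * s)) * ann_norm p (f n) j)"
    unfolding besov_def weighted_norm_def using a
    by (intro Lp_norm_mono_AE q) (auto intro!: mult_left_mono simp flip: SUP_mult_left_ennreal)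
  also have "\<dots> \<le> B"
    using B unfolding besov_def weighted_norm_def
    by (intro Lp_norm_SUP q) (auto intro!: mult_left_mono mono)
  finally show ?thesis .
qed

lemma besov_eq_0:
  assumes [measurable]: "f \<in> borel_measurable borel" and "besov s p q f = 0"
  shows "AE \<xi> in lborel. f \<xi> = 0"
proof -
  have "AE \<xi> in lborel. f \<xi> * indicator (ann j) \<xi> = 0" for j
  proof (rule Lp_norm_eq_0[OF p1])
    have "ennreal (2 powr (real_of_int j * s)) * ann_norm p f j \<le> 0"
      using Lp_norm_point[OF q, of "\<lambda>j. ennreal (2 powr (real_of_int j * s)) * ann_norm p f j" j] assms(2)
      by (simp add: besov_def weighted_norm_def)
    then show "Lp_norm lborel p (\<lambda>\<xi>. f \<xi> * indicator (ann j) \<xi>) = 0"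
      by (simp add: ann_norm_def ennreal_eq_0_iff not_le)
  qed measurable
  then have "AE \<xi> in lborel. \<forall>j. f \<xi> * indicator (ann j) \<xi> = 0" unfolding AE_all_countable by blast
  moreover have "AE \<xi> in lborel. \<xi> \<noteq> (0 :: real^3)" by (rule AE_lborel_singleton)
  ultimately show ?thesis
  proof eventually_elim
    case (elim \<xi>)
    obtain j where "\<xi> \<in> ann j" using ex_ann elim by blast
    then show ?case using elim(1)[rule_format, of j] by simp
  qed
qed

text \<open>On an annulus, \<open>norm \<xi> powr \<gamma>\<close> is comparable to
  \<open>2 powr (j * \<gamma>)\<close>. For \<gamma> \<ge> 0 the outer radius decides, for \<gamma>
  < 0 the inner one, and the factor \<open>2 powr \<bar>\<gamma>\<bar>\<close> covers both.\<close>

lemma besov_weight: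
  assumes [measurable]: "f \<in> borel_measurable borel"
  shows "besov s p q (\<lambda>\<xi>. ennreal (norm \<xi> powr \<gamma>) * f \<xi>) \<le> ennreal (2 powr \<bar>\<gamma>\<bar>) * besov (s + \<gamma>) p q f"
proof -
  have a: "ann_norm p (\<lambda>\<xi>. ennreal (norm \<xi> powr \<gamma>) * f \<xi>) j
      \<le> ennreal (2 powr \<bar>\<gamma>\<bar>) * (ennreal (2 powr (real_of_int j * \<gamma>)) * ann_norm p f j)" for j
  proof -
    let ?c = "2 powr \<bar>\<gamma>\<bar> * 2 powr (real_of_int j * \<gamma>)"
    have le: "norm \<xi> powr \<gamma> \<le> ?c" if "\<xi> \<in> ann j" for \<xi>
    proof -
      have b: "2 powr real_of_int j \<le> norm \<xi>" "norm \<xi> \<le> 2 powr (real_of_int j + 1)" "0 < norm \<xi>"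
        using that powr_gt_zero[of 2 "real_of_int j"] by (auto simp: ann_def simp del: powr_gt_zero)
      show ?thesis
      proof (cases "0 \<le> \<gamma>")
        case True
        then have "norm \<xi> powr \<gamma> \<le> (2 powr (real_of_int j + 1)) powr \<gamma>" using b by (intro powr_mono2) auto
        also have "\<dots> = 2 powr ((real_of_int j + 1) * \<gamma>)" by (simp only: powr_powr)
        also have "\<dots> = ?c" using True by (simp add: algebra_simps powr_add)
        finally show ?thesis .
      next
        case False
        then have "norm \<xi> powr \<gamma> \<le> (2 powr real_of_int j) powr \<gamma>" using b by (intro powr_mono2') auto
        also have "\<dots> = 1 * 2 powr (real_of_int j * \<gamma>)" by (simp add: powr_powr)
        also have "\<dots> \<le> ?c" by (intro mult_right_mono ge_one_powr_ge_zero) auto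
        finally show ?thesis .
      qed
    qed
    have "ann_norm p (\<lambda>\<xi>. ennreal (norm \<xi> powr \<gamma>) * f \<xi>) j
        \<le> Lp_norm lborel p (\<lambda>\<xi>. ennreal ?c * (f \<xi> * indicator (ann j) \<xi>))"
      unfolding ann_norm_def
    proof (intro Lp_norm_mono_AE p1 AE_I2)
      fix \<xi> show "ennreal (norm \<xi> powr \<gamma>) * f \<xi> * indicator (ann j) \<xi> \<le> ennreal ?c * (f \<xi> * indicator (ann j) \<xi>)"
        using le[of \<xi>] by (auto split: split_indicator intro!: mult_right_mono ennreal_leI)
    qed measurable
    also have "\<dots> \<le> ennreal ?c * ann_norm p f j"
      unfolding ann_norm_def by (intro Lp_norm_cmult p1) measurable
    finally show ?thesis by (simp add: ennreal_mult mult.assoc)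
  qed
  have "besov s p q (\<lambda>\<xi>. ennreal (norm \<xi> powr \<gamma>) * f \<xi>) \<le> Lp_norm (count_space UNIV) q
      (\<lambda>j. ennreal (2 powr \<bar>\<gamma>\<bar>) * (ennreal (2 powr (real_of_int j * (s + \<gamma>))) * ann_norm p f j))"
    unfolding besov_def weighted_norm_def
  proof (intro Lp_norm_mono_AE q AE_I2)
    fix j :: int
    have "ennreal (2 powr (real_of_int j * s)) * ann_norm p (\<lambda>\<xi>. ennreal (norm \<xi> powr \<gamma>) * f \<xi>) j
      \<le> ennreal (2 powr (real_of_int j * s)) * (ennreal (2 powr \<bar>\<gamma>\<bar>) * (ennreal (2 powr (real_of_int j * \<gamma>)) * ann_norm p f j))"
      by (intro mult_left_mono a) simp
    also have "\<dots> = ennreal (2 powr \<bar>\<gamma>\<bar>) * (ennreal (2 powr (real_of_int j * (s + \<gamma>))) * ann_norm p f j)"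
      by (simp add: distrib_left powr_add ennreal_mult mult_ac)
    finally show "ennreal (2 powr (real_of_int j * s)) * ann_norm p (\<lambda>\<xi>. ennreal (norm \<xi> powr \<gamma>) * f \<xi>) j
      \<le> ennreal (2 powr \<bar>\<gamma>\<bar>) * (ennreal (2 powr (real_of_int j * (s + \<gamma>))) * ann_norm p f j)" .
  qed simp
  also have "\<dots> \<le> ennreal (2 powr \<bar>\<gamma>\<bar>) * besov (s + \<gamma>) p q f"
    unfolding besov_def weighted_norm_def by (intro Lp_norm_cmult q) auto
  finally show ?thesis .
qed


text \<open>Hoelder on an annulus, whose volume is of order \<open>2 powr (3 * j)\<close>; then one
  term of the sequence norm is bounded by the whole norm.\<close>

lemma ann_integral_le:
  assumes [measurable]: "f \<in> borel_measurable borel"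
  shows "(\<integral>\<^sup>+\<xi>. f \<xi> * indicator (ann j) \<xi> \<partial>lborel)
    \<le> ennreal 64 * (ennreal (2 powr (real_of_int j * (3 - enn2real (3 / p) - s))) * besov s p q f)"
proof -
  note rb = enn2real_3_div_bounds[OF p]
  have "(\<integral>\<^sup>+\<xi>. f \<xi> * indicator (ann j) \<xi> \<partial>lborel)
      \<le> ennreal_pow (emeasure lborel (ann j)) (1 - enn2real (3 / p) / 3) * ann_norm p f j"
    unfolding ann_norm_def using emeasure_ann_le[of j]
    by (intro nn_integral_le_Lp_norm p) (auto simp: less_top[symmetric] top_unique)
  also have "\<dots> \<le> ennreal (64 * 2 powr (real_of_int j * (3 - enn2real (3 / p)))) * ann_norm p f j"
  proof (rule mult_right_mono)
    have "ennreal_pow (emeasure lborel (ann j)) (1 - enn2real (3 / p) / 3) \<le> ennreal_pow (ennreal (64 * 2 powr (3 * real_of_int j))) (1 - enn2real (3 / p) / 3)"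
      using rb by (intro ennreal_pow_mono emeasure_ann_le) auto
    also have "\<dots> = ennreal (64 powr (1 - enn2real (3 / p) / 3) * 2 powr (3 * real_of_int j * (1 - enn2real (3 / p) / 3)))"
      by (simp add: ennreal_pow_ennreal powr_mult powr_powr)
    also have "3 * real_of_int j * (1 - enn2real (3 / p) / 3) = real_of_int j * (3 - enn2real (3 / p))" by (simp add: algebra_simps)
    also have "ennreal (64 powr (1 - enn2real (3 / p) / 3) * 2 powr (real_of_int j * (3 - enn2real (3 / p)))) \<le> ennreal (64 powr 1 * 2 powr (real_of_int j * (3 - enn2real (3 / p))))"
      using rb by (intro ennreal_leI mult_right_mono powr_mono) auto
    finally show "ennreal_pow (emeasure lborel (ann j)) (1 - enn2real (3 / p) / 3) \<le> ennreal (64 * 2 powr (real_of_int j * (3 - enn2real (3 / p))))" by simp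
  qed simp
  also have "\<dots> = ennreal 64 * (ennreal (2 powr (real_of_int j * (3 - enn2real (3 / p) - s))) * (ennreal (2 powr (real_of_int j * s)) * ann_norm p f j))"
  proof -
    have "64 * 2 powr (real_of_int j * (3 - enn2real (3 / p))) = 64 * (2 powr (real_of_int j * (3 - enn2real (3 / p) - s)) * 2 powr (real_of_int j * s))"
      by (simp add: algebra_simps flip: powr_add)
    then show ?thesis by (simp add: ennreal_mult mult.assoc)
  qed
  also have "\<dots> \<le> ennreal 64 * (ennreal (2 powr (real_of_int j * (3 - enn2real (3 / p) - s))) * besov s p q f)"
    unfolding besov_def weighted_norm_def
    by (intro mult_left_mono Lp_norm_point[OF q, of "\<lambda>j. ennreal (2 powr (real_of_int j * s)) * ann_norm p f j" j]) auto
  finally show ?thesis .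
qed

text \<open>Up to the origin, the ball is the union of the annuli with \<open>k \<le> i\<close>.
  Their contributions decrease geometrically towards low frequencies when 3 - 3/p - s > 0, and then
  the factor \<open>geom\<close> is finite.\<close>

lemma ball_integral_le:
  assumes [measurable]: "f \<in> borel_measurable borel"
  shows "(\<integral>\<^sup>+\<xi>. f \<xi> * indicator {\<xi>. norm \<xi> < 2 powr (real_of_int i + 1)} \<xi> \<partial>lborel)
    \<le> ennreal 64 * geom 0 (3 - enn2real (3 / p) - s) * (ennreal (2 powr (real_of_int i * (3 - enn2real (3 / p) - s))) * besov s p q f)"
proof -
  let ?\<beta> = "3 - enn2real (3 / p) - s"
  have "(\<integral>\<^sup>+\<xi>. f \<xi> * indicator {\<xi>. norm \<xi> < 2 powr (real_of_int i + 1)} \<xi> \<partial>lborel)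
    \<le> (\<integral>\<^sup>+\<xi>. \<integral>\<^sup>+k. (if k \<le> i then f \<xi> * indicator (ann k) \<xi> else 0) \<partial>count_space UNIV \<partial>lborel)"
  proof (rule nn_integral_mono_AE)
    have "AE \<xi> in lborel. \<xi> \<noteq> (0 :: real^3)" by (rule AE_lborel_singleton)
    then show "AE \<xi> in lborel. f \<xi> * indicator {\<xi>. norm \<xi> < 2 powr (real_of_int i + 1)} \<xi>
      \<le> (\<integral>\<^sup>+k. (if k \<le> i then f \<xi> * indicator (ann k) \<xi> else 0) \<partial>count_space UNIV)"
    proof eventually_elim
      case (elim \<xi>)
      obtain k where k: "\<xi> \<in> ann k" using ex_ann[OF elim] by blast
      show ?case
      proof (cases "norm \<xi> < 2 powr (real_of_int i + 1)")
        case True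
        have "2 powr real_of_int k \<le> norm \<xi>" using k by (simp add: ann_def)
        then have "2 powr real_of_int k < 2 powr (real_of_int i + 1)" using True by linarith
        then have "k \<le> i" by simp
        then have "f \<xi> * indicator {\<xi>. norm \<xi> < 2 powr (real_of_int i + 1)} \<xi>
            \<le> (if k \<le> i then f \<xi> * indicator (ann k) \<xi> else 0)" using k by (auto split: split_indicator)
        also have "\<dots> \<le> (\<integral>\<^sup>+k. (if k \<le> i then f \<xi> * indicator (ann k) \<xi> else 0) \<partial>count_space UNIV)"
          by (rule nn_integral_ge_point) simp
        finally show ?thesis .
      qed simp
    qed
  qed
  also have "\<dots> \<le> (\<integral>\<^sup>+k. \<integral>\<^sup>+\<xi>. (if k \<le> i then f \<xi> * indicator (ann k) \<xi> else 0) \<partial>lborel \<partial>count_space UNIV)"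
    by (intro nn_integral_countable_sum_le sigma_finite_lborel) auto
  also have "\<dots> \<le> (\<integral>\<^sup>+k. (if k \<le> i then ennreal (2 powr (real_of_int k * ?\<beta>)) else 0) * (ennreal 64 * besov s p q f) \<partial>count_space UNIV)"
  proof (rule nn_integral_mono)
    fix k
    show "(\<integral>\<^sup>+\<xi>. (if k \<le> i then f \<xi> * indicator (ann k) \<xi> else 0) \<partial>lborel)
      \<le> (if k \<le> i then ennreal (2 powr (real_of_int k * ?\<beta>)) else 0) * (ennreal 64 * besov s p q f)"
      using ann_integral_le[of f k s] by (simp add: mult_ac)
  qed
  also have "\<dots> = (ennreal (2 powr (real_of_int i * ?\<beta>)) * geom 0 ?\<beta>) * (ennreal 64 * besov s p q f)"
    by (simp only: nn_integral_multc[OF borel_measurable_count_space] geom_below)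
  finally show ?thesis by (simp only: mult_ac)
qed

text \<open>Low frequencies are summable by the sign of 3 - 3/p - s, high ones by the polynomial
  weight.\<close>

lemma moderate_growth:
  assumes [measurable]: "f \<in> borel_measurable borel" and fin: "besov s p q f < \<infinity>" and \<beta>: "0 < 3 - enn2real (3 / p) - s"
  shows "\<exists>M::nat. (\<integral>\<^sup>+\<xi>. f \<xi> * ennreal (1 / (1 + norm \<xi>) ^ M) \<partial>lborel) < \<infinity>"
proof -
  let ?\<beta> = "3 - enn2real (3 / p) - s"
  \<comment> \<open>On annuli with \<open>k \<ge> 0\<close> this \<open>M\<close> outweighs the
    growth of order \<open>2 powr (k * ?\<beta>)\<close> and leaves a further factor
    \<open>2 powr (- k)\<close>.\<close>
  obtain M :: nat where M: "?\<beta> + 1 \<le> real M" using real_arch_simple by blast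
  let ?w = "\<lambda>k::int. (if 0 \<le> k then ennreal (2 powr (- real_of_int k * 1)) else 0) +
      (if k \<le> 0 then ennreal (2 powr (real_of_int k * ?\<beta>)) else 0)"
  have "(\<integral>\<^sup>+\<xi>. f \<xi> * ennreal (1 / (1 + norm \<xi>) ^ M) \<partial>lborel)
    \<le> (\<integral>\<^sup>+\<xi>. \<integral>\<^sup>+k. f \<xi> * indicator (ann k) \<xi> * ennreal (1 / (1 + norm \<xi>) ^ M) \<partial>count_space UNIV \<partial>lborel)"
  proof (rule nn_integral_mono_AE)
    have "AE \<xi> in lborel. \<xi> \<noteq> (0 :: real^3)" by (rule AE_lborel_singleton)
    then show "AE \<xi> in lborel. f \<xi> * ennreal (1 / (1 + norm \<xi>) ^ M)
      \<le> (\<integral>\<^sup>+k. f \<xi> * indicator (ann k) \<xi> * ennreal (1 / (1 + norm \<xi>) ^ M) \<partial>count_space UNIV)"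
    proof eventually_elim
      case (elim \<xi>)
      obtain k where k: "\<xi> \<in> ann k" using ex_ann[OF elim] by blast
      have "f \<xi> * ennreal (1 / (1 + norm \<xi>) ^ M) = f \<xi> * indicator (ann k) \<xi> * ennreal (1 / (1 + norm \<xi>) ^ M)"
        using k by simp
      also have "\<dots> \<le> (\<integral>\<^sup>+k. f \<xi> * indicator (ann k) \<xi> * ennreal (1 / (1 + norm \<xi>) ^ M) \<partial>count_space UNIV)"
        by (rule nn_integral_ge_point) simp
      finally show ?case .
    qed
  qed
  also have "\<dots> \<le> (\<integral>\<^sup>+k. \<integral>\<^sup>+\<xi>. f \<xi> * indicator (ann k) \<xi> * ennreal (1 / (1 + norm \<xi>) ^ M) \<partial>lborel \<partial>count_space UNIV)"
    by (intro nn_integral_countable_sum_le sigma_finite_lborel) measurable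
  also have "\<dots> \<le> (\<integral>\<^sup>+k. ?w k * (ennreal 64 * besov s p q f) \<partial>count_space UNIV)"
  proof (rule nn_integral_mono)
    fix k :: int
    let ?t = "if 0 \<le> k then 2 powr (- (real_of_int k * real M)) else 1"
    have t: "1 / (1 + norm \<xi>) ^ M \<le> ?t" if "\<xi> \<in> ann k" for \<xi>
    proof (cases "0 \<le> k")
      case True
      have "(2 powr real_of_int k) ^ M \<le> (1 + norm \<xi>) ^ M" using that by (intro power_mono) (auto simp: ann_def)
      then have "1 / (1 + norm \<xi>) ^ M \<le> 1 / (2 powr real_of_int k) ^ M" by (intro divide_left_mono) (auto intro!: mult_pos_pos zero_less_power add_pos_nonneg)
      then show ?thesis using True by (simp add: powr_minus divide_inverse powr_powr flip: powr_realpow)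
    next
      case False
      have "1 \<le> (1 + norm \<xi>) ^ M" by (intro one_le_power) simp
      then show ?thesis using False by (simp add: divide_le_eq)
    qed
    have "(\<integral>\<^sup>+\<xi>. f \<xi> * indicator (ann k) \<xi> * ennreal (1 / (1 + norm \<xi>) ^ M) \<partial>lborel)
      \<le> (\<integral>\<^sup>+\<xi>. f \<xi> * indicator (ann k) \<xi> * ennreal ?t \<partial>lborel)"
    proof (rule nn_integral_mono)
      fix \<xi> show "f \<xi> * indicator (ann k) \<xi> * ennreal (1 / (1 + norm \<xi>) ^ M) \<le> f \<xi> * indicator (ann k) \<xi> * ennreal ?t"
      proof (cases "\<xi> \<in> ann k")
        case True
        show ?thesis by (intro mult_left_mono ennreal_leI t True) simp
      qed simp
    qed
    also have "\<dots> = (\<integral>\<^sup>+\<xi>. f \<xi> * indicator (ann k) \<xi> \<partial>lborel) * ennreal ?t"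
      by (rule nn_integral_multc) measurable
    also have "\<dots> \<le> (ennreal 64 * (ennreal (2 powr (real_of_int k * ?\<beta>)) * besov s p q f)) * ennreal ?t"
      by (intro mult_right_mono ann_integral_le) auto
    also have "\<dots> = ennreal (2 powr (real_of_int k * ?\<beta>) * ?t) * (ennreal 64 * besov s p q f)"
      by (subst ennreal_mult) (auto simp: mult_ac)
    also have "\<dots> \<le> ?w k * (ennreal 64 * besov s p q f)"
    proof (rule mult_right_mono)
      show "ennreal (2 powr (real_of_int k * ?\<beta>) * ?t) \<le> ?w k"
      proof (cases "0 \<le> k")
        case True
        have "real_of_int k * ?\<beta> + - (real_of_int k * real M) \<le> - real_of_int k * 1"
          using mult_left_mono[OF M, of "real_of_int k"] True by (simp add: algebra_simps)
        then have "2 powr (real_of_int k * ?\<beta>) * ?t \<le> 2 powr (- real_of_int k * 1)"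
          using True by (simp flip: powr_add)
        then have "ennreal (2 powr (real_of_int k * ?\<beta>) * ?t) \<le> ennreal (2 powr (- real_of_int k * 1))" by (rule ennreal_leI)
        then show ?thesis using True by (auto intro: order_trans)
      qed auto
    qed simp
    finally show "(\<integral>\<^sup>+\<xi>. f \<xi> * indicator (ann k) \<xi> * ennreal (1 / (1 + norm \<xi>) ^ M) \<partial>lborel)
      \<le> ?w k * (ennreal 64 * besov s p q f)" .
  qed
  also have "\<dots> = (geom 0 1 + geom 0 ?\<beta>) * (ennreal 64 * besov s p q f)"
    using geom_below[of 0 ?\<beta>]
    by (simp add: nn_integral_multc nn_integral_add geom_def)
  also have "\<dots> < \<infinity>"
    using geom_finite[of 1 0] geom_finite[OF \<beta>, of 0] fin
    by (auto simp: ennreal_mult_less_top)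
  finally show ?thesis by blast
qed

end

section \<open>Convolution in Fourier-Besov norms\<close>

definition conv :: "(real^3 \<Rightarrow> ennreal) \<Rightarrow> (real^3 \<Rightarrow> ennreal) \<Rightarrow> real^3 \<Rightarrow> ennreal" where
  "conv f h \<xi> = (\<integral>\<^sup>+\<eta>. f (\<xi> - \<eta>) * h \<eta> \<partial>lborel)"

lemma conv_measurable [measurable]:
  assumes [measurable]: "f \<in> borel_measurable borel" "h \<in> borel_measurable borel"
  shows "conv f h \<in> borel_measurable borel"
  unfolding conv_def by measurable

lemma nn_integral_reflect:
  fixes f :: "real^3 \<Rightarrow> ennreal"
  assumes [measurable]: "f \<in> borel_measurable borel"
  shows "(\<integral>\<^sup>+\<eta>. f (\<xi> - \<eta>) \<partial>lborel) = (\<integral>\<^sup>+\<eta>. f \<eta> \<partial>lborel)"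
proof -
  have "(\<integral>\<^sup>+\<eta>. f \<eta> \<partial>lborel) = (\<integral>\<^sup>+\<eta>. f \<eta> \<partial>density (distr lborel borel (\<lambda>x. \<xi> + (-1) *\<^sub>R x)) (\<lambda>_. ennreal (\<bar>-1\<bar> ^ DIM(real^3))))"
    using lborel_affine[of "-1" \<xi>] by simp
  also have "\<dots> = (\<integral>\<^sup>+\<eta>. f (\<xi> - \<eta>) \<partial>lborel)"
    by (simp add: density_1 nn_integral_distr)
  finally show ?thesis ..
qed


lemma conv_mono:
  "(\<And>\<xi>. f \<xi> \<le> f' \<xi>) \<Longrightarrow> (\<And>\<xi>. h \<xi> \<le> h' \<xi>) \<Longrightarrow> conv f h \<xi> \<le> conv f' h' \<xi>"
  unfolding conv_def by (intro nn_integral_mono mult_mono) auto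

text \<open>The convolution is an average of translates of \<open>f\<close> with weight
  \<open>h\<close>, and all translates have the same norm.\<close>

lemma young_inequality:
  assumes p: "1 \<le> p" and [measurable]: "f \<in> borel_measurable borel" "h \<in> borel_measurable borel"
    and fin: "(\<integral>\<^sup>+\<eta>. h \<eta> \<partial>lborel) < \<infinity>"
  shows "Lp_norm lborel p (conv f h) \<le> (\<integral>\<^sup>+\<eta>. h \<eta> \<partial>lborel) * Lp_norm lborel p f"
proof -
  have "Lp_norm lborel p (\<lambda>\<xi>. \<integral>\<^sup>+\<eta>. h \<eta> * (\<lambda>(\<eta>, \<xi>). f (\<xi> - \<eta>)) (\<eta>, \<xi>) \<partial>lborel)
      \<le> (\<integral>\<^sup>+\<eta>. h \<eta> \<partial>lborel) * Lp_norm lborel p f"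
  proof (rule Lp_norm_average[OF sigma_finite_lborel sigma_finite_lborel p _ _ fin])
    fix \<eta> :: "real^3"
    have "distr lborel lborel (\<lambda>\<xi>. \<xi> - \<eta>) = distr lborel borel ((+) (- \<eta>))"
      by (intro distr_cong) (auto simp: add.commute)
    then have "distr lborel lborel (\<lambda>\<xi>. \<xi> - \<eta>) = lborel" by (simp only: lborel_distr_plus)
    then show "Lp_norm lborel p (\<lambda>\<xi>. (\<lambda>(\<eta>, \<xi>). f (\<xi> - \<eta>)) (\<eta>, \<xi>)) \<le> Lp_norm lborel p f"
      using Lp_norm_measure_preserving[OF p, of "\<lambda>\<xi>. \<xi> - \<eta>" lborel f] by simp
  qed measurable
  then show ?thesis by (simp add: conv_def[abs_def] mult.commute)
qed


definition high_low :: "(real^3 \<Rightarrow> ennreal) \<Rightarrow> (real^3 \<Rightarrow> ennreal) \<Rightarrow> real^3 \<Rightarrow> ennreal" where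
  "high_low f h \<xi> = (\<integral>\<^sup>+\<eta>. f (\<xi> - \<eta>) * h \<eta> * indicator {\<eta>. norm \<eta> \<le> norm (\<xi> - \<eta>)} \<eta> \<partial>lborel)"

lemma high_low_measurable [measurable]:
  assumes [measurable]: "f \<in> borel_measurable borel" "h \<in> borel_measurable borel"
  shows "high_low f h \<in> borel_measurable borel"
proof -
  have [measurable]: "(\<lambda>p::(real^3) \<times> (real^3). indicator {\<eta>. norm \<eta> \<le> norm (fst p - \<eta>)} (snd p) :: ennreal)
      \<in> borel_measurable (borel \<Otimes>\<^sub>M borel)"
  proof -
    have "(\<lambda>p::(real^3) \<times> (real^3). indicator {\<eta>. norm \<eta> \<le> norm (fst p - \<eta>)} (snd p) :: ennreal)
      = (\<lambda>p. if norm (snd p) \<le> norm (fst p - snd p) then 1 else 0)" by (auto simp: fun_eq_iff)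
    then show ?thesis by simp
  qed
  show ?thesis unfolding high_low_def by measurable
qed

text \<open>The two regions cover all \<open>\<eta>\<close>, and reflecting \<open>\<eta>\<close> to
  \<open>\<xi> - \<eta>\<close> exchanges the factors on the second one. The common boundary is
  counted twice, so the result is an inequality.\<close>

lemma conv_le_high_low:
  assumes [measurable]: "f \<in> borel_measurable borel" "h \<in> borel_measurable borel"
  shows "conv f h \<xi> \<le> high_low f h \<xi> + high_low h f \<xi>"
proof -
  have "conv f h \<xi> \<le> (\<integral>\<^sup>+\<eta>. f (\<xi> - \<eta>) * h \<eta> * indicator {\<eta>. norm \<eta> \<le> norm (\<xi> - \<eta>)} \<eta> +
      f (\<xi> - \<eta>) * h \<eta> * indicator {\<eta>. norm (\<xi> - \<eta>) \<le> norm \<eta>} \<eta> \<partial>lborel)"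
    unfolding conv_def by (intro nn_integral_mono) (auto split: split_indicator)
  also have "\<dots> = high_low f h \<xi> + (\<integral>\<^sup>+\<eta>. f (\<xi> - \<eta>) * h \<eta> * indicator {\<eta>. norm (\<xi> - \<eta>) \<le> norm \<eta>} \<eta> \<partial>lborel)"
    unfolding high_low_def by (rule nn_integral_add) measurable
  also have "(\<integral>\<^sup>+\<eta>. f (\<xi> - \<eta>) * h \<eta> * indicator {\<eta>. norm (\<xi> - \<eta>) \<le> norm \<eta>} \<eta> \<partial>lborel) = high_low h f \<xi>"
  proof -
    have "(\<integral>\<^sup>+\<eta>. f (\<xi> - \<eta>) * h \<eta> * indicator {\<eta>. norm (\<xi> - \<eta>) \<le> norm \<eta>} \<eta> \<partial>lborel)
        = (\<integral>\<^sup>+\<eta>. f (\<xi> - (\<xi> - \<eta>)) * h (\<xi> - \<eta>) * indicator {\<eta>. norm (\<xi> - \<eta>) \<le> norm \<eta>} (\<xi> - \<eta>) \<partial>lborel)"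
      by (rule nn_integral_reflect[symmetric, of "\<lambda>\<eta>. f (\<xi> - \<eta>) * h \<eta> * indicator {\<eta>. norm (\<xi> - \<eta>) \<le> norm \<eta>} \<eta>"]) measurable
    also have "\<dots> = high_low h f \<xi>"
      unfolding high_low_def by (intro nn_integral_cong) (auto simp: mult_ac split: split_indicator)
    finally show ?thesis .
  qed
  finally show ?thesis .
qed

context
  fixes p q :: ennreal
  assumes p: "1 < p" and q: "1 \<le> q"
begin

text \<open>If \<open>\<eta>\<close> is the lower frequency, then \<open>\<xi> - \<eta>\<close> has
  at least half the size of \<open>\<xi>\<close>, so it lies in an annulus with
  \<open>i \<ge> j - 1\<close>. For each \<open>i\<close>, Young's inequality takes the low factor
  in L^1 at the cost \<open>2 powr (i * \<beta>)\<close>. The remaining sum over the shifts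
  \<open>m = i - j\<close> is the series \<open>geom (-1) (s - \<beta>)\<close>.\<close>

lemma high_low_bound:
  fixes s :: real
  defines "\<beta> \<equiv> 3 - enn2real (3 / p) - s"
  assumes [measurable]: "f \<in> borel_measurable borel" "h \<in> borel_measurable borel"
    and \<beta>: "0 < \<beta>" and fin: "besov s p q h < \<infinity>"
  shows "besov (s - \<beta>) p q (high_low f h)
    \<le> ennreal 64 * geom 0 \<beta> * geom (-1) (s - \<beta>) * (besov s p q f * besov s p q h)"
proof -
  let ?H = "besov s p q h" and ?c = "ennreal 64 * geom 0 \<beta>"
  have p1: "1 \<le> p" using p by simp
  define fi where "fi i \<xi> = f \<xi> * indicator (ann i) \<xi>" for i \<xi>
  define hi where "hi i \<xi> = h \<xi> * indicator {\<xi>. norm \<xi> < 2 powr (real_of_int i + 1)} \<xi>" for i :: int and \<xi>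
  have [measurable]: "fi i \<in> borel_measurable borel" "hi i \<in> borel_measurable borel" for i
    unfolding fi_def hi_def by measurable
  have hi1: "(\<integral>\<^sup>+\<eta>. hi i \<eta> \<partial>lborel) \<le> ?c * (ennreal (2 powr (real_of_int i * \<beta>)) * ?H)" for i
    unfolding hi_def \<beta>_def by (intro ball_integral_le[OF p q]) measurable
  have hifin: "(\<integral>\<^sup>+\<eta>. hi i \<eta> \<partial>lborel) < \<infinity>" for i
    by (rule le_less_trans[OF hi1]) (use geom_finite[OF \<beta>, of 0] fin in \<open>auto simp: ennreal_mult_less_top\<close>)
  have point: "high_low f h \<xi> * indicator (ann j) \<xi>
      \<le> (\<integral>\<^sup>+i. (if j - 1 \<le> i then conv (fi i) (hi i) \<xi> else 0) \<partial>count_space UNIV)" for j \<xi>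
  proof (cases "\<xi> \<in> ann j")
    case True
    have "high_low f h \<xi> \<le> (\<integral>\<^sup>+\<eta>. \<integral>\<^sup>+i. (if j - 1 \<le> i then fi i (\<xi> - \<eta>) * hi i \<eta> else 0) \<partial>count_space UNIV \<partial>lborel)"
      unfolding high_low_def
    proof (rule nn_integral_mono)
      fix \<eta>
      show "f (\<xi> - \<eta>) * h \<eta> * indicator {\<eta>. norm \<eta> \<le> norm (\<xi> - \<eta>)} \<eta>
        \<le> (\<integral>\<^sup>+i. (if j - 1 \<le> i then fi i (\<xi> - \<eta>) * hi i \<eta> else 0) \<partial>count_space UNIV)"
      proof (cases "norm \<eta> \<le> norm (\<xi> - \<eta>)")
        case le: True
        have tri: "norm \<xi> \<le> norm (\<xi> - \<eta>) + norm \<eta>" by (metis diff_add_cancel norm_triangle_ineq)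
        have pos: "2 powr real_of_int j \<le> norm \<xi>" using True by (simp add: ann_def)
        have "0 < norm \<xi>" using pos powr_gt_zero[of 2 "real_of_int j"] by linarith
        then have "\<xi> - \<eta> \<noteq> 0" using tri le by auto
        then obtain i where i: "\<xi> - \<eta> \<in> ann i" using ex_ann by blast
        have u: "norm (\<xi> - \<eta>) < 2 powr (real_of_int i + 1)" using i by (simp add: ann_def)
        have "2 powr real_of_int j < 2 * 2 powr (real_of_int i + 1)" using pos tri le u by linarith
        also have "\<dots> = 2 powr (real_of_int i + 2)" by (simp add: powr_add)
        \<comment> \<open>The chain gives \<open>j < i + 2\<close>; for integers this is
          \<open>j - 1 \<le> i\<close>, which is where the lower limit -1 of the shifts comes
          from.\<close>
        finally have "j - 1 \<le> i" by simp
        moreover have "\<eta> \<in> {\<xi>. norm \<xi> < 2 powr (real_of_int i + 1)}" using le u by simp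
        ultimately have "f (\<xi> - \<eta>) * h \<eta> * indicator {\<eta>. norm \<eta> \<le> norm (\<xi> - \<eta>)} \<eta>
          = (if j - 1 \<le> i then fi i (\<xi> - \<eta>) * hi i \<eta> else 0)"
          using le i by (simp add: fi_def hi_def)
        also have "\<dots> \<le> (\<integral>\<^sup>+i. (if j - 1 \<le> i then fi i (\<xi> - \<eta>) * hi i \<eta> else 0) \<partial>count_space UNIV)"
          by (rule nn_integral_ge_point) simp
        finally show ?thesis .
      qed simp
    qed
    also have "\<dots> \<le> (\<integral>\<^sup>+i. \<integral>\<^sup>+\<eta>. (if j - 1 \<le> i then fi i (\<xi> - \<eta>) * hi i \<eta> else 0) \<partial>lborel \<partial>count_space UNIV)"
      by (intro nn_integral_countable_sum_le sigma_finite_lborel) measurable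
    also have "\<dots> = (\<integral>\<^sup>+i. (if j - 1 \<le> i then conv (fi i) (hi i) \<xi> else 0) \<partial>count_space UNIV)"
      by (intro nn_integral_cong) (simp add: conv_def)
    finally show ?thesis using True by simp
  qed simp
  have "ann_norm p (high_low f h) j
      \<le> (\<integral>\<^sup>+m. (if -1 \<le> m then ?c * ?H else 0) * (ennreal (2 powr (real_of_int (j + m) * \<beta>)) * ann_norm p f (j + m)) \<partial>count_space UNIV)" for j
  proof -
    let ?G = "\<lambda>i. (if j - 1 \<le> i then ?c * ?H else 0) * (ennreal (2 powr (real_of_int i * \<beta>)) * ann_norm p f i)"
    have "ann_norm p (high_low f h) j \<le> Lp_norm lborel p (\<lambda>\<xi>. \<integral>\<^sup>+i. (if j - 1 \<le> i then conv (fi i) (hi i) \<xi> else 0) \<partial>count_space UNIV)"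
      unfolding ann_norm_def using point by (intro Lp_norm_mono_AE p1) auto
    also have "\<dots> \<le> (\<integral>\<^sup>+i. Lp_norm lborel p (\<lambda>\<xi>. if j - 1 \<le> i then conv (fi i) (hi i) \<xi> else 0) \<partial>count_space UNIV)"
      by (intro Lp_norm_countable_sum sigma_finite_lborel p1) measurable
    also have "\<dots> \<le> (\<integral>\<^sup>+i. ?G i \<partial>count_space UNIV)"
    proof (rule nn_integral_mono)
      fix i :: int
      show "Lp_norm lborel p (\<lambda>\<xi>. if j - 1 \<le> i then conv (fi i) (hi i) \<xi> else 0) \<le> ?G i"
      proof (cases "j - 1 \<le> i")
        case True
        have "Lp_norm lborel p (conv (fi i) (hi i)) \<le> (\<integral>\<^sup>+\<eta>. hi i \<eta> \<partial>lborel) * Lp_norm lborel p (fi i)"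
          by (intro young_inequality p1 hifin) measurable
        also have "\<dots> \<le> (?c * (ennreal (2 powr (real_of_int i * \<beta>)) * ?H)) * Lp_norm lborel p (fi i)"
          by (intro mult_right_mono hi1) simp
        also have "Lp_norm lborel p (fi i) = ann_norm p f i" by (simp add: ann_norm_def fi_def[abs_def])
        finally show ?thesis using True by (simp add: mult_ac)
      next
        case False
        have "Lp_norm lborel p (\<lambda>\<xi>::real^3. 0 * 0) \<le> 0 * Lp_norm lborel p (\<lambda>\<xi>::real^3. 0)"
          by (intro Lp_norm_cmult p1) simp
        then show ?thesis using False by simp
      qed
    qed
    also have "\<dots> = (\<integral>\<^sup>+m. ?G (j + m) \<partial>count_space UNIV)"
      by (rule nn_integral_bij_count_space[symmetric]) (rule bij_betw_byWitness[where f' = "\<lambda>i. i - j"], auto)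
    also have "\<dots> = (\<integral>\<^sup>+m. (if -1 \<le> m then ?c * ?H else 0) * (ennreal (2 powr (real_of_int (j + m) * \<beta>)) * ann_norm p f (j + m)) \<partial>count_space UNIV)"
      by (intro nn_integral_cong) simp
    finally show ?thesis .
  qed
  then have "besov (s - \<beta>) p q (high_low f h)
    \<le> (\<integral>\<^sup>+m. (if -1 \<le> m then ?c * ?H else 0) * ennreal (2 powr (- real_of_int m * (s - \<beta>))) \<partial>count_space UNIV)
      * weighted_norm (s - \<beta>) q (\<lambda>i. ennreal (2 powr (real_of_int i * \<beta>)) * ann_norm p f i)"
    unfolding besov_def[of _ _ _ "high_low f h"] by (rule weighted_norm_shift_sum[OF q])
  also have "(\<integral>\<^sup>+m. (if -1 \<le> m then ?c * ?H else 0) * ennreal (2 powr (- real_of_int m * (s - \<beta>))) \<partial>count_space UNIV)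
      = ?c * ?H * geom (-1) (s - \<beta>)"
    unfolding geom_def by (subst nn_integral_cmult[symmetric]) (auto intro!: nn_integral_cong)
  also have "weighted_norm (s - \<beta>) q (\<lambda>i. ennreal (2 powr (real_of_int i * \<beta>)) * ann_norm p f i) = besov s p q f"
  proof -
    have "ennreal (2 powr (real_of_int i * (s - \<beta>))) * (ennreal (2 powr (real_of_int i * \<beta>)) * ann_norm p f i)
        = ennreal (2 powr (real_of_int i * s)) * ann_norm p f i" for i :: int
    proof -
      have "2 powr (real_of_int i * (s - \<beta>)) * 2 powr (real_of_int i * \<beta>) = 2 powr (real_of_int i * s)"
        by (simp add: algebra_simps flip: powr_add)
      then show ?thesis by (simp flip: mult.assoc ennreal_mult)
    qed
    then show ?thesis by (simp add: weighted_norm_def besov_def)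
  qed
  finally show ?thesis by (simp only: mult_ac)
qed

text \<open>The convolution is controlled with index \<open>s - \<beta>\<close>, and the weight of
  order \<open>- \<beta>\<close> converts this into a bound with index \<open>s\<close>, so the same
  space appears on both sides.\<close>

lemma conv_bound:
  fixes s :: real
  defines "\<beta> \<equiv> 3 - enn2real (3 / p) - s"
  assumes \<beta>: "0 < \<beta>" "\<beta> < s"
  obtains K where "0 < K"
    and "\<And>f h. f \<in> borel_measurable borel \<Longrightarrow> h \<in> borel_measurable borel \<Longrightarrow>
      besov s p q f < \<infinity> \<Longrightarrow> besov s p q h < \<infinity> \<Longrightarrow>
      besov s p q (\<lambda>\<xi>. ennreal (norm \<xi> powr - \<beta>) * conv f h \<xi>) \<le> ennreal K * (besov s p q f * besov s p q h)"
proof -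
  let ?c = "ennreal 64 * geom 0 \<beta> * geom (-1) (s - \<beta>)"
  have "ennreal (2 powr \<bar>- \<beta>\<bar>) * (?c + ?c) < \<infinity>"
    using geom_finite[OF \<beta>(1), of 0] geom_finite[of "s - \<beta>" "-1"] \<beta> by (auto simp: ennreal_mult_less_top)
  then obtain K where K: "ennreal (2 powr \<bar>- \<beta>\<bar>) * (?c + ?c) = ennreal K" "0 \<le> K"
    by (cases "ennreal (2 powr \<bar>- \<beta>\<bar>) * (?c + ?c)") auto
  \<comment> \<open>\<open>K\<close> might be 0; adding 1 makes the constant strictly
    positive.\<close>
  have bound: "besov s p q (\<lambda>\<xi>. ennreal (norm \<xi> powr - \<beta>) * conv f h \<xi>) \<le> ennreal (K + 1) * (besov s p q f * besov s p q h)"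
    if [measurable]: "f \<in> borel_measurable borel" "h \<in> borel_measurable borel"
      and fin: "besov s p q f < \<infinity>" "besov s p q h < \<infinity>" for f h
  proof -
    have "besov s p q (\<lambda>\<xi>. ennreal (norm \<xi> powr - \<beta>) * conv f h \<xi>)
        \<le> ennreal (2 powr \<bar>- \<beta>\<bar>) * besov (s + - \<beta>) p q (conv f h)"
      by (intro besov_weight p q) measurable
    also have "besov (s + - \<beta>) p q (conv f h) \<le> besov (s - \<beta>) p q (\<lambda>\<xi>. high_low f h \<xi> + high_low h f \<xi>)"
      by (simp, intro besov_mono p q conv_le_high_low) measurable
    also have "\<dots> \<le> besov (s - \<beta>) p q (high_low f h) + besov (s - \<beta>) p q (high_low h f)"
      by (intro besov_add p q) measurable
    also have "\<dots> \<le> ?c * (besov s p q f * besov s p q h) + ?c * (besov s p q h * besov s p q f)"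
      unfolding \<beta>_def by (intro add_mono high_low_bound) (use \<beta> fin in \<open>auto simp: \<beta>_def\<close>)
    also have "\<dots> = (?c + ?c) * (besov s p q f * besov s p q h)"
      by (simp only: distrib_right mult.commute[of "besov s p q h"])
    finally have "besov s p q (\<lambda>\<xi>. ennreal (norm \<xi> powr - \<beta>) * conv f h \<xi>)
        \<le> ennreal K * (besov s p q f * besov s p q h)"
      unfolding K(1)[symmetric] by (simp add: mult.assoc mult_left_mono)
    also have "\<dots> \<le> ennreal (K + 1) * (besov s p q f * besov s p q h)"
      by (intro mult_right_mono ennreal_leI) auto
    finally show ?thesis .
  qed
  show ?thesis by (rule that[of "K + 1"]) (use K bound in auto)
qed

end

section \<open>Comparison with the Littlewood-Paley norm\<close>

lemma three_sum:
  "(\<integral>\<^sup>+m. (if \<bar>m\<bar> \<le> 1 then g m else 0) \<partial>count_space UNIV) = (g (-1) + g 0 + g (1::int) :: ennreal)"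
proof -
  have "(\<integral>\<^sup>+m. (if \<bar>m\<bar> \<le> 1 then g m else 0) \<partial>count_space UNIV) = (\<Sum>m\<in>{-1, 0, 1}. if \<bar>m\<bar> \<le> 1 then g m else 0)"
    by (rule nn_integral_count_space') auto
  then show ?thesis by (simp add: add.assoc)
qed

lemma littlewood_paleyD:
  assumes "littlewood_paley \<phi>"
  shows "schwartz \<phi>" "closure {\<xi>. \<phi> \<xi> \<noteq> 0} \<subseteq> {\<xi>. 3/4 \<le> norm \<xi> \<and> norm \<xi> \<le> 8/3}"
    "\<xi> \<noteq> 0 \<Longrightarrow> ((\<lambda>j. dyadic \<phi> j \<xi>) has_sum 1) UNIV"
  using assms unfolding littlewood_paley_def by blast+

text \<open>On the support, \<open>norm \<xi>\<close> lies between 3/4 and 8/3 times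
  \<open>2 powr j\<close>, hence strictly between \<open>2 powr (j - 1)\<close> and
  \<open>2 powr (j + 2)\<close>. This range meets three annuli.\<close>

lemma dyadic_support:
  assumes "littlewood_paley \<phi>" "dyadic \<phi> j \<xi> \<noteq> 0" "\<xi> \<in> ann k"
  shows "\<bar>k - j\<bar> \<le> 1"
proof -
  let ?y = "(2 powr (- real_of_int j)) *\<^sub>R \<xi>"
  have "?y \<in> closure {\<xi>. \<phi> \<xi> \<noteq> 0}" using assms(2) closure_subset[of "{\<xi>. \<phi> \<xi> \<noteq> 0}"] unfolding dyadic_def by blast
  then have "?y \<in> {\<xi>. 3/4 \<le> norm \<xi> \<and> norm \<xi> \<le> 8/3}" using littlewood_paleyD(2)[OF assms(1)] by (rule rev_subsetD)
  then have y: "3/4 \<le> norm ?y" "norm ?y \<le> 8/3" by blast+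
  have n: "norm ?y = norm \<xi> / 2 powr real_of_int j" by (simp add: powr_minus divide_inverse mult.commute)
  have lo: "3/4 * 2 powr real_of_int j \<le> norm \<xi>" and hi: "norm \<xi> \<le> 8/3 * 2 powr real_of_int j"
    using y unfolding n by (simp_all add: field_simps)
  have k: "2 powr real_of_int k \<le> norm \<xi>" "norm \<xi> < 2 powr (real_of_int k + 1)" using assms(3) by (auto simp: ann_def)
  have pos: "0 < 2 powr real_of_int j" by simp
  have "2 powr real_of_int k < 4 * 2 powr real_of_int j" using k(1) hi pos by linarith
  also have "\<dots> = 2 powr (real_of_int j + 2)" by (simp add: powr_add)
  finally have "k < j + 2" by simp
  have "1/2 * 2 powr real_of_int j < 2 powr (real_of_int k + 1)" using k(2) lo pos by linarith
  moreover have "1/2 * 2 powr real_of_int j = 2 powr (real_of_int j - 1)" by (simp add: powr_diff)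
  ultimately have "2 powr (real_of_int j - 1) < 2 powr (real_of_int k + 1)" by linarith
  then have "j - 1 < k + 1" by simp
  then show ?thesis using \<open>k < j + 2\<close> by linarith
qed

text \<open>On \<open>ann k\<close> only three terms of the partition of unity survive. Passing to
  absolute values can increase their sum, since \<open>\<phi>\<close> may be complex or change
  sign.\<close>

lemma littlewood_paley_sum_ge_1:
  assumes "littlewood_paley \<phi>" "\<xi> \<in> ann k"
  shows "1 \<le> (\<Sum>m\<in>{-1, 0, 1}. cmod (dyadic \<phi> (k + m) \<xi>))"
proof -
  have "\<xi> \<noteq> 0" using assms(2) powr_gt_zero[of 2 "real_of_int k"] by (auto simp: ann_def not_le)
  then have "((\<lambda>j. dyadic \<phi> j \<xi>) has_sum 1) UNIV" by (rule littlewood_paleyD(3)[OF assms(1)])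
  moreover have "((\<lambda>j. dyadic \<phi> j \<xi>) has_sum 1) UNIV \<longleftrightarrow> ((\<lambda>j. dyadic \<phi> j \<xi>) has_sum 1) {k - 1, k, k + 1}"
  proof (rule has_sum_cong_neutral)
    show "dyadic \<phi> x \<xi> = 0" if "x \<in> UNIV - {k - 1, k, k + 1}" for x
    proof (rule ccontr)
      assume "dyadic \<phi> x \<xi> \<noteq> 0"
      then have "\<bar>k - x\<bar> \<le> 1" using dyadic_support[OF assms(1) _ assms(2)] by blast
      then show False using that by auto
    qed
  qed auto
  ultimately have "((\<lambda>j. dyadic \<phi> j \<xi>) has_sum 1) {k - 1, k, k + 1}" by simp
  then have "(\<Sum>j\<in>{k - 1, k, k + 1}. dyadic \<phi> j \<xi>) = 1"
    by (rule has_sum_unique[rotated]) (simp only: has_sum_finite finite.intros)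
  then have "1 = cmod (\<Sum>m\<in>{-1, 0, 1}. dyadic \<phi> (k + m) \<xi>)" by (simp add: algebra_simps)
  also have "\<dots> \<le> (\<Sum>m\<in>{-1, 0, 1}. cmod (dyadic \<phi> (k + m) \<xi>))" by (rule norm_sum)
  finally show ?thesis .
qed

context
  fixes p q :: ennreal and \<phi> :: "real^3 \<Rightarrow> complex"
  assumes p: "1 < p" and q: "1 \<le> q" and \<phi>: "littlewood_paley \<phi>"
begin

lemma dyadic_measurable [measurable]: "dyadic \<phi> j \<in> borel_measurable borel"
proof -
  have [measurable]: "\<phi> \<in> borel_measurable borel" by (intro schwartz_measurable littlewood_paleyD(1)[OF \<phi>])
  show ?thesis unfolding dyadic_def[abs_def] by measurable
qed

text \<open>A dyadic piece is bounded by \<open>B\<close> and lives on three annuli, so its norm is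
  at most a short sum of shifted annular norms; \<open>?K\<close> collects the factors of the three
  shifts.\<close>

lemma dyadic_norm_le_besov:
  obtains K where "0 < K" and "\<And>f. f \<in> borel_measurable borel \<Longrightarrow>
    weighted_norm s q (\<lambda>j. Lp_norm lborel p (\<lambda>\<xi>. ennreal (cmod (dyadic \<phi> j \<xi>)) * f \<xi>)) \<le> ennreal K * besov s p q f"
proof -
  have p1: "1 \<le> p" using p by simp
  obtain B where B: "\<And>x. cmod (\<phi> x) \<le> B" using schwartz_bound[OF littlewood_paleyD(1)[OF \<phi>], of 0 "[]"] by auto
  have "0 \<le> B" using B norm_ge_zero order_trans by blast
  let ?K = "B * 2 powr s + B + B * 2 powr (- s)"
  have K: "(\<integral>\<^sup>+m. (if \<bar>m\<bar> \<le> 1 then ennreal B else 0) * ennreal (2 powr (- real_of_int m * s)) \<partial>count_space UNIV) = ennreal ?K"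
    using three_sum[of "\<lambda>m. ennreal B * ennreal (2 powr (- real_of_int m * s))"] \<open>0 \<le> B\<close>
    by (simp add: if_distrib[of "\<lambda>x. x * _"] ennreal_mult ennreal_plus cong: if_cong)
  have bound: "weighted_norm s q (\<lambda>j. Lp_norm lborel p (\<lambda>\<xi>. ennreal (cmod (dyadic \<phi> j \<xi>)) * f \<xi>)) \<le> ennreal (?K + 1) * besov s p q f"
    if [measurable]: "f \<in> borel_measurable borel" for f
  proof -
    have "Lp_norm lborel p (\<lambda>\<xi>. ennreal (cmod (dyadic \<phi> j \<xi>)) * f \<xi>)
        \<le> (\<integral>\<^sup>+m. (if \<bar>m\<bar> \<le> 1 then ennreal B else 0) * ann_norm p f (j + m) \<partial>count_space UNIV)" for j
    proof -
      have "Lp_norm lborel p (\<lambda>\<xi>. ennreal (cmod (dyadic \<phi> j \<xi>)) * f \<xi>)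
        \<le> Lp_norm lborel p (\<lambda>\<xi>. \<integral>\<^sup>+m. (if \<bar>m\<bar> \<le> 1 then ennreal B else 0) * (f \<xi> * indicator (ann (j + m)) \<xi>) \<partial>count_space UNIV)"
      proof (rule Lp_norm_mono_AE[OF p1 _ AE_mp[OF AE_lborel_singleton[of 0] AE_I2]], safe)
        fix \<xi> :: "real^3" assume "\<xi> \<noteq> 0"
        then obtain k where k: "\<xi> \<in> ann k" using ex_ann by blast
        show "ennreal (cmod (dyadic \<phi> j \<xi>)) * f \<xi>
          \<le> (\<integral>\<^sup>+m. (if \<bar>m\<bar> \<le> 1 then ennreal B else 0) * (f \<xi> * indicator (ann (j + m)) \<xi>) \<partial>count_space UNIV)"
        proof (cases "dyadic \<phi> j \<xi> = 0")
          case False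
          then have kj: "\<bar>k - j\<bar> \<le> 1" using dyadic_support[OF \<phi> _ k] by blast
          have "ennreal (cmod (dyadic \<phi> j \<xi>)) * f \<xi> \<le> ennreal B * f \<xi>"
            using B by (intro mult_right_mono ennreal_leI) (auto simp: dyadic_def)
          also have "\<dots> = (if \<bar>k - j\<bar> \<le> 1 then ennreal B else 0) * (f \<xi> * indicator (ann (j + (k - j))) \<xi>)"
            using kj k by simp
          also have "\<dots> \<le> (\<integral>\<^sup>+m. (if \<bar>m\<bar> \<le> 1 then ennreal B else 0) * (f \<xi> * indicator (ann (j + m)) \<xi>) \<partial>count_space UNIV)"
            by (rule nn_integral_ge_point) simp
          finally show ?thesis .
        qed simp
      qed measurable
      also have "\<dots> \<le> (\<integral>\<^sup>+m. Lp_norm lborel p (\<lambda>\<xi>. (if \<bar>m\<bar> \<le> 1 then ennreal B else 0) * (f \<xi> * indicator (ann (j + m)) \<xi>)) \<partial>count_space UNIV)"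
        by (intro Lp_norm_countable_sum sigma_finite_lborel p1) measurable
      also have "\<dots> \<le> (\<integral>\<^sup>+m. (if \<bar>m\<bar> \<le> 1 then ennreal B else 0) * ann_norm p f (j + m) \<partial>count_space UNIV)"
        unfolding ann_norm_def by (intro nn_integral_mono Lp_norm_cmult p1) measurable
      finally show ?thesis .
    qed
    then have "weighted_norm s q (\<lambda>j. Lp_norm lborel p (\<lambda>\<xi>. ennreal (cmod (dyadic \<phi> j \<xi>)) * f \<xi>)) \<le> ennreal ?K * besov s p q f"
      unfolding besov_def K[symmetric] by (rule weighted_norm_shift_sum[OF q])
    also have "\<dots> \<le> ennreal (?K + 1) * besov s p q f" by (intro mult_right_mono ennreal_leI) auto
    finally show ?thesis .
  qed
  have "0 < ?K + 1" using \<open>0 \<le> B\<close> by (simp add: add_nonneg_pos)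
  then show ?thesis using bound by (rule that)
qed

text \<open>Conversely, on each annulus the three neighbouring dyadic pieces add up to at least 1 in
  absolute value.\<close>

lemma besov_le_dyadic_norm:
  obtains K where "0 < K" and "\<And>f. f \<in> borel_measurable borel \<Longrightarrow>
    besov s p q f \<le> ennreal K * weighted_norm s q (\<lambda>j. Lp_norm lborel p (\<lambda>\<xi>. ennreal (cmod (dyadic \<phi> j \<xi>)) * f \<xi>))"
proof -
  have p1: "1 \<le> p" using p by simp
  let ?K = "2 powr s + 1 + 2 powr (- s)"
  have K: "(\<integral>\<^sup>+m. (if \<bar>m\<bar> \<le> 1 then 1 else 0) * ennreal (2 powr (- real_of_int m * s)) \<partial>count_space UNIV) = ennreal ?K"
    using three_sum[of "\<lambda>m. ennreal (2 powr (- real_of_int m * s))"]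
    by (simp add: if_distrib[of "\<lambda>x. x * _"] ennreal_plus cong: if_cong)
  have bound: "besov s p q f \<le> ennreal ?K * weighted_norm s q (\<lambda>j. Lp_norm lborel p (\<lambda>\<xi>. ennreal (cmod (dyadic \<phi> j \<xi>)) * f \<xi>))"
    if [measurable]: "f \<in> borel_measurable borel" for f
  proof -
    have "ann_norm p f j \<le> (\<integral>\<^sup>+m. (if \<bar>m\<bar> \<le> 1 then 1 else 0) *
        Lp_norm lborel p (\<lambda>\<xi>. ennreal (cmod (dyadic \<phi> (j + m) \<xi>)) * f \<xi>) \<partial>count_space UNIV)" for j
    proof -
      have "ann_norm p f j \<le> Lp_norm lborel p (\<lambda>\<xi>. \<integral>\<^sup>+m. (if \<bar>m\<bar> \<le> 1 then 1 else 0) *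
          (ennreal (cmod (dyadic \<phi> (j + m) \<xi>)) * f \<xi>) \<partial>count_space UNIV)"
        unfolding ann_norm_def
      proof (intro Lp_norm_mono_AE p1 AE_I2)
        fix \<xi> :: "real^3"
        show "f \<xi> * indicator (ann j) \<xi> \<le> (\<integral>\<^sup>+m. (if \<bar>m\<bar> \<le> 1 then 1 else 0) *
          (ennreal (cmod (dyadic \<phi> (j + m) \<xi>)) * f \<xi>) \<partial>count_space UNIV)"
        proof (cases "\<xi> \<in> ann j")
          case True
          have "ennreal 1 \<le> ennreal (\<Sum>m\<in>{-1, 0, 1}. cmod (dyadic \<phi> (j + m) \<xi>))"
            by (intro ennreal_leI littlewood_paley_sum_ge_1 \<phi> True)
          then have "1 * f \<xi> \<le> ennreal (\<Sum>m\<in>{-1, 0, 1}. cmod (dyadic \<phi> (j + m) \<xi>)) * f \<xi>"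
            by (intro mult_right_mono) auto
          also have "\<dots> = (\<integral>\<^sup>+m. (if \<bar>m\<bar> \<le> 1 then ennreal (cmod (dyadic \<phi> (j + m) \<xi>)) * f \<xi> else 0) \<partial>count_space UNIV)"
            by (subst three_sum) (simp add: ennreal_plus distrib_right add_ac)
          also have "\<dots> = (\<integral>\<^sup>+m. (if \<bar>m\<bar> \<le> 1 then 1 else 0) * (ennreal (cmod (dyadic \<phi> (j + m) \<xi>)) * f \<xi>) \<partial>count_space UNIV)"
            by (intro nn_integral_cong) simp
          finally show ?thesis using True by simp
        qed simp
      qed measurable
      also have "\<dots> \<le> (\<integral>\<^sup>+m. Lp_norm lborel p (\<lambda>\<xi>. (if \<bar>m\<bar> \<le> 1 then 1 else 0) *
          (ennreal (cmod (dyadic \<phi> (j + m) \<xi>)) * f \<xi>)) \<partial>count_space UNIV)"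
        by (intro Lp_norm_countable_sum sigma_finite_lborel p1) measurable
      also have "\<dots> \<le> (\<integral>\<^sup>+m. (if \<bar>m\<bar> \<le> 1 then 1 else 0) *
        Lp_norm lborel p (\<lambda>\<xi>. ennreal (cmod (dyadic \<phi> (j + m) \<xi>)) * f \<xi>) \<partial>count_space UNIV)"
        by (intro nn_integral_mono Lp_norm_cmult p1) measurable
      finally show ?thesis .
    qed
    then show ?thesis
      unfolding besov_def K[symmetric]
      by (rule weighted_norm_shift_sum[OF q, where d = "\<lambda>j. Lp_norm lborel p (\<lambda>\<xi>. ennreal (cmod (dyadic \<phi> j \<xi>)) * f \<xi>)"])
  qed
  have "0 < ?K" by (simp add: add_pos_pos)
  then show ?thesis using bound by (rule that)
qed

end

section \<open>The stationary resolvent\<close>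

definition coriolis :: "real^3 \<Rightarrow> complex^3^3" where
  "coriolis \<xi> = map_matrix complex_of_real (coriolis_matrix \<xi>)"

text \<open>This is \<open>\<integral>\<^sub>0\<^sup>\<infinity> S(\<tau>) w d\<tau>\<close> when \<open>l = \<nu>|\<xi>|\<^sup>2\<^sup>\<alpha>\<close> and \<open>h = \<Omega> \<xi>\<^sub>3 / |\<xi>|\<close>; these both vanish at \<open>\<xi> = 0\<close>,
  where division by zero makes the value 0.\<close>

definition resolvent :: "real \<Rightarrow> real \<Rightarrow> real^3 \<Rightarrow> complex^3 \<Rightarrow> complex^3" where
  "resolvent l h \<xi> w = (1 / (l\<^sup>2 + h\<^sup>2)) *\<^sub>R (l *\<^sub>R w + h *\<^sub>R (coriolis \<xi> *v w))"

text \<open>The operator L of the overview. The Leray projection comes first because it confines the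
  argument to the plane on which the Coriolis matrix squares to -1.\<close>

definition stationary_op :: "real \<Rightarrow> real \<Rightarrow> real \<Rightarrow> real^3 \<Rightarrow> complex^3 \<Rightarrow> complex^3" where
  "stationary_op \<nu> \<Omega> \<alpha> \<xi> g =
    resolvent (\<nu> * norm \<xi> powr (2 * \<alpha>)) (\<Omega> * (\<xi>$3 / norm \<xi>)) \<xi> (leray_symbol \<xi> *v g)"

lemma coriolis_apply:
  "(coriolis \<xi> *v w) $ 1 = (\<xi>$3 / norm \<xi>) *\<^sub>R w$2 - (\<xi>$2 / norm \<xi>) *\<^sub>R w$3"
  "(coriolis \<xi> *v w) $ 2 = (\<xi>$1 / norm \<xi>) *\<^sub>R w$3 - (\<xi>$3 / norm \<xi>) *\<^sub>R w$1"
  "(coriolis \<xi> *v w) $ 3 = (\<xi>$2 / norm \<xi>) *\<^sub>R w$1 - (\<xi>$1 / norm \<xi>) *\<^sub>R w$2"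
  by (simp_all add: coriolis_def coriolis_matrix_def matrix_vector_mult_def sum_3 map_matrix_def)
    (simp_all add: scaleR_conv_of_real)

lemma leray_apply:
  "(leray_symbol \<xi> *v w) $ m = w $ m - (\<xi>$m / (norm \<xi>)\<^sup>2) *\<^sub>R (\<Sum>k\<in>UNIV. \<xi>$k *\<^sub>R w$k)"
proof -
  have "(leray_symbol \<xi> *v w) $ m = (\<Sum>k\<in>UNIV. (if m = k then w $ k else 0) - (\<xi>$m / (norm \<xi>)\<^sup>2) *\<^sub>R (\<xi>$k *\<^sub>R w$k))"
    unfolding leray_symbol_def matrix_vector_mult_def
    by (simp, intro sum.cong) (auto simp: scaleR_conv_of_real algebra_simps)
  also have "\<dots> = w $ m - (\<xi>$m / (norm \<xi>)\<^sup>2) *\<^sub>R (\<Sum>k\<in>UNIV. \<xi>$k *\<^sub>R w$k)"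
    by (simp add: sum_subtractf scaleR_sum_right)
  finally show ?thesis .
qed

lemma norm_sq_3: "(norm (\<xi>::real^3))\<^sup>2 = (\<xi>$1)\<^sup>2 + (\<xi>$2)\<^sup>2 + (\<xi>$3)\<^sup>2"
  unfolding power2_norm_eq_inner by (simp add: inner_vec_def sum_3 power2_eq_square)

lemma leray_divergence_free:
  assumes "\<xi> \<noteq> 0"
  shows "(\<Sum>k\<in>UNIV. \<xi>$k *\<^sub>R (leray_symbol \<xi> *v w) $ k) = 0"
proof -
  let ?d = "\<Sum>k\<in>UNIV. \<xi>$k *\<^sub>R w$k"
  have "(\<Sum>k\<in>UNIV. \<xi>$k *\<^sub>R (leray_symbol \<xi> *v w) $ k) = ?d - (\<Sum>k\<in>UNIV. \<xi>$k * (\<xi>$k / (norm \<xi>)\<^sup>2)) *\<^sub>R ?d"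
    by (simp add: leray_apply scaleR_diff_right sum_subtractf scaleR_sum_left)
  also have "(\<Sum>k\<in>UNIV. \<xi>$k * (\<xi>$k / (norm \<xi>)\<^sup>2)) = (norm \<xi>)\<^sup>2 / (norm \<xi>)\<^sup>2"
  proof -
    have "(\<Sum>k\<in>UNIV. \<xi>$k * (\<xi>$k / (norm \<xi>)\<^sup>2)) = ((\<xi>$1)\<^sup>2 + (\<xi>$2)\<^sup>2 + (\<xi>$3)\<^sup>2) / (norm \<xi>)\<^sup>2"
      by (simp add: sum_3 power2_eq_square add_divide_distrib)
    then show ?thesis by (simp only: norm_sq_3)
  qed
  finally show ?thesis using assms by simp
qed

text \<open>With n = \<xi>/|\<xi>|, the matrix R acts as the cross product w x n, so its square
  takes w to (n . w) n - w. On vectors orthogonal to \<xi> it is an imaginary unit. This is why the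
  semigroup is a damped rotation there and why \<open>resolvent\<close> inverts l - h R.\<close>

lemma coriolis_square:
  assumes "\<xi> \<noteq> 0" and div: "(\<Sum>k\<in>UNIV. \<xi>$k *\<^sub>R w $ k) = 0"
  shows "coriolis \<xi> *v (coriolis \<xi> *v w) = - w"
proof -
  define a b c where "a = \<xi>$1 / norm \<xi>" and "b = \<xi>$2 / norm \<xi>" and "c = \<xi>$3 / norm \<xi>"
  have n: "norm \<xi> \<noteq> 0" using assms(1) by simp
  have abc: "a * a + b * b + c * c = 1"
  proof -
    have "a * a + b * b + c * c = ((\<xi>$1)\<^sup>2 + (\<xi>$2)\<^sup>2 + (\<xi>$3)\<^sup>2) / (norm \<xi>)\<^sup>2"
      by (simp add: a_def b_def c_def power2_eq_square add_divide_distrib)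
    then show ?thesis using n by (simp flip: norm_sq_3)
  qed
  have "(1 / norm \<xi>) *\<^sub>R (\<Sum>k\<in>UNIV. \<xi>$k *\<^sub>R w $ k) = 0" using div by simp
  then have d: "a *\<^sub>R w$1 + b *\<^sub>R w$2 + c *\<^sub>R w$3 = 0"
    by (simp add: sum_3 a_def b_def c_def scaleR_add_right)
  \<comment> \<open>The vector triple product identity in components, before (n . w) = 0 and |n| = 1
    are inserted.\<close>
  have id1: "c *\<^sub>R (a *\<^sub>R w$3 - c *\<^sub>R w$1) - b *\<^sub>R (b *\<^sub>R w$1 - a *\<^sub>R w$2)
      = a *\<^sub>R (a *\<^sub>R w$1 + b *\<^sub>R w$2 + c *\<^sub>R w$3) - (a * a + b * b + c * c) *\<^sub>R w$1"
    and id2: "a *\<^sub>R (b *\<^sub>R w$1 - a *\<^sub>R w$2) - c *\<^sub>R (c *\<^sub>R w$2 - b *\<^sub>R w$3)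
      = b *\<^sub>R (a *\<^sub>R w$1 + b *\<^sub>R w$2 + c *\<^sub>R w$3) - (a * a + b * b + c * c) *\<^sub>R w$2"
    and id3: "b *\<^sub>R (c *\<^sub>R w$2 - b *\<^sub>R w$3) - a *\<^sub>R (a *\<^sub>R w$3 - c *\<^sub>R w$1)
      = c *\<^sub>R (a *\<^sub>R w$1 + b *\<^sub>R w$2 + c *\<^sub>R w$3) - (a * a + b * b + c * c) *\<^sub>R w$3"
    by (simp_all add: scaleR_conv_of_real algebra_simps)
  show ?thesis
    unfolding vec_eq_iff forall_3 coriolis_apply
    unfolding a_def[symmetric] b_def[symmetric] c_def[symmetric]
    using id1 id2 id3 unfolding d abc by simp
qed

lemma semigroup_apply:
  "semigroup_symbol \<nu> \<Omega> \<alpha> t \<xi> *v w =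
    (exp (- ((\<nu> * norm \<xi> powr (2 * \<alpha>)) * t)) * cos ((\<Omega> * (\<xi>$3 / norm \<xi>)) * t)) *\<^sub>R w +
    (exp (- ((\<nu> * norm \<xi> powr (2 * \<alpha>)) * t)) * sin ((\<Omega> * (\<xi>$3 / norm \<xi>)) * t)) *\<^sub>R (coriolis \<xi> *v w)"
proof -
  define c s where "c = exp (- ((\<nu> * norm \<xi> powr (2 * \<alpha>)) * t)) * cos ((\<Omega> * (\<xi>$3 / norm \<xi>)) * t)"
    and "s = exp (- ((\<nu> * norm \<xi> powr (2 * \<alpha>)) * t)) * sin ((\<Omega> * (\<xi>$3 / norm \<xi>)) * t)"
  have e: "semigroup_symbol \<nu> \<Omega> \<alpha> t \<xi> $ i $ j = c *\<^sub>R (if i = j then 1 else 0) + s *\<^sub>R (coriolis \<xi> $ i $ j)" for i j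
    unfolding c_def s_def
    by (simp add: semigroup_symbol_def coriolis_def map_matrix_def mat_def)
      (simp_all add: scaleR_conv_of_real algebra_simps)
  have "(\<Sum>j\<in>UNIV. semigroup_symbol \<nu> \<Omega> \<alpha> t \<xi> $ i $ j * w $ j) =
      (\<Sum>j\<in>UNIV. (if i = j then c *\<^sub>R w $ j else 0) + s *\<^sub>R (coriolis \<xi> $ i $ j * w $ j))" for i
    unfolding e by (intro sum.cong) (auto simp: distrib_right)
  then show ?thesis
    unfolding c_def[symmetric] s_def[symmetric]
    by (simp add: vec_eq_iff matrix_vector_mult_def sum.distrib scaleR_sum_right)
qed

section \<open>Linearity and time integrals of the semigroup\<close>

lemma linear_coriolis: "linear (\<lambda>w::complex^3. coriolis \<xi> *v w)"
  by (intro linearI) (simp_all add: vec_eq_iff matrix_vector_mult_def distrib_left sum.distrib scaleR_sum_right)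

lemma linear_semigroup: "linear (\<lambda>w::complex^3. semigroup_symbol \<nu> \<Omega> \<alpha> t \<xi> *v w)"
  by (intro linearI) (simp_all add: vec_eq_iff matrix_vector_mult_def distrib_left sum.distrib scaleR_sum_right)

lemma linear_resolvent: "linear (resolvent l h \<xi>)"
  unfolding resolvent_def[abs_def]
  by (intro linearI) (simp_all add: linear_add[OF linear_coriolis] linear_scale[OF linear_coriolis] algebra_simps)

lemma linear_leray: "linear (\<lambda>w::complex^3. leray_symbol \<xi> *v w)"
  by (intro linearI) (simp_all add: vec_eq_iff matrix_vector_mult_def distrib_left sum.distrib scaleR_sum_right)

lemma linear_stationary_op: "linear (stationary_op \<nu> \<Omega> \<alpha> \<xi>)"
  unfolding stationary_op_def[abs_def]
  using linear_compose[OF linear_leray linear_resolvent] by (simp add: o_def)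

lemma integral_damped_oscillation:
  fixes w z :: "complex^3" and l t h :: real
  assumes l: "0 < l" and t: "0 \<le> t"
  defines "E \<equiv> \<lambda>\<tau>. (exp (- (l * \<tau>)) * cos (h * \<tau>)) *\<^sub>R w + (exp (- (l * \<tau>)) * sin (h * \<tau>)) *\<^sub>R z"
    and "D \<equiv> l\<^sup>2 + h\<^sup>2"
  shows "(LINT \<tau>:{0..t}|lborel. E \<tau>) =
      (1 / D) *\<^sub>R ((l - exp (- (l * t)) * (l * cos (h * t) - h * sin (h * t))) *\<^sub>R w +
        (h - exp (- (l * t)) * (l * sin (h * t) + h * cos (h * t))) *\<^sub>R z)"
proof -
  have D: "D \<noteq> 0" using l by (simp add: D_def add_pos_nonneg less_imp_neq[symmetric])
  \<comment> \<open>\<open>A\<close> and \<open>B\<close> are the real and imaginary parts of the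
    primitive \<open>exp ((- l + \<i> * h) * \<tau>) / (- l + \<i> * h)\<close>.\<close>
  define A where "A \<tau> = 1 / D * (exp (- (l * \<tau>)) * (h * sin (h * \<tau>) - l * cos (h * \<tau>)))" for \<tau>
  define B where "B \<tau> = 1 / D * (- exp (- (l * \<tau>)) * (l * sin (h * \<tau>) + h * cos (h * \<tau>)))" for \<tau>
  have A: "(A has_vector_derivative exp (- (l * \<tau>)) * cos (h * \<tau>)) (at \<tau> within S)" for \<tau> S
  proof -
    have "(A has_real_derivative 1 / D * (exp (- (l * \<tau>)) * (- l) * (h * sin (h * \<tau>) - l * cos (h * \<tau>)) +
        exp (- (l * \<tau>)) * (h * (cos (h * \<tau>) * h) + l * (sin (h * \<tau>) * h)))) (at \<tau> within S)"
      unfolding A_def by (rule DERIV_cmult) (auto intro!: derivative_eq_intros simp: algebra_simps)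
    also have "(exp (- (l * \<tau>)) * (- l) * (h * sin (h * \<tau>) - l * cos (h * \<tau>)) +
        exp (- (l * \<tau>)) * (h * (cos (h * \<tau>) * h) + l * (sin (h * \<tau>) * h))) = (exp (- (l * \<tau>)) * cos (h * \<tau>)) * D"
      by (simp add: D_def power2_eq_square algebra_simps)
    finally show ?thesis using D by (simp add: has_real_derivative_iff_has_vector_derivative)
  qed
  have B: "(B has_vector_derivative exp (- (l * \<tau>)) * sin (h * \<tau>)) (at \<tau> within S)" for \<tau> S
  proof -
    have "(B has_real_derivative 1 / D * (exp (- (l * \<tau>)) * l * (l * sin (h * \<tau>) + h * cos (h * \<tau>)) -
        exp (- (l * \<tau>)) * (l * (cos (h * \<tau>) * h) - h * (sin (h * \<tau>) * h)))) (at \<tau> within S)"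
      unfolding B_def by (rule DERIV_cmult) (auto intro!: derivative_eq_intros simp: algebra_simps)
    also have "(exp (- (l * \<tau>)) * l * (l * sin (h * \<tau>) + h * cos (h * \<tau>)) -
        exp (- (l * \<tau>)) * (l * (cos (h * \<tau>) * h) - h * (sin (h * \<tau>) * h))) = (exp (- (l * \<tau>)) * sin (h * \<tau>)) * D"
      by (simp add: D_def power2_eq_square algebra_simps)
    finally show ?thesis using D by (simp add: has_real_derivative_iff_has_vector_derivative)
  qed
  have scale: "((\<lambda>\<tau>. f \<tau> *\<^sub>R v) has_vector_derivative f' *\<^sub>R v) (at \<tau> within S)"
    if "(f has_vector_derivative f') (at \<tau> within S)" for f f' \<tau> S and v :: "complex^3"
    using bounded_linear.has_vector_derivative[OF bounded_linear_scaleR_left that] .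
  have "(LINT \<tau>:{0..t}|lborel. E \<tau>) = (A t *\<^sub>R w + B t *\<^sub>R z) - (A 0 *\<^sub>R w + B 0 *\<^sub>R z)"
    unfolding set_lebesgue_integral_def
  proof (rule integral_FTC_atLeastAtMost[OF t])
    show "((\<lambda>\<tau>. A \<tau> *\<^sub>R w + B \<tau> *\<^sub>R z) has_vector_derivative E \<tau>) (at \<tau> within {0..t})" for \<tau>
      unfolding E_def by (intro has_vector_derivative_add scale A B)
    show "continuous_on {0..t} E" unfolding E_def by (intro continuous_intros)
  qed
  also have "\<dots> = (A t - A 0) *\<^sub>R w + (B t - B 0) *\<^sub>R z" by (simp add: algebra_simps)
  also have "A t - A 0 = (1 / D) * (l - exp (- (l * t)) * (l * cos (h * t) - h * sin (h * t)))"
    using D by (simp add: A_def field_simps)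
  also have "B t - B 0 = (1 / D) * (h - exp (- (l * t)) * (l * sin (h * t) + h * cos (h * t)))"
    using D by (simp add: B_def field_simps)
  finally show ?thesis by (simp add: scaleR_add_right)
qed

lemma set_integral_reverse:
  fixes f :: "real \<Rightarrow> complex^3"
  shows "(LINT \<tau>:{0..t}|lborel. f (t - \<tau>)) = (LINT \<tau>:{0..t}|lborel. f \<tau>)"
proof -
  have "(LINT \<tau>|lborel. indicat_real {0..t} \<tau> *\<^sub>R f \<tau>)
      = \<bar>-1\<bar> *\<^sub>R (LINT \<tau>|lborel. indicat_real {0..t} (t + -1 * \<tau>) *\<^sub>R f (t + -1 * \<tau>))"
    by (rule lborel_integral_real_affine) simp
  also have "\<dots> = (LINT \<tau>|lborel. indicat_real {0..t} \<tau> *\<^sub>R f (t - \<tau>))"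
    by (simp, intro Bochner_Integration.integral_cong) (auto split: split_indicator)
  finally show ?thesis by (simp add: set_lebesgue_integral_def)
qed

text \<open>The integral over the half line minus its tail from \<open>t\<close>, where the tail is
  the semigroup at \<open>t\<close> applied to the whole integral. Since R squares to -1 on
  projected vectors, both sides are combinations of \<open>w\<close> and \<open>z\<close>
  only.\<close>

lemma semigroup_integral:
  assumes \<xi>: "\<xi> \<noteq> 0" and \<nu>: "0 < \<nu>" and t: "0 \<le> t"
  shows "(LINT \<tau>:{0..t}|lborel. semigroup_symbol \<nu> \<Omega> \<alpha> \<tau> \<xi> *v (leray_symbol \<xi> *v g)) =
    stationary_op \<nu> \<Omega> \<alpha> \<xi> g - semigroup_symbol \<nu> \<Omega> \<alpha> t \<xi> *v stationary_op \<nu> \<Omega> \<alpha> \<xi> g"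
proof -
  define w where "w = leray_symbol \<xi> *v g"
  define z where "z = coriolis \<xi> *v w"
  define l h where "l = \<nu> * norm \<xi> powr (2 * \<alpha>)" and "h = \<Omega> * (\<xi>$3 / norm \<xi>)"
  define e where "e = exp (- (l * t))"
  have l: "0 < l" using \<xi> \<nu> by (simp add: l_def)
  have z: "coriolis \<xi> *v z = - w"
    unfolding z_def w_def by (intro coriolis_square \<xi> leray_divergence_free)
  have S: "stationary_op \<nu> \<Omega> \<alpha> \<xi> g = (1 / (l\<^sup>2 + h\<^sup>2)) *\<^sub>R (l *\<^sub>R w + h *\<^sub>R z)"
    by (simp add: stationary_op_def resolvent_def l_def h_def w_def z_def)
  have "semigroup_symbol \<nu> \<Omega> \<alpha> t \<xi> *v stationary_op \<nu> \<Omega> \<alpha> \<xi> g =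
     (1 / (l\<^sup>2 + h\<^sup>2)) *\<^sub>R ((e * cos (h * t)) *\<^sub>R (l *\<^sub>R w + h *\<^sub>R z) + (e * sin (h * t)) *\<^sub>R (l *\<^sub>R z - h *\<^sub>R w))"
    unfolding S linear_scale[OF linear_semigroup]
    unfolding semigroup_apply l_def[symmetric] h_def[symmetric] e_def[symmetric]
      linear_add[OF linear_coriolis] linear_scale[OF linear_coriolis] z z_def[symmetric] by simp
  then show ?thesis
    unfolding semigroup_apply w_def[symmetric] l_def[symmetric] h_def[symmetric] z_def[symmetric]
      integral_damped_oscillation[OF l t] S e_def[symmetric]
    by (simp add: algebra_simps)
qed

text \<open>Reversing time gives both integrals the same form, and \<open>semigroup_integral\<close>
  evaluates them; collecting terms leaves the defect \<open>X\<close> on one side and its image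
  under the semigroup on the other.\<close>

lemma mild_equation_iff:
  fixes \<nu> \<Omega> \<alpha> t :: real and v f g :: "complex^3"
  assumes \<xi>: "\<xi> \<noteq> 0" and \<nu>: "0 < \<nu>" and t: "0 \<le> t"
  defines "S \<equiv> \<lambda>\<tau>. semigroup_symbol \<nu> \<Omega> \<alpha> \<tau> \<xi>"
  defines "X \<equiv> v - stationary_op \<nu> \<Omega> \<alpha> \<xi> (f - g)"
  shows "v = S t *v v - (LINT \<tau>:{0..t}|lborel. S (t - \<tau>) *v (leray_symbol \<xi> *v g))
      + (LINT \<tau>:{0..t}|lborel. S \<tau> *v (leray_symbol \<xi> *v f)) \<longleftrightarrow> X = S t *v X"
proof -
  let ?L = "stationary_op \<nu> \<Omega> \<alpha> \<xi>"
  have rev: "(LINT \<tau>:{0..t}|lborel. S (t - \<tau>) *v (leray_symbol \<xi> *v g)) = (LINT \<tau>:{0..t}|lborel. S \<tau> *v (leray_symbol \<xi> *v g))"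
    by (rule set_integral_reverse[where f = "\<lambda>\<tau>. S \<tau> *v (leray_symbol \<xi> *v g)"])
  have I: "(LINT \<tau>:{0..t}|lborel. S \<tau> *v (leray_symbol \<xi> *v g)) = ?L g - S t *v ?L g" for g
    unfolding S_def by (rule semigroup_integral[OF \<xi> \<nu> t])
  have X: "X = v - (?L f - ?L g)" by (simp add: X_def linear_diff[OF linear_stationary_op])
  have SX: "S t *v X = S t *v v - (S t *v ?L f - S t *v ?L g)"
    unfolding X S_def by (simp add: linear_diff[OF linear_semigroup])
  show ?thesis unfolding rev I SX unfolding X by (auto simp: algebra_simps)
qed

section \<open>Size and decay of the symbols\<close>

lemma cmod_component_le: "cmod ((w :: complex^3) $ k) \<le> norm w"
  by (rule Finite_Cartesian_Product.norm_nth_le)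

lemma norm_le_sum_components: "norm (w :: complex^3) \<le> cmod (w$1) + cmod (w$2) + cmod (w$3)"
  using L2_set_le_sum[of UNIV "\<lambda>i. cmod (w$i)"] by (simp add: norm_vec_def sum_3)

text \<open>Each of the three components is a difference of two terms of size at most
  \<open>norm w\<close>, whence 6.\<close>

lemma coriolis_bound: "norm (coriolis \<xi> *v w) \<le> 6 * norm w"
proof -
  have c: "cmod ((\<xi>$i / norm \<xi>) *\<^sub>R w$j) \<le> norm w" for i j
  proof -
    have "\<bar>\<xi>$i / norm \<xi>\<bar> \<le> 1" using component_le_norm_cart[of \<xi> i] by (cases "\<xi> = 0") (auto simp: abs_divide divide_le_eq)
    then have "\<bar>\<xi>$i / norm \<xi>\<bar> * cmod (w$j) \<le> 1 * norm w" by (intro mult_mono cmod_component_le) auto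
    then show ?thesis by simp
  qed
  have d: "cmod ((\<xi>$i / norm \<xi>) *\<^sub>R w$j - (\<xi>$k / norm \<xi>) *\<^sub>R w$m) \<le> norm w + norm w" for i j k m
    by (rule order_trans[OF norm_triangle_ineq4]) (intro add_mono c)
  show ?thesis
    using norm_le_sum_components[of "coriolis \<xi> *v w"] d[of 3 2 2 3] d[of 1 3 3 1] d[of 2 1 1 2]
    unfolding coriolis_apply by linarith
qed

text \<open>Each component contributes 1 for the identity and 3 for the sum along \<xi>; three
  components give 12.\<close>

lemma leray_bound: "norm (leray_symbol \<xi> *v w) \<le> 12 * norm w"
proof -
  have "cmod ((leray_symbol \<xi> *v w) $ m) \<le> 4 * norm w" for m
  proof -
    have "cmod (\<Sum>k\<in>UNIV. \<xi>$k *\<^sub>R w$k) \<le> (\<Sum>k\<in>(UNIV :: 3 set). norm \<xi> * norm w)"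
      by (intro sum_norm_le) (auto intro!: mult_mono component_le_norm_cart cmod_component_le)
    then have s: "cmod (\<Sum>k\<in>UNIV. \<xi>$k *\<^sub>R w$k) \<le> 3 * norm \<xi> * norm w" by simp
    have "\<bar>\<xi>$m / (norm \<xi>)\<^sup>2\<bar> * cmod (\<Sum>k\<in>UNIV. \<xi>$k *\<^sub>R w$k) \<le> (norm \<xi> / (norm \<xi>)\<^sup>2) * (3 * norm \<xi> * norm w)"
      using component_le_norm_cart[of \<xi> m] by (intro mult_mono s) (auto simp: abs_divide divide_right_mono)
    also have "\<dots> \<le> 3 * norm w" by (cases "\<xi> = 0") (auto simp: power2_eq_square)
    finally have "cmod ((\<xi>$m / (norm \<xi>)\<^sup>2) *\<^sub>R (\<Sum>k\<in>UNIV. \<xi>$k *\<^sub>R w$k)) \<le> 3 * norm w" by simp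
    then show ?thesis
      unfolding leray_apply using norm_triangle_ineq4[of "w$m" "(\<xi>$m / (norm \<xi>)\<^sup>2) *\<^sub>R (\<Sum>k\<in>UNIV. \<xi>$k *\<^sub>R w$k)"]
        cmod_component_le[of w m] by linarith
  qed
  from this[of 1] this[of 2] this[of 3] show ?thesis
    using norm_le_sum_components[of "leray_symbol \<xi> *v w"] by linarith
qed

text \<open>Both \<open>l / (l\<^sup>2 + h\<^sup>2)\<close> and
  \<open>\<bar>h\<bar> / (l\<^sup>2 + h\<^sup>2)\<close> are at most \<open>1 / l\<close>, which
  makes the bound independent of the rotation speed. The constant 84 is the product of 1 + 6 for the
  Coriolis part and 12 for the projection.\<close>

lemma stationary_op_bound:
  assumes \<nu>: "0 < \<nu>"
  shows "norm (stationary_op \<nu> \<Omega> \<alpha> \<xi> g) \<le> 84 / \<nu> * norm \<xi> powr (- (2 * \<alpha>)) * norm g"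
proof (cases "\<xi> = 0")
  case True
  \<comment> \<open>At the origin both sides are 0, by the conventions for division by zero and for
    \<open>0 powr x\<close>.\<close>
  then show ?thesis by (simp add: stationary_op_def resolvent_def)
next
  case False
  define l h where "l = \<nu> * norm \<xi> powr (2 * \<alpha>)" and "h = \<Omega> * (\<xi>$3 / norm \<xi>)"
  define w where "w = leray_symbol \<xi> *v g"
  have l: "0 < l" using False \<nu> by (simp add: l_def)
  have D: "0 < l\<^sup>2 + h\<^sup>2" using l by (simp add: add_pos_nonneg)
  have key: "x / (l\<^sup>2 + h\<^sup>2) \<le> 1 / l" if "x * l \<le> l\<^sup>2 + h\<^sup>2" for x
  proof -
    have "x \<le> (l\<^sup>2 + h\<^sup>2) / l" using that l by (simp add: pos_le_divide_eq)
    then have "x / (l\<^sup>2 + h\<^sup>2) \<le> (l\<^sup>2 + h\<^sup>2) / l / (l\<^sup>2 + h\<^sup>2)" using D by (intro divide_right_mono) auto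
    also have "\<dots> = 1 / l" using D by simp
    finally show ?thesis .
  qed
  have 1: "l / (l\<^sup>2 + h\<^sup>2) \<le> 1 / l" by (rule key) (simp add: power2_eq_square)
  have "0 \<le> \<bar>h\<bar> * l" using l by simp
  then have "\<bar>h\<bar> * l \<le> l\<^sup>2 + h\<^sup>2"
    using sum_squares_bound[of "\<bar>h\<bar>" l] by simp
  then have 2: "\<bar>h\<bar> / (l\<^sup>2 + h\<^sup>2) \<le> 1 / l" by (rule key)
  have "norm (stationary_op \<nu> \<Omega> \<alpha> \<xi> g) = norm ((l / (l\<^sup>2 + h\<^sup>2)) *\<^sub>R w + (h / (l\<^sup>2 + h\<^sup>2)) *\<^sub>R (coriolis \<xi> *v w))"
    unfolding stationary_op_def resolvent_def l_def[symmetric] h_def[symmetric] w_def[symmetric]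
    by (simp add: scaleR_add_right)
  also have "\<dots> \<le> l / (l\<^sup>2 + h\<^sup>2) * norm w + \<bar>h\<bar> / (l\<^sup>2 + h\<^sup>2) * norm (coriolis \<xi> *v w)"
    by (rule order_trans[OF norm_triangle_ineq]) (use l D in \<open>simp add: abs_divide\<close>)
  also have "\<dots> \<le> 1 / l * norm w + 1 / l * (6 * norm w)"
    using l by (intro add_mono mult_mono 1 2 coriolis_bound) auto
  also have "\<dots> = 7 / l * norm w" by (simp add: field_simps)
  also have "\<dots> \<le> 7 / l * (12 * norm g)"
    using l unfolding w_def by (intro mult_left_mono leray_bound) auto
  also have "\<dots> = 84 / \<nu> * norm \<xi> powr (- (2 * \<alpha>)) * norm g"
    using False \<nu> by (simp add: l_def powr_minus divide_inverse)
  finally show ?thesis .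
qed

lemma semigroup_decay:
  assumes \<xi>: "\<xi> \<noteq> 0" and \<nu>: "0 < \<nu>"
  shows "(\<lambda>n. semigroup_symbol \<nu> \<Omega> \<alpha> (real (Suc n)) \<xi> *v w) \<longlonglongrightarrow> 0"
proof -
  define l h where "l = \<nu> * norm \<xi> powr (2 * \<alpha>)" and "h = \<Omega> * (\<xi>$3 / norm \<xi>)"
  have l: "0 < l" using \<xi> \<nu> by (simp add: l_def)
  have le: "norm (semigroup_symbol \<nu> \<Omega> \<alpha> t \<xi> *v w) \<le> exp (- l * t) * (7 * norm w)" for t
  proof -
    have "norm (semigroup_symbol \<nu> \<Omega> \<alpha> t \<xi> *v w) \<le>
      \<bar>exp (- (l * t)) * cos (h * t)\<bar> * norm w + \<bar>exp (- (l * t)) * sin (h * t)\<bar> * norm (coriolis \<xi> *v w)"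
      unfolding semigroup_apply l_def[symmetric] h_def[symmetric]
      by (rule order_trans[OF norm_triangle_ineq]) simp
    also have "\<dots> \<le> exp (- (l * t)) * norm w + exp (- (l * t)) * (6 * norm w)"
      by (intro add_mono mult_mono coriolis_bound) (auto simp: abs_mult)
    finally show ?thesis by (simp add: algebra_simps)
  qed
  have "(\<lambda>n. exp (- l * real (Suc n)) * (7 * norm w)) \<longlonglongrightarrow> 0 * (7 * norm w)"
  proof (intro tendsto_mult_right)
    have "(\<lambda>n. exp (- l) ^ Suc n) \<longlonglongrightarrow> 0"
      using l by (intro LIMSEQ_Suc LIMSEQ_realpow_zero) auto
    then show "(\<lambda>n. exp (- l * real (Suc n))) \<longlonglongrightarrow> 0"
      by (simp only: mult.commute[of "- l"] exp_of_nat_mult)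
  qed
  then have "(\<lambda>n. exp (- l * real (Suc n)) * (7 * norm w)) \<longlonglongrightarrow> 0" unfolding mult_zero_left .
  moreover have "\<forall>n. norm (semigroup_symbol \<nu> \<Omega> \<alpha> (real (Suc n)) \<xi> *v w) \<le> exp (- l * real (Suc n)) * (7 * norm w)"
    by (intro allI le)
  ultimately show ?thesis
    by (rule Lim_null_comparison[OF always_eventually, rotated])
qed

section \<open>The bilinear term\<close>

lemma vec_measurable:
  fixes v :: "'a \<Rightarrow> complex^3"
  assumes "\<And>k. (\<lambda>x. v x $ k) \<in> borel_measurable M"
  shows "v \<in> borel_measurable M"
proof (rule borel_measurable_euclidean_space[THEN iffD2], rule ballI)
  fix i :: "complex^3" assume "i \<in> Basis"
  then obtain k b where "i = axis k b" by (auto simp: Basis_vec_def)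
  then show "(\<lambda>x. v x \<bullet> i) \<in> borel_measurable M" using assms by (simp add: inner_axis)
qed

lemma component_measurable [measurable (raw)]:
  fixes v :: "'a \<Rightarrow> complex^3"
  assumes "v \<in> borel_measurable M"
  shows "(\<lambda>x. v x $ k) \<in> borel_measurable M"
proof -
  have "(\<lambda>x::complex^3. x $ k) \<in> borel_measurable borel"
    by (intro borel_measurable_continuous_onI continuous_intros)
  then show ?thesis by (rule measurable_compose[OF assms])
qed


definition mag :: "(real^3 \<Rightarrow> complex^3) \<Rightarrow> real^3 \<Rightarrow> ennreal" where
  "mag v \<xi> = ennreal (norm (v \<xi>))"

lemma mag_measurable [measurable]: "v \<in> borel_measurable borel \<Longrightarrow> mag v \<in> borel_measurable borel"
  unfolding mag_def[abs_def] by measurable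

lemma div_tensor_hat_measurable [measurable]:
  assumes [measurable]: "v \<in> borel_measurable borel"
  shows "div_tensor_hat v \<in> borel_measurable borel"
proof (rule vec_measurable)
  have [measurable]: "(\<lambda>\<xi>. LINT \<eta>|lborel. v (\<xi> - \<eta>) $ m * v \<eta> $ k) \<in> borel_measurable borel" for m k
    by (intro lborel.borel_measurable_lebesgue_integral) measurable
  show "(\<lambda>\<xi>. div_tensor_hat v \<xi> $ k) \<in> borel_measurable borel" for k
    unfolding div_tensor_hat_def tensor_hat_def by simp
qed

lemma stationary_op_measurable:
  assumes [measurable]: "g \<in> borel_measurable borel"
  shows "(\<lambda>\<xi>. stationary_op \<nu> \<Omega> \<alpha> \<xi> (g \<xi>)) \<in> borel_measurable borel"
proof -
  have P [measurable]: "(\<lambda>\<xi>. leray_symbol \<xi> *v g \<xi>) \<in> borel_measurable borel"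
    by (rule vec_measurable) (simp add: leray_apply)
  have [measurable]: "(\<lambda>\<xi>. coriolis \<xi> *v (leray_symbol \<xi> *v g \<xi>)) \<in> borel_measurable borel"
  proof (rule vec_measurable)
    have "\<forall>k. (\<lambda>\<xi>. (coriolis \<xi> *v (leray_symbol \<xi> *v g \<xi>)) $ k) \<in> borel_measurable borel"
      unfolding forall_3 coriolis_apply by (intro conjI) measurable
    then show "(\<lambda>\<xi>. (coriolis \<xi> *v (leray_symbol \<xi> *v g \<xi>)) $ k) \<in> borel_measurable borel" for k by blast
  qed
  show ?thesis unfolding stationary_op_def resolvent_def by measurable
qed

text \<open>No integrability is needed: if exactly one of the two Bochner integrals is a junk value,
  then the right-hand side is infinite.\<close>

lemma integral_diff_le:
  fixes f h :: "'a \<Rightarrow> complex"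
  assumes [measurable]: "f \<in> borel_measurable M" "h \<in> borel_measurable M"
  shows "ennreal (cmod ((LINT x|M. f x) - (LINT x|M. h x))) \<le> (\<integral>\<^sup>+x. ennreal (cmod (f x - h x)) \<partial>M)"
proof (cases "integrable M (\<lambda>x. f x - h x)")
  case True
  have iff: "integrable M f \<longleftrightarrow> integrable M h"
  proof
    assume "integrable M f"
    from Bochner_Integration.integrable_diff[OF this True] show "integrable M h" by simp
  next
    assume "integrable M h"
    from Bochner_Integration.integrable_add[OF this True] show "integrable M f" by simp
  qed
  show ?thesis
  proof (cases "integrable M f")
    case f: True
    then have "(LINT x|M. f x) - (LINT x|M. h x) = (LINT x|M. f x - h x)" using iff by simp
    then show ?thesis using integral_norm_bound_ennreal[OF True] by simp
  next
    case False
    then show ?thesis using iff by (simp add: not_integrable_integral_eq)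
  qed
next
  case False
  then have "(\<integral>\<^sup>+x. ennreal (cmod (f x - h x)) \<partial>M) = \<infinity>"
    by (auto simp: integrable_iff_bounded not_less top_unique)
  then show ?thesis by simp
qed

text \<open>The difference of products splits as (v - w) v + w (v - w). The mixed form, with
  \<open>v\<close> in one summand and \<open>w\<close> in the other, is the one that
  \<open>conv_increment_le\<close> accepts.\<close>

lemma tensor_hat_diff_le:
  assumes [measurable]: "v \<in> borel_measurable borel" "w \<in> borel_measurable borel"
  shows "ennreal (cmod (tensor_hat v \<xi> $ m $ k - tensor_hat w \<xi> $ m $ k))
    \<le> conv (mag (\<lambda>\<xi>. v \<xi> - w \<xi>)) (mag v) \<xi> + conv (mag w) (mag (\<lambda>\<xi>. v \<xi> - w \<xi>)) \<xi>"
proof -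
  have "ennreal (cmod (tensor_hat v \<xi> $ m $ k - tensor_hat w \<xi> $ m $ k))
      \<le> (\<integral>\<^sup>+\<eta>. ennreal (cmod (v (\<xi> - \<eta>) $ m * v \<eta> $ k - w (\<xi> - \<eta>) $ m * w \<eta> $ k)) \<partial>lborel)"
    unfolding tensor_hat_def by (simp, intro integral_diff_le) measurable
  also have "\<dots> \<le> (\<integral>\<^sup>+\<eta>. mag (\<lambda>\<xi>. v \<xi> - w \<xi>) (\<xi> - \<eta>) * mag v \<eta> + mag w (\<xi> - \<eta>) * mag (\<lambda>\<xi>. v \<xi> - w \<xi>) \<eta> \<partial>lborel)"
  proof (rule nn_integral_mono)
    fix \<eta>
    have "v (\<xi> - \<eta>) $ m * v \<eta> $ k - w (\<xi> - \<eta>) $ m * w \<eta> $ k =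
        (v (\<xi> - \<eta>) - w (\<xi> - \<eta>)) $ m * v \<eta> $ k + w (\<xi> - \<eta>) $ m * (v \<eta> - w \<eta>) $ k"
      by (simp add: algebra_simps)
    also have "cmod \<dots> \<le> norm (v (\<xi> - \<eta>) - w (\<xi> - \<eta>)) * norm (v \<eta>) + norm (w (\<xi> - \<eta>)) * norm (v \<eta> - w \<eta>)"
      by (rule order_trans[OF norm_triangle_ineq], unfold norm_mult) (intro add_mono mult_mono cmod_component_le norm_ge_zero)
    finally have "ennreal (cmod (v (\<xi> - \<eta>) $ m * v \<eta> $ k - w (\<xi> - \<eta>) $ m * w \<eta> $ k)) \<le>
      ennreal (norm (v (\<xi> - \<eta>) - w (\<xi> - \<eta>)) * norm (v \<eta>) + norm (w (\<xi> - \<eta>)) * norm (v \<eta> - w \<eta>))"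
      by (rule ennreal_leI)
    then show "ennreal (cmod (v (\<xi> - \<eta>) $ m * v \<eta> $ k - w (\<xi> - \<eta>) $ m * w \<eta> $ k))
      \<le> mag (\<lambda>\<xi>. v \<xi> - w \<xi>) (\<xi> - \<eta>) * mag v \<eta> + mag w (\<xi> - \<eta>) * mag (\<lambda>\<xi>. v \<xi> - w \<xi>) \<eta>"
      by (simp add: mag_def ennreal_mult ennreal_plus)
  qed
  also have "\<dots> = conv (mag (\<lambda>\<xi>. v \<xi> - w \<xi>)) (mag v) \<xi> + conv (mag w) (mag (\<lambda>\<xi>. v \<xi> - w \<xi>)) \<xi>"
    unfolding conv_def by (rule nn_integral_add) measurable
  finally show ?thesis .
qed

lemma div_tensor_hat_bound:
  assumes "\<And>m k. cmod (tensor_hat v \<xi> $ m $ k - tensor_hat w \<xi> $ m $ k) \<le> B"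
  shows "norm (div_tensor_hat v \<xi> - div_tensor_hat w \<xi>) \<le> 9 * norm \<xi> * B"
proof -
  have B: "0 \<le> B" using order_trans[OF norm_ge_zero assms] .
  have "cmod ((div_tensor_hat v \<xi> - div_tensor_hat w \<xi>) $ m) \<le> 3 * (norm \<xi> * B)" for m
  proof -
    have "(div_tensor_hat v \<xi> - div_tensor_hat w \<xi>) $ m =
        (\<Sum>k\<in>UNIV. \<i> * complex_of_real (\<xi>$k) * (tensor_hat v \<xi> $ m $ k - tensor_hat w \<xi> $ m $ k))"
      by (simp add: div_tensor_hat_def right_diff_distrib sum_subtractf)
    also have "cmod \<dots> \<le> (\<Sum>k\<in>(UNIV :: 3 set). norm \<xi> * B)"
      by (intro sum_norm_le) (auto simp: norm_mult intro!: mult_mono component_le_norm_cart assms)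
    finally show ?thesis by simp
  qed
  from this[of 1] this[of 2] this[of 3] show ?thesis
    using norm_le_sum_components[of "div_tensor_hat v \<xi> - div_tensor_hat w \<xi>"] by linarith
qed

text \<open>The divergence contributes \<open>9 * norm \<xi>\<close> and
  \<open>stationary_op_bound\<close> contributes
  \<open>84 / \<nu> * norm \<xi> powr (- (2 * \<alpha>))\<close>; together they give 756 and the
  exponent 1 - 2\<alpha>.\<close>

lemma bilinear_diff_le:
  assumes [measurable]: "v \<in> borel_measurable borel" "w \<in> borel_measurable borel" and \<nu>: "0 < \<nu>"
  shows "ennreal (norm (stationary_op \<nu> \<Omega> \<alpha> \<xi> (div_tensor_hat v \<xi>) - stationary_op \<nu> \<Omega> \<alpha> \<xi> (div_tensor_hat w \<xi>)))
    \<le> ennreal (756 / \<nu>) * (ennreal (norm \<xi> powr (1 - 2 * \<alpha>)) *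
      (conv (mag (\<lambda>\<xi>. v \<xi> - w \<xi>)) (mag v) \<xi> + conv (mag w) (mag (\<lambda>\<xi>. v \<xi> - w \<xi>)) \<xi>))"
    (is "_ \<le> _ * (_ * ?B)")
proof (cases "\<xi> = 0")
  case True
  then show ?thesis by (simp add: stationary_op_def resolvent_def)
next
  case False
  show ?thesis
  proof (cases "?B")
    case top
    \<comment> \<open>When the convolutions are infinite, so is the right-hand side, because both
      factors in front are nonzero.\<close>
    have "ennreal (norm \<xi> powr (1 - 2 * \<alpha>)) \<noteq> 0" "ennreal (756 / \<nu>) \<noteq> 0"
      using False \<nu> by (auto simp: ennreal_eq_0_iff not_le)
    then show ?thesis unfolding top by (simp add: ennreal_mult_top)
  next
    case (real B)
    have "cmod (tensor_hat v \<xi> $ m $ k - tensor_hat w \<xi> $ m $ k) \<le> B" for m k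
      using tensor_hat_diff_le[of v w \<xi> m k] real by simp
    then have "norm (div_tensor_hat v \<xi> - div_tensor_hat w \<xi>) \<le> 9 * norm \<xi> * B" by (rule div_tensor_hat_bound)
    then have "84 / \<nu> * norm \<xi> powr (- (2 * \<alpha>)) * norm (div_tensor_hat v \<xi> - div_tensor_hat w \<xi>)
        \<le> 84 / \<nu> * norm \<xi> powr (- (2 * \<alpha>)) * (9 * norm \<xi> * B)"
      using \<nu> by (intro mult_left_mono) auto
    also have "\<dots> = 756 / \<nu> * (norm \<xi> powr (1 - 2 * \<alpha>) * B)"
      using False by (simp add: powr_diff powr_minus divide_inverse)
    finally have "norm (stationary_op \<nu> \<Omega> \<alpha> \<xi> (div_tensor_hat v \<xi> - div_tensor_hat w \<xi>)) \<le> 756 / \<nu> * (norm \<xi> powr (1 - 2 * \<alpha>) * B)"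
      using stationary_op_bound[OF \<nu>, of \<Omega> \<alpha> \<xi> "div_tensor_hat v \<xi> - div_tensor_hat w \<xi>"] by linarith
    then have "ennreal (norm (stationary_op \<nu> \<Omega> \<alpha> \<xi> (div_tensor_hat v \<xi> - div_tensor_hat w \<xi>)))
        \<le> ennreal (756 / \<nu> * (norm \<xi> powr (1 - 2 * \<alpha>) * B))" by (rule ennreal_leI)
    also have "\<dots> = ennreal (756 / \<nu>) * (ennreal (norm \<xi> powr (1 - 2 * \<alpha>)) * ennreal B)"
      using \<nu> real(1) by (subst ennreal_mult) (auto simp: ennreal_mult)
    finally show ?thesis unfolding real(2) linear_diff[OF linear_stationary_op] .
  qed
qed

section \<open>Convolution integrals and null sets\<close>

lemma lborel_distr_reflect: "distr lborel borel (\<lambda>\<eta>. \<xi> - \<eta>) = (lborel :: (real^3) measure)"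
  using lborel_affine[of "-1" \<xi>] by (simp add: density_1)

lemma AE_reflect:
  assumes "AE \<eta> in (lborel :: (real^3) measure). P \<eta>"
  shows "AE \<eta> in lborel. P (\<xi> - \<eta>)"
proof (rule AE_distrD[where f = "\<lambda>\<eta>. \<xi> - \<eta>" and P = P and M' = borel])
  show "(\<lambda>\<eta>. \<xi> - \<eta>) \<in> measurable lborel borel" by measurable
  show "AE \<eta> in distr lborel borel (\<lambda>\<eta>. \<xi> - \<eta>). P \<eta>" unfolding lborel_distr_reflect by (rule assms)
qed

text \<open>For fixed \<xi> the exceptional \<open>\<eta>\<close> and their reflections form a null
  set, so the equality holds at every \<xi>. Passing to another representative of a transform thus
  changes the nonlinear term nowhere.\<close>

lemma tensor_hat_AE_cong:
  assumes "AE \<eta> in lborel. v \<eta> = w \<eta>" and [measurable]: "v \<in> borel_measurable borel" "w \<in> borel_measurable borel"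
  shows "tensor_hat v \<xi> = tensor_hat w \<xi>"
proof -
  have "(LINT \<eta>|lborel. v (\<xi> - \<eta>) $ m * v \<eta> $ k) = (LINT \<eta>|lborel. w (\<xi> - \<eta>) $ m * w \<eta> $ k)" for m k
  proof (rule integral_cong_AE)
    show "AE \<eta> in lborel. v (\<xi> - \<eta>) $ m * v \<eta> $ k = w (\<xi> - \<eta>) $ m * w \<eta> $ k"
      using assms(1) AE_reflect[OF assms(1), of \<xi>] by eventually_elim simp
  qed measurable
  then show ?thesis by (simp add: tensor_hat_def)
qed

lemma tensor_integrable:
  assumes [measurable]: "v \<in> borel_measurable borel" and fin: "conv (mag v) (mag v) \<xi> < \<infinity>"
  shows "integrable lborel (\<lambda>\<eta>. v (\<xi> - \<eta>) $ m * v \<eta> $ k)"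
proof (rule integrableI_bounded)
  have "(\<integral>\<^sup>+\<eta>. ennreal (norm (v (\<xi> - \<eta>) $ m * v \<eta> $ k)) \<partial>lborel) \<le> conv (mag v) (mag v) \<xi>"
    unfolding conv_def
  proof (rule nn_integral_mono)
    fix \<eta>
    have "norm (v (\<xi> - \<eta>) $ m * v \<eta> $ k) \<le> norm (v (\<xi> - \<eta>)) * norm (v \<eta>)"
      unfolding norm_mult by (intro mult_mono cmod_component_le norm_ge_zero)
    then show "ennreal (norm (v (\<xi> - \<eta>) $ m * v \<eta> $ k)) \<le> mag v (\<xi> - \<eta>) * mag v \<eta>"
      by (simp add: mag_def flip: ennreal_mult)
  qed
  then show "(\<integral>\<^sup>+\<eta>. ennreal (norm (v (\<xi> - \<eta>) $ m * v \<eta> $ k)) \<partial>lborel) < \<infinity>" using fin by (rule le_less_trans)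
qed measurable

section \<open>Picard iteration with a scalar majorant\<close>

primrec picard :: "((real^3 \<Rightarrow> complex^3) \<Rightarrow> real^3 \<Rightarrow> complex^3) \<Rightarrow> (real^3 \<Rightarrow> complex^3) \<Rightarrow> nat \<Rightarrow> real^3 \<Rightarrow> complex^3" where
  "picard B A 0 = (\<lambda>\<xi>. 0)"
| "picard B A (Suc n) = (\<lambda>\<xi>. A \<xi> - B (picard B A n) \<xi>)"

text \<open>Started at 0 and increasing in \<open>n\<close>, so that a pointwise supremum exists in
  \<open>ennreal\<close> before any smallness is used.\<close>

primrec majorant :: "real \<Rightarrow> real \<Rightarrow> (real^3 \<Rightarrow> ennreal) \<Rightarrow> nat \<Rightarrow> real^3 \<Rightarrow> ennreal" where
  "majorant k \<gamma> a 0 = (\<lambda>\<xi>. 0)"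
| "majorant k \<gamma> a (Suc n) =
    (\<lambda>\<xi>. a \<xi> + ennreal k * (ennreal (norm \<xi> powr \<gamma>) * conv (majorant k \<gamma> a n) (majorant k \<gamma> a n) \<xi>))"

lemma majorant_measurable [measurable]:
  assumes [measurable]: "a \<in> borel_measurable borel"
  shows "majorant k \<gamma> a n \<in> borel_measurable borel"
proof (induction n)
  case (Suc n)
  note [measurable] = Suc
  show ?case by simp
qed simp

lemma majorant_mono: "majorant k \<gamma> a n \<xi> \<le> majorant k \<gamma> a (Suc n) \<xi>"
proof (induction n arbitrary: \<xi>)
  case (Suc n)
  then show ?case by (simp only: majorant.simps) (intro add_left_mono mult_left_mono conv_mono, auto)
qed simp

text \<open>Pointwise before integration: d u + v d + g g \<le> d g' + g (d + g) \<le> (d + g) g'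
  \<le> g' g'. In the application \<open>d\<close> is an increment of the iteration, and
  \<open>g\<close>, \<open>g'\<close> are consecutive majorants.\<close>

lemma conv_increment_le:
  assumes [measurable]: "d \<in> borel_measurable borel" "g \<in> borel_measurable borel" "g' \<in> borel_measurable borel"
      "u \<in> borel_measurable borel" "v \<in> borel_measurable borel"
    and le: "\<And>\<xi>. d \<xi> + g \<xi> \<le> g' \<xi>" "\<And>\<xi>. u \<xi> \<le> g' \<xi>" "\<And>\<xi>. v \<xi> \<le> g \<xi>"
  shows "conv d u \<xi> + conv v d \<xi> + conv g g \<xi> \<le> conv g' g' \<xi>"
proof -
  have "conv d u \<xi> + conv v d \<xi> + conv g g \<xi> =
      (\<integral>\<^sup>+\<eta>. d (\<xi> - \<eta>) * u \<eta> + v (\<xi> - \<eta>) * d \<eta> + g (\<xi> - \<eta>) * g \<eta> \<partial>lborel)"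
    unfolding conv_def by (simp add: nn_integral_add)
  also have "\<dots> \<le> conv g' g' \<xi>"
    unfolding conv_def
  proof (rule nn_integral_mono)
    fix \<eta>
    have "d (\<xi> - \<eta>) * u \<eta> + v (\<xi> - \<eta>) * d \<eta> + g (\<xi> - \<eta>) * g \<eta>
        \<le> d (\<xi> - \<eta>) * g' \<eta> + g (\<xi> - \<eta>) * d \<eta> + g (\<xi> - \<eta>) * g \<eta>"
      by (intro add_mono mult_mono le) auto
    also have "\<dots> = d (\<xi> - \<eta>) * g' \<eta> + g (\<xi> - \<eta>) * (d \<eta> + g \<eta>)" by (simp add: distrib_left add.assoc)
    also have "\<dots> \<le> d (\<xi> - \<eta>) * g' \<eta> + g (\<xi> - \<eta>) * g' \<eta>" by (intro add_left_mono mult_left_mono le) auto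
    also have "\<dots> = (d (\<xi> - \<eta>) + g (\<xi> - \<eta>)) * g' \<eta>" by (simp add: distrib_right)
    also have "\<dots> \<le> g' (\<xi> - \<eta>) * g' \<eta>" by (intro mult_right_mono le) auto
    finally show "d (\<xi> - \<eta>) * u \<eta> + v (\<xi> - \<eta>) * d \<eta> + g (\<xi> - \<eta>) * g \<eta> \<le> g' (\<xi> - \<eta>) * g' \<eta>" .
  qed
  finally show ?thesis .
qed

lemma bounded_linear_stationary_op: "bounded_linear (stationary_op \<nu> \<Omega> \<alpha> \<xi>)"
  using linear_stationary_op linear_conv_bounded_linear by blast

abbreviation bilinear_term :: "real \<Rightarrow> real \<Rightarrow> real \<Rightarrow> (real^3 \<Rightarrow> complex^3) \<Rightarrow> real^3 \<Rightarrow> complex^3" where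
  "bilinear_term \<nu> \<Omega> \<alpha> v \<xi> \<equiv> stationary_op \<nu> \<Omega> \<alpha> \<xi> (div_tensor_hat v \<xi>)"

lemma picard_measurable [measurable]:
  assumes [measurable]: "A \<in> borel_measurable borel"
  shows "picard (bilinear_term \<nu> \<Omega> \<alpha>) A n \<in> borel_measurable borel"
proof (induction n)
  case (Suc n)
  have [measurable]: "bilinear_term \<nu> \<Omega> \<alpha> (picard (bilinear_term \<nu> \<Omega> \<alpha>) A n) \<in> borel_measurable borel"
    by (intro stationary_op_measurable div_tensor_hat_measurable Suc)
  show ?case by simp
qed simp

lemma div_tensor_hat_zero [simp]: "div_tensor_hat (\<lambda>\<xi>. 0) \<xi> = 0"
  by (simp add: div_tensor_hat_def tensor_hat_def vec_eq_iff)

lemma stationary_op_zero [simp]: "stationary_op \<nu> \<Omega> \<alpha> \<xi> 0 = 0"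
  by (rule linear_0[OF linear_stationary_op])

text \<open>The increment is bounded through a sum with \<open>g n\<close> instead of a difference
  of majorants, as subtraction in \<open>ennreal\<close> is truncated. Both claims share one
  induction: the size bound at n + 1 follows from the increment bound at n and enters the next
  increment bound.\<close>

lemma picard_step:
  fixes \<nu> \<Omega> \<alpha> :: real
  assumes A [measurable]: "A \<in> borel_measurable borel" and \<nu>: "0 < \<nu>"
  defines "U \<equiv> picard (bilinear_term \<nu> \<Omega> \<alpha>) A" and "g \<equiv> majorant (756 / \<nu>) (1 - 2 * \<alpha>) (mag A)"
  shows "(\<forall>\<xi>. mag (\<lambda>\<xi>. U (Suc n) \<xi> - U n \<xi>) \<xi> + g n \<xi> \<le> g (Suc n) \<xi>) \<and> (\<forall>\<xi>. mag (U n) \<xi> \<le> g n \<xi>)"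
proof (induction n)
  case 0
  then show ?case by (simp add: U_def g_def mag_def)
next
  case (Suc n)
  let ?d = "mag (\<lambda>\<xi>. U (Suc n) \<xi> - U n \<xi>)"
  have [measurable]: "U n \<in> borel_measurable borel" "g n \<in> borel_measurable borel" for n
    unfolding U_def g_def by measurable
  have U': "mag (U (Suc n)) \<xi> \<le> g (Suc n) \<xi>" for \<xi>
  proof -
    have "norm (U (Suc n) \<xi>) \<le> norm (U (Suc n) \<xi> - U n \<xi>) + norm (U n \<xi>)" by (metis diff_add_cancel norm_triangle_ineq)
    then have "mag (U (Suc n)) \<xi> \<le> ?d \<xi> + mag (U n) \<xi>"
      by (simp add: mag_def ennreal_leI flip: ennreal_plus)
    also have "\<dots> \<le> ?d \<xi> + g n \<xi>" using Suc by (intro add_left_mono) blast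
    also have "\<dots> \<le> g (Suc n) \<xi>" using Suc by blast
    finally show ?thesis .
  qed
  moreover have "mag (\<lambda>\<xi>. U (Suc (Suc n)) \<xi> - U (Suc n) \<xi>) \<xi> + g (Suc n) \<xi> \<le> g (Suc (Suc n)) \<xi>" for \<xi>
  proof -
    let ?w = "\<lambda>x. ennreal (756 / \<nu>) * (ennreal (norm \<xi> powr (1 - 2 * \<alpha>)) * x)"
    have U2: "U (Suc (Suc n)) \<xi> - U (Suc n) \<xi> = - (bilinear_term \<nu> \<Omega> \<alpha> (U (Suc n)) \<xi> - bilinear_term \<nu> \<Omega> \<alpha> (U n) \<xi>)"
    proof -
      have "U (Suc m) \<xi> = A \<xi> - bilinear_term \<nu> \<Omega> \<alpha> (U m) \<xi>" for m by (simp add: U_def)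
      from this[of "Suc n"] this[of n] show ?thesis by simp
    qed
    have "mag (\<lambda>\<xi>. U (Suc (Suc n)) \<xi> - U (Suc n) \<xi>) \<xi> \<le> ?w (conv ?d (mag (U (Suc n))) \<xi> + conv (mag (U n)) ?d \<xi>)"
      unfolding mag_def[of "\<lambda>\<xi>. U (Suc (Suc n)) \<xi> - U (Suc n) \<xi>"] U2 norm_minus_cancel
      by (rule bilinear_diff_le[OF _ _ \<nu>]) measurable
    then have "mag (\<lambda>\<xi>. U (Suc (Suc n)) \<xi> - U (Suc n) \<xi>) \<xi> + g (Suc n) \<xi>
        \<le> ?w (conv ?d (mag (U (Suc n))) \<xi> + conv (mag (U n)) ?d \<xi>) + (mag A \<xi> + ?w (conv (g n) (g n) \<xi>))"
      unfolding g_def majorant.simps(2) by (rule add_right_mono)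
    also have "\<dots> = mag A \<xi> + ?w (conv ?d (mag (U (Suc n))) \<xi> + conv (mag (U n)) ?d \<xi> + conv (g n) (g n) \<xi>)"
      by (simp only: distrib_left add_ac)
    also have "\<dots> \<le> mag A \<xi> + ?w (conv (g (Suc n)) (g (Suc n)) \<xi>)"
      by (intro add_left_mono mult_left_mono conv_increment_le) (use Suc U' in auto)
    also have "\<dots> = g (Suc (Suc n)) \<xi>" by (simp only: g_def majorant.simps(2))
    finally show ?thesis .
  qed
  ultimately show ?case by blast
qed

text \<open>The first n increments add up to at most the n-th majorant, so a finite supremum gives
  absolute summability and the telescoping series converges.\<close>

lemma picard_convergent:
  assumes A [measurable]: "A \<in> borel_measurable borel" and \<nu>: "0 < \<nu>"
    and fin: "(SUP n. majorant (756 / \<nu>) (1 - 2 * \<alpha>) (mag A) n \<xi>) < \<infinity>"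
  shows "convergent (\<lambda>n. picard (bilinear_term \<nu> \<Omega> \<alpha>) A n \<xi>)"
proof -
  let ?U = "\<lambda>n. picard (bilinear_term \<nu> \<Omega> \<alpha>) A n \<xi>" and ?g = "\<lambda>n. majorant (756 / \<nu>) (1 - 2 * \<alpha>) (mag A) n \<xi>"
  obtain R where R: "0 \<le> R" "(SUP n. ?g n) = ennreal R" using fin by (cases "SUP n. ?g n") auto
  have "ennreal (\<Sum>i<n. norm (?U (Suc i) - ?U i)) \<le> ?g n" for n
  proof (induction n)
    case (Suc n)
    have "ennreal (\<Sum>i<Suc n. norm (?U (Suc i) - ?U i)) = ennreal (norm (?U (Suc n) - ?U n)) + ennreal (\<Sum>i<n. norm (?U (Suc i) - ?U i))"
      unfolding sum.lessThan_Suc by (subst ennreal_plus[symmetric]) (auto intro: sum_nonneg simp: add.commute)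
    also have "\<dots> \<le> ennreal (norm (?U (Suc n) - ?U n)) + ?g n" by (intro add_left_mono Suc)
    also have "\<dots> \<le> ?g (Suc n)"
      using picard_step[OF A \<nu>, of \<Omega> \<alpha> n] unfolding mag_def[of "\<lambda>\<xi>. picard _ A _ \<xi> - picard _ A _ \<xi>"] by blast
    finally show ?case .
  qed simp
  then have "ennreal (\<Sum>i<n. norm (?U (Suc i) - ?U i)) \<le> ennreal R" for n
    unfolding R(2)[symmetric] by (rule SUP_upper2[OF UNIV_I])
  then have "(\<Sum>i<n. norm (?U (Suc i) - ?U i)) \<le> R" for n using R(1) by simp
  then have "summable (\<lambda>i. norm (?U (Suc i) - ?U i))" by (intro summableI_nonneg_bounded) auto
  then have "summable (\<lambda>i. ?U (Suc i) - ?U i)" by (rule summable_norm_cancel)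
  then have "convergent (\<lambda>n. \<Sum>i<n. ?U (Suc i) - ?U i)" unfolding summable_iff_convergent .
  moreover have "(\<lambda>n. \<Sum>i<n. ?U (Suc i) - ?U i) = ?U"
    by (rule ext, subst sum_lessThan_telescope) simp
  ultimately show ?thesis by (simp only:)
qed

text \<open>Dominated convergence in \<open>\<eta>\<close> with the bound
  \<open>G (\<xi> - \<eta>) * G \<eta>\<close>, which is integrable exactly because the convolution
  is finite at this \<xi>. The shifted factor is handled by reflecting null sets.\<close>

lemma tensor_hat_limit:
  assumes [measurable]: "\<And>n. U n \<in> borel_measurable borel" "V \<in> borel_measurable borel" "G \<in> borel_measurable borel"
    and le: "\<And>n \<eta>. mag (U n) \<eta> \<le> G \<eta>" and fin: "AE \<eta> in lborel. G \<eta> < \<infinity>"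
    and lim: "AE \<eta> in lborel. (\<lambda>n. U n \<eta>) \<longlonglongrightarrow> V \<eta>" and conv: "conv G G \<xi> < \<infinity>"
  shows "(\<lambda>n. tensor_hat (U n) \<xi> $ m $ k) \<longlonglongrightarrow> tensor_hat V \<xi> $ m $ k"
proof -
  let ?w = "\<lambda>\<eta>. enn2real (G (\<xi> - \<eta>) * G \<eta>)"
  have fin': "AE \<eta> in lborel. G (\<xi> - \<eta>) * G \<eta> < \<infinity>"
    using fin AE_reflect[OF fin, of \<xi>] by eventually_elim (simp add: ennreal_mult_less_top)
  have "(\<lambda>n. LINT \<eta>|lborel. U n (\<xi> - \<eta>) $ m * U n \<eta> $ k) \<longlonglongrightarrow> (LINT \<eta>|lborel. V (\<xi> - \<eta>) $ m * V \<eta> $ k)"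
  proof (rule integral_dominated_convergence[where w = ?w])
    show "integrable lborel ?w"
    proof (rule integrableI_bounded)
      have "(\<integral>\<^sup>+\<eta>. ennreal (norm (?w \<eta>)) \<partial>lborel) = conv G G \<xi>"
        unfolding conv_def using fin' by (intro nn_integral_cong_AE) (auto elim!: eventually_mono)
      then show "(\<integral>\<^sup>+\<eta>. ennreal (norm (?w \<eta>)) \<partial>lborel) < \<infinity>" using conv by simp
    qed measurable
    show "AE \<eta> in lborel. (\<lambda>n. U n (\<xi> - \<eta>) $ m * U n \<eta> $ k) \<longlonglongrightarrow> V (\<xi> - \<eta>) $ m * V \<eta> $ k"
      using lim AE_reflect[OF lim, of \<xi>] by eventually_elim (intro tendsto_mult tendsto_vec_nth)
    show "AE \<eta> in lborel. norm (U n (\<xi> - \<eta>) $ m * U n \<eta> $ k) \<le> ?w \<eta>" for n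
      using fin'
    proof eventually_elim
      case (elim \<eta>)
      have "norm (U n (\<xi> - \<eta>) $ m * U n \<eta> $ k) \<le> norm (U n (\<xi> - \<eta>)) * norm (U n \<eta>)"
        unfolding norm_mult by (intro mult_mono cmod_component_le norm_ge_zero)
      then have "ennreal (norm (U n (\<xi> - \<eta>) $ m * U n \<eta> $ k)) \<le> mag (U n) (\<xi> - \<eta>) * mag (U n) \<eta>"
        by (simp add: mag_def flip: ennreal_mult)
      also have "\<dots> \<le> G (\<xi> - \<eta>) * G \<eta>" by (intro mult_mono le) auto
      also have "\<dots> = ennreal (?w \<eta>)" using elim by simp
      finally show ?case by simp
    qed
  qed measurable
  then show ?thesis by (simp add: tensor_hat_def)
qed

lemma div_tensor_hat_limit:
  assumes "\<And>m k. (\<lambda>n. tensor_hat (U n) \<xi> $ m $ k) \<longlonglongrightarrow> tensor_hat V \<xi> $ m $ k"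
  shows "(\<lambda>n. div_tensor_hat (U n) \<xi>) \<longlonglongrightarrow> div_tensor_hat V \<xi>"
proof (rule vec_tendstoI)
  show "(\<lambda>n. div_tensor_hat (U n) \<xi> $ m) \<longlonglongrightarrow> div_tensor_hat V \<xi> $ m" for m
    unfolding div_tensor_hat_def vec_lambda_beta by (intro tendsto_sum tendsto_mult tendsto_const assms)
qed

text \<open>The integral in \<open>moderate_growth\<close> is finite and its weight is nowhere
  zero.\<close>

lemma AE_finite_of_besov:
  assumes p: "1 < p" and q: "1 \<le> q" and f [measurable]: "f \<in> borel_measurable borel"
    and fin: "besov s p q f < \<infinity>" and \<beta>: "0 < 3 - enn2real (3 / p) - s"
  shows "AE \<xi> in lborel. f \<xi> < \<infinity>"
proof -
  obtain M :: nat where "(\<integral>\<^sup>+\<xi>. f \<xi> * ennreal (1 / (1 + norm \<xi>) ^ M) \<partial>lborel) < \<infinity>"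
    using moderate_growth[OF p q f fin \<beta>] by blast
  then have "AE \<xi> in lborel. f \<xi> * ennreal (1 / (1 + norm \<xi>) ^ M) \<noteq> \<infinity>"
    by (intro nn_integral_PInf_AE) auto
  then show ?thesis
  proof eventually_elim
    case (elim \<xi>)
    have "0 < (1 + norm \<xi>) ^ M" by (intro zero_less_power add_pos_nonneg) auto
    then have "ennreal (1 / (1 + norm \<xi>) ^ M) \<noteq> 0" by (simp add: ennreal_eq_0_iff not_le)
    then show ?case using elim by (cases "f \<xi> = top") (auto simp: ennreal_top_mult less_top[symmetric])
  qed
qed

section \<open>The fixed point problem for small data\<close>

context
  fixes p q :: ennreal and \<alpha> \<nu> \<Omega> s K :: real
  assumes p: "1 < p" and q: "1 \<le> q" and \<alpha>: "1/2 < \<alpha>" and \<nu>: "0 < \<nu>" and K: "0 < K"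
    and s: "s = 4 - 2 * \<alpha> - enn2real (3 / p)"
    and conv_le: "\<And>f h. f \<in> borel_measurable borel \<Longrightarrow> h \<in> borel_measurable borel \<Longrightarrow>
      besov s p q f < \<infinity> \<Longrightarrow> besov s p q h < \<infinity> \<Longrightarrow>
      besov s p q (\<lambda>\<xi>. ennreal (norm \<xi> powr (1 - 2 * \<alpha>)) * conv f h \<xi>) \<le> ennreal K * (besov s p q f * besov s p q h)"
begin

lemma subcritical: "0 < 3 - enn2real (3 / p) - s"
  using \<alpha> by (simp add: s)

lemma conv_AE_finite:
  assumes [measurable]: "f \<in> borel_measurable borel" and fin: "besov s p q f < \<infinity>"
  shows "AE \<xi> in lborel. conv f f \<xi> < \<infinity>"
proof -
  have "besov s p q (\<lambda>\<xi>. ennreal (norm \<xi> powr (1 - 2 * \<alpha>)) * conv f f \<xi>) < \<infinity>"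
    by (rule le_less_trans[OF conv_le]) (use fin in \<open>auto simp: ennreal_mult_less_top\<close>)
  then have "AE \<xi> in lborel. ennreal (norm \<xi> powr (1 - 2 * \<alpha>)) * conv f f \<xi> < \<infinity>"
    by (intro AE_finite_of_besov[OF p q _ _ subcritical]) auto
  moreover have "AE \<xi> in lborel. \<xi> \<noteq> (0 :: real^3)" by (rule AE_lborel_singleton)
  ultimately show ?thesis
  proof eventually_elim
    case (elim \<xi>)
    then have "ennreal (norm \<xi> powr (1 - 2 * \<alpha>)) \<noteq> 0" by (simp add: ennreal_eq_0_iff not_le)
    then show ?case
      using elim by (cases "conv f f \<xi> = top") (auto simp: ennreal_mult_top less_top[symmetric])
  qed
qed

text \<open>With \<open>k = 756 / \<nu>\<close>, the scalar map
  \<open>\<delta> + k * K * x\<^sup>2\<close> sends the interval from 0 to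
  \<open>2 * \<delta>\<close> into itself as soon as
  \<open>4 * k * K * \<delta> \<le> 1\<close>.\<close>

lemma majorant_besov:
  assumes a [measurable]: "a \<in> borel_measurable borel" and \<delta>: "0 \<le> \<delta>" "besov s p q a \<le> ennreal \<delta>"
    and small: "4 * (756 / \<nu>) * K * \<delta> \<le> 1"
  shows "besov s p q (majorant (756 / \<nu>) (1 - 2 * \<alpha>) a n) \<le> ennreal (2 * \<delta>)"
proof (induction n)
  case 0
  have "besov s p q (\<lambda>\<xi>. 0 * 0) \<le> 0 * besov s p q (\<lambda>\<xi>. 0)" by (intro besov_cmult p q) simp
  then show ?case by simp
next
  case (Suc n)
  let ?g = "majorant (756 / \<nu>) (1 - 2 * \<alpha>) a n"
  have fin: "besov s p q ?g < \<infinity>" using Suc by (rule le_less_trans) simp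
  have "besov s p q (majorant (756 / \<nu>) (1 - 2 * \<alpha>) a (Suc n)) \<le> besov s p q a +
      besov s p q (\<lambda>\<xi>. ennreal (756 / \<nu>) * (ennreal (norm \<xi> powr (1 - 2 * \<alpha>)) * conv ?g ?g \<xi>))"
    unfolding majorant.simps by (intro besov_add p q) measurable
  also have "\<dots> \<le> ennreal \<delta> + ennreal (756 / \<nu>) * (ennreal K * (ennreal (2 * \<delta>) * ennreal (2 * \<delta>)))"
  proof (intro add_mono \<delta>)
    have "besov s p q (\<lambda>\<xi>. ennreal (756 / \<nu>) * (ennreal (norm \<xi> powr (1 - 2 * \<alpha>)) * conv ?g ?g \<xi>))
        \<le> ennreal (756 / \<nu>) * besov s p q (\<lambda>\<xi>. ennreal (norm \<xi> powr (1 - 2 * \<alpha>)) * conv ?g ?g \<xi>)"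
      by (intro besov_cmult p q) measurable
    also have "\<dots> \<le> ennreal (756 / \<nu>) * (ennreal K * (besov s p q ?g * besov s p q ?g))"
      by (intro mult_left_mono conv_le fin) auto
    also have "\<dots> \<le> ennreal (756 / \<nu>) * (ennreal K * (ennreal (2 * \<delta>) * ennreal (2 * \<delta>)))"
      by (intro mult_left_mono mult_mono Suc) auto
    finally show "besov s p q (\<lambda>\<xi>. ennreal (756 / \<nu>) * (ennreal (norm \<xi> powr (1 - 2 * \<alpha>)) * conv ?g ?g \<xi>))
        \<le> ennreal (756 / \<nu>) * (ennreal K * (ennreal (2 * \<delta>) * ennreal (2 * \<delta>)))" .
  qed
  also have "\<dots> = ennreal (\<delta> + (756 / \<nu>) * (K * (2 * \<delta> * (2 * \<delta>))))"
  proof -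
    have "ennreal (756 / \<nu>) * (ennreal K * (ennreal (2 * \<delta>) * ennreal (2 * \<delta>))) = ennreal ((756 / \<nu>) * (K * (2 * \<delta> * (2 * \<delta>))))"
      using \<delta>(1) K \<nu> by (simp only: ennreal_mult[symmetric] mult_nonneg_nonneg zero_le_numeral less_imp_le divide_nonneg_nonneg)
    then show ?thesis using \<delta>(1) K \<nu> by (simp add: ennreal_plus)
  qed
  also have "\<dots> \<le> ennreal (2 * \<delta>)"
  proof (rule ennreal_leI)
    have "(756 / \<nu>) * (K * (2 * \<delta> * (2 * \<delta>))) = (4 * (756 / \<nu>) * K * \<delta>) * \<delta>" by simp
    also have "\<dots> \<le> 1 * \<delta>" by (intro mult_right_mono small \<delta>)
    finally show "\<delta> + (756 / \<nu>) * (K * (2 * \<delta> * (2 * \<delta>))) \<le> 2 * \<delta>" by simp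
  qed
  finally show ?case .
qed

lemma exists_fixed_point:
  assumes A [measurable]: "A \<in> borel_measurable borel" and \<delta>: "0 \<le> \<delta>" "besov s p q (mag A) \<le> ennreal \<delta>"
    and small: "4 * (756 / \<nu>) * K * \<delta> \<le> 1"
  obtains V where "V \<in> borel_measurable borel" "besov s p q (mag V) \<le> ennreal (2 * \<delta>)"
    "AE \<xi> in lborel. V \<xi> = A \<xi> - bilinear_term \<nu> \<Omega> \<alpha> V \<xi>"
proof -
  define U where "U = picard (bilinear_term \<nu> \<Omega> \<alpha>) A"
  define g where "g = majorant (756 / \<nu>) (1 - 2 * \<alpha>) (mag A)"
  define G where "G \<xi> = (SUP n. g n \<xi>)" for \<xi>
  \<comment> \<open>Convergence is known only where the majorant is finite; elsewhere
    \<open>lim\<close> has an unspecified value, and 0 is taken.\<close>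
  define V where "V \<xi> = (if G \<xi> < \<infinity> then lim (\<lambda>n. U n \<xi>) else 0)" for \<xi>
  have [measurable]: "U n \<in> borel_measurable borel" "g n \<in> borel_measurable borel" for n
    unfolding U_def g_def by measurable
  have [measurable]: "G \<in> borel_measurable borel" unfolding G_def by measurable
  have [measurable]: "(\<lambda>\<xi>. lim (\<lambda>n. U n \<xi>)) \<in> borel_measurable borel"
    by (rule borel_measurable_lim_metric) measurable
  have V [measurable]: "V \<in> borel_measurable borel" unfolding V_def by measurable
  have Ule: "mag (U n) \<xi> \<le> G \<xi>" for n \<xi>
    using picard_step[OF A \<nu>, of \<Omega> \<alpha> n] unfolding G_def U_def g_def by (intro SUP_upper2[OF UNIV_I]) blast
  have lim: "(\<lambda>n. U n \<xi>) \<longlonglongrightarrow> V \<xi>" if "G \<xi> < \<infinity>" for \<xi>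
    using picard_convergent[OF A \<nu>, of \<alpha> \<xi> \<Omega>] that
    by (simp add: V_def G_def g_def U_def convergent_LIMSEQ_iff)
  have Vle: "mag V \<xi> \<le> G \<xi>" for \<xi>
  proof (cases "G \<xi> < \<infinity>")
    case True
    then obtain R where R: "0 \<le> R" "G \<xi> = ennreal R" by (cases "G \<xi>") auto
    have "norm (U n \<xi>) \<le> R" for n using Ule[of n \<xi>] R by (simp add: mag_def)
    then have "norm (V \<xi>) \<le> R" using tendsto_norm[OF lim[OF True]] LIMSEQ_le_const2 by blast
    then show ?thesis by (simp add: R mag_def)
  qed (simp add: not_less top_unique)
  have Gb: "besov s p q G \<le> ennreal (2 * \<delta>)"
    unfolding G_def g_def
    by (intro besov_SUP p q majorant_mono majorant_besov \<delta> small) measurable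
  then have Gfin: "besov s p q G < \<infinity>" by (rule le_less_trans) simp
  have GAE: "AE \<xi> in lborel. G \<xi> < \<infinity>"
    by (rule AE_finite_of_besov[OF p q _ Gfin subcritical]) measurable
  have limAE: "AE \<xi> in lborel. (\<lambda>n. U n \<xi>) \<longlonglongrightarrow> V \<xi>"
    using GAE by eventually_elim (rule lim)
  have "AE \<xi> in lborel. conv G G \<xi> < \<infinity>" by (rule conv_AE_finite[OF _ Gfin]) measurable
  then have "AE \<xi> in lborel. V \<xi> = A \<xi> - bilinear_term \<nu> \<Omega> \<alpha> V \<xi>"
    using limAE
  proof eventually_elim
    case (elim \<xi>)
    have "(\<lambda>n. tensor_hat (U n) \<xi> $ m $ k) \<longlonglongrightarrow> tensor_hat V \<xi> $ m $ k" for m k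
      by (rule tensor_hat_limit[OF _ _ _ Ule GAE limAE elim(1)]) measurable
    then have "(\<lambda>n. A \<xi> - bilinear_term \<nu> \<Omega> \<alpha> (U n) \<xi>) \<longlonglongrightarrow> A \<xi> - bilinear_term \<nu> \<Omega> \<alpha> V \<xi>"
      by (intro tendsto_diff tendsto_const bounded_linear.tendsto[OF bounded_linear_stationary_op] div_tensor_hat_limit)
    moreover have "(\<lambda>n. A \<xi> - bilinear_term \<nu> \<Omega> \<alpha> (U n) \<xi>) = (\<lambda>n. U (Suc n) \<xi>)"
      by (simp add: U_def)
    ultimately have "(\<lambda>n. U (Suc n) \<xi>) \<longlonglongrightarrow> A \<xi> - bilinear_term \<nu> \<Omega> \<alpha> V \<xi>" by simp
    then show ?case using LIMSEQ_Suc[OF elim(2)] LIMSEQ_unique by blast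
  qed
  moreover have "besov s p q (mag V) \<le> ennreal (2 * \<delta>)"
    by (rule order_trans[OF besov_mono[OF p q _ Vle] Gb]) measurable
  ultimately show ?thesis using that V by blast
qed

text \<open>The difference of two fixed points satisfies a linear estimate in which each argument of
  the bilinear term contributes \<open>(756 / \<nu>) * K * N\<close>. The total factor is below 1,
  so a finite norm of the difference must be 0.\<close>

lemma fixed_point_unique:
  assumes [measurable]: "V \<in> borel_measurable borel" "W \<in> borel_measurable borel"
    and V: "AE \<xi> in lborel. V \<xi> = A \<xi> - bilinear_term \<nu> \<Omega> \<alpha> V \<xi>" "besov s p q (mag V) \<le> ennreal N"
    and W: "AE \<xi> in lborel. W \<xi> = A \<xi> - bilinear_term \<nu> \<Omega> \<alpha> W \<xi>" "besov s p q (mag W) \<le> ennreal N"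
    and small: "0 \<le> N" "2 * (756 / \<nu>) * K * N < 1"
  shows "AE \<xi> in lborel. V \<xi> = W \<xi>"
proof -
  let ?d = "mag (\<lambda>\<xi>. V \<xi> - W \<xi>)"
  have [measurable]: "?d \<in> borel_measurable borel" by measurable
  have VW: "besov s p q (mag V) < \<infinity>" "besov s p q (mag W) < \<infinity>"
    using V(2) W(2) by (auto intro: le_less_trans)
  \<comment> \<open>Finiteness comes first, since an infinite norm would satisfy the estimate below
    as well.\<close>
  have "besov s p q ?d \<le> besov s p q (\<lambda>\<xi>. mag V \<xi> + mag W \<xi>)"
    by (intro besov_mono p q) (auto simp: mag_def norm_triangle_ineq4 ennreal_leI simp flip: ennreal_plus)
  also have "\<dots> \<le> besov s p q (mag V) + besov s p q (mag W)" by (intro besov_add p q) measurable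
  also have "\<dots> < \<infinity>" using VW by simp
  finally have dfin: "besov s p q ?d < \<infinity>" .
  let ?w = "\<lambda>\<xi>. ennreal (norm \<xi> powr (1 - 2 * \<alpha>))"
  have "AE \<xi> in lborel. ?d \<xi> \<le> ennreal (756 / \<nu>) * (?w \<xi> * conv ?d (mag V) \<xi> + ?w \<xi> * conv (mag W) ?d \<xi>)"
    using V(1) W(1)
  proof eventually_elim
    case (elim \<xi>)
    have "V \<xi> - W \<xi> = - (bilinear_term \<nu> \<Omega> \<alpha> V \<xi> - bilinear_term \<nu> \<Omega> \<alpha> W \<xi>)" by (subst elim(1), subst elim(2)) simp
    then have "?d \<xi> = ennreal (norm (bilinear_term \<nu> \<Omega> \<alpha> V \<xi> - bilinear_term \<nu> \<Omega> \<alpha> W \<xi>))"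
      by (simp only: mag_def norm_minus_cancel)
    also have "\<dots> \<le> ennreal (756 / \<nu>) * (?w \<xi> * (conv ?d (mag V) \<xi> + conv (mag W) ?d \<xi>))"
      by (rule bilinear_diff_le[OF _ _ \<nu>]) measurable
    finally show ?case by (simp only: distrib_left)
  qed
  then have "besov s p q ?d \<le> besov s p q (\<lambda>\<xi>. ennreal (756 / \<nu>) * (?w \<xi> * conv ?d (mag V) \<xi> + ?w \<xi> * conv (mag W) ?d \<xi>))"
    by (intro besov_mono_AE p q) measurable
  also have "\<dots> \<le> ennreal (756 / \<nu>) * besov s p q (\<lambda>\<xi>. ?w \<xi> * conv ?d (mag V) \<xi> + ?w \<xi> * conv (mag W) ?d \<xi>)"
    by (intro besov_cmult p q) measurable
  also have "\<dots> \<le> ennreal (756 / \<nu>) * (besov s p q (\<lambda>\<xi>. ?w \<xi> * conv ?d (mag V) \<xi>) + besov s p q (\<lambda>\<xi>. ?w \<xi> * conv (mag W) ?d \<xi>))"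
    by (intro mult_left_mono besov_add p q) auto
  also have "\<dots> \<le> ennreal (756 / \<nu>) * (ennreal K * (besov s p q ?d * ennreal N) + ennreal K * (ennreal N * besov s p q ?d))"
  proof (intro mult_left_mono add_mono)
    show "besov s p q (\<lambda>\<xi>. ?w \<xi> * conv ?d (mag V) \<xi>) \<le> ennreal K * (besov s p q ?d * ennreal N)"
      by (rule order_trans[OF conv_le[OF _ _ dfin VW(1)]]) (auto intro!: mult_left_mono V)
    show "besov s p q (\<lambda>\<xi>. ?w \<xi> * conv (mag W) ?d \<xi>) \<le> ennreal K * (ennreal N * besov s p q ?d)"
      by (rule order_trans[OF conv_le[OF _ _ VW(2) dfin]]) (auto intro!: mult_left_mono mult_right_mono W)
  qed auto
  finally have le: "besov s p q ?d \<le> ennreal (756 / \<nu>) * (ennreal K * (besov s p q ?d * ennreal N) + ennreal K * (ennreal N * besov s p q ?d))" .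
  obtain x where x: "0 \<le> x" "besov s p q ?d = ennreal x" using dfin by (cases "besov s p q ?d") auto
  have "ennreal (756 / \<nu>) * (ennreal K * (ennreal x * ennreal N) + ennreal K * (ennreal N * ennreal x))
      = ennreal (756 / \<nu> * (K * (x * N) + K * (N * x)))"
  proof -
    have "ennreal a * (ennreal b * (ennreal x * ennreal N) + ennreal b * (ennreal N * ennreal x))
        = ennreal (a * (b * (x * N) + b * (N * x)))" if "0 \<le> a" "0 \<le> b" for a b
    proof -
      have "ennreal b * (ennreal x * ennreal N) = ennreal (b * (x * N))"
        "ennreal b * (ennreal N * ennreal x) = ennreal (b * (N * x))"
        using that x(1) small(1) by (simp_all add: ennreal_mult)
      then have "ennreal b * (ennreal x * ennreal N) + ennreal b * (ennreal N * ennreal x) = ennreal (b * (x * N) + b * (N * x))"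
        using that x(1) small(1) by (subst ennreal_plus) auto
      then show ?thesis using that x(1) small(1) by (simp only: ennreal_mult'[symmetric])
    qed
    then show ?thesis using K \<nu> by simp
  qed
  then have "x \<le> 756 / \<nu> * (K * (x * N) + K * (N * x))" using le x small(1) K \<nu> by simp
  also have "\<dots> = (2 * (756 / \<nu>) * K * N) * x" by (simp add: algebra_simps)
  finally have "x = 0"
    using small(2) x(1) mult_strict_right_mono[OF small(2), of x] by (cases "x = 0") auto
  then have "besov s p q ?d = 0" using x by simp
  then have "AE \<xi> in lborel. ?d \<xi> = 0" by (intro besov_eq_0[OF p q]) measurable
  then show ?thesis by eventually_elim (simp add: mag_def)
qed

end

section \<open>Existence and uniqueness of stationary solutions\<close>

lemma norm_vector_scalar: "norm (c *s (v :: complex^3)) = cmod c * norm v"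
  by (simp add: norm_vec_def vector_scalar_mult_def norm_mult L2_set_right_distrib)

lemma fb_norm_eq:
  "fb_norm \<phi> s p q u = weighted_norm s q
    (\<lambda>j. Lp_norm lborel p (\<lambda>\<xi>. ennreal (cmod (dyadic \<phi> j \<xi>)) * mag (fourier_fun u) \<xi>))"
  by (simp add: fb_norm_def weighted_norm_def norm_vector_scalar mag_def ennreal_mult)

lemma fourier_fun_measurable:
  assumes "u \<in> fourier_besov \<phi> s p q"
  shows "fourier_fun u \<in> borel_measurable borel"
proof (rule vec_measurable)
  fix k
  have "\<exists>g. represents g (fourier_dist (u $ k))" using assms by (simp add: fourier_besov_def)
  from fourier_fun_represents[OF this] show "(\<lambda>\<xi>. fourier_fun u \<xi> $ k) \<in> borel_measurable borel"
    by (simp add: represents_def locally_integrable_def)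
qed

text \<open>The null set in the mild equation may depend on \<open>t\<close>. In one direction the
  times n + 1 suffice, with one common null set, because the decay only asks for times tending to
  infinity. In the other, a vanishing defect solves the equation at every time.\<close>

lemma mild_equation_AE:
  assumes \<nu>: "0 < \<nu>"
  shows "(\<forall>t>0. AE \<xi> in lborel.
        V \<xi> = semigroup_symbol \<nu> \<Omega> \<alpha> t \<xi> *v V \<xi>
          - (LINT \<tau>:{0..t}|lborel. semigroup_symbol \<nu> \<Omega> \<alpha> (t - \<tau>) \<xi> *v (leray_symbol \<xi> *v g \<xi>))
          + (LINT \<tau>:{0..t}|lborel. semigroup_symbol \<nu> \<Omega> \<alpha> \<tau> \<xi> *v (leray_symbol \<xi> *v f \<xi>)))
    \<longleftrightarrow> (AE \<xi> in lborel. V \<xi> = stationary_op \<nu> \<Omega> \<alpha> \<xi> (f \<xi>) - stationary_op \<nu> \<Omega> \<alpha> \<xi> (g \<xi>))"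
    (is "(\<forall>t>0. AE \<xi> in lborel. ?E t \<xi>) \<longleftrightarrow> (AE \<xi> in lborel. ?F \<xi>)")
proof -
  define X where "X \<xi> = V \<xi> - stationary_op \<nu> \<Omega> \<alpha> \<xi> (f \<xi> - g \<xi>)" for \<xi>
  have E: "?E t \<xi> \<longleftrightarrow> X \<xi> = semigroup_symbol \<nu> \<Omega> \<alpha> t \<xi> *v X \<xi>" if "0 < t" "\<xi> \<noteq> 0" for t \<xi>
    unfolding X_def using that by (intro mild_equation_iff \<nu>) auto
  have F: "?F \<xi> \<longleftrightarrow> X \<xi> = 0" for \<xi>
    by (simp add: X_def linear_diff[OF linear_stationary_op])
  have nz: "AE \<xi> in lborel. \<xi> \<noteq> (0 :: real^3)" by (rule AE_lborel_singleton)
  show ?thesis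
  proof
    assume "\<forall>t>0. AE \<xi> in lborel. ?E t \<xi>"
    then have "\<forall>n. AE \<xi> in lborel. ?E (real (Suc n)) \<xi>" by simp
    then have "AE \<xi> in lborel. \<forall>n. ?E (real (Suc n)) \<xi>" unfolding AE_all_countable .
    then show "AE \<xi> in lborel. ?F \<xi>"
      using nz
    proof eventually_elim
      case (elim \<xi>)
      have "X \<xi> = semigroup_symbol \<nu> \<Omega> \<alpha> (real (Suc n)) \<xi> *v X \<xi>" for n
        using elim(1)[rule_format, of n] E[OF _ elim(2), of "real (Suc n)"] by simp
      then have "(\<lambda>n::nat. X \<xi>) \<longlonglongrightarrow> 0"
        using semigroup_decay[OF elim(2) \<nu>, of \<Omega> \<alpha> "X \<xi>"] by simp
      then have "X \<xi> = 0" using LIMSEQ_unique tendsto_const by blast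
      then show ?case using F by blast
    qed
  next
    assume A: "AE \<xi> in lborel. ?F \<xi>"
    show "\<forall>t>0. AE \<xi> in lborel. ?E t \<xi>"
    proof (intro allI impI)
      fix t :: real assume t: "0 < t"
      show "AE \<xi> in lborel. ?E t \<xi>"
        using A nz
      proof eventually_elim
        case (elim \<xi>)
        have "X \<xi> = 0" using F elim(1) by blast
        then show ?case using E[OF t elim(2)] linear_0[OF linear_semigroup] by simp
      qed
    qed
  qed
qed

theorem theorem3p3:
  fixes \<phi> :: "real^3 \<Rightarrow> complex" and p q :: ennreal and \<alpha> \<nu> \<Omega> :: real
  assumes "littlewood_paley \<phi>"
    and "1 < p" and "1 \<le> q"
    and "1/2 < \<alpha>" and "\<alpha> < (5 - enn2real (3 / p)) / 4"
    and "0 < \<nu>"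
  shows "\<exists>C>0::real. \<exists>\<epsilon>>0::real.
    \<forall>F \<in> fourier_besov \<phi> (4 - 4 * \<alpha> - enn2real (3 / p)) p q.
      fb_norm \<phi> (4 - 4 * \<alpha> - enn2real (3 / p)) p q F < ennreal (\<epsilon> * \<nu> / C) \<longrightarrow>
      (\<exists>u. stationary_mild_solution \<phi> p q \<alpha> \<nu> \<Omega> F u \<and>
           fb_norm \<phi> (4 - 2 * \<alpha> - enn2real (3 / p)) p q u \<le> ennreal (2 * \<epsilon>) \<and>
           (\<forall>v. stationary_mild_solution \<phi> p q \<alpha> \<nu> \<Omega> F v \<and>
                fb_norm \<phi> (4 - 2 * \<alpha> - enn2real (3 / p)) p q v \<le> ennreal (2 * \<epsilon>) \<longrightarrow> v = u))"
proof -
  note \<phi> = assms(1) and p = assms(2) and q = assms(3) and \<alpha> = assms(4,5) and \<nu> = assms(6)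
  define s where "s = 4 - 2 * \<alpha> - enn2real (3 / p)"
  define s' where "s' = 4 - 4 * \<alpha> - enn2real (3 / p)"
  have ss': "s' = s + - (2 * \<alpha>)" by (simp add: s_def s'_def)
  have \<beta>: "3 - enn2real (3 / p) - s = 2 * \<alpha> - 1" by (simp add: s_def)
  have sub: "0 < 3 - enn2real (3 / p) - s" using \<alpha> by (simp add: \<beta>)
  \<comment> \<open>The right-hand side exceeds the left by 5 - 4\<alpha> - 3/p, so this is the
    upper bound on \<alpha>.\<close>
  have "3 - enn2real (3 / p) - s < s" using \<alpha> unfolding s_def by (simp add: field_simps)
  then obtain K where K: "0 < K" and K_le: "\<And>f h. f \<in> borel_measurable borel \<Longrightarrow> h \<in> borel_measurable borel \<Longrightarrow>
      besov s p q f < \<infinity> \<Longrightarrow> besov s p q h < \<infinity> \<Longrightarrow>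
      besov s p q (\<lambda>\<xi>. ennreal (norm \<xi> powr - (3 - enn2real (3 / p) - s)) * conv f h \<xi>) \<le> ennreal K * (besov s p q f * besov s p q h)"
    using conv_bound[OF p q sub] by blast
  \<comment> \<open>With \<beta> = 2\<alpha> - 1 the weight in \<open>conv_bound\<close> is the
    weight of the bilinear term.\<close>
  note conv = K_le[unfolded \<beta> minus_diff_eq]
  obtain K1 where K1: "0 < K1" and fb_le: "\<And>f. f \<in> borel_measurable borel \<Longrightarrow>
    weighted_norm s q (\<lambda>j. Lp_norm lborel p (\<lambda>\<xi>. ennreal (cmod (dyadic \<phi> j \<xi>)) * f \<xi>)) \<le> ennreal K1 * besov s p q f"
    using dyadic_norm_le_besov[OF p q \<phi>] by blast
  obtain K2 where K2: "0 < K2" and le_fb: "\<And>f. f \<in> borel_measurable borel \<Longrightarrow>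
    besov s p q f \<le> ennreal K2 * weighted_norm s q (\<lambda>j. Lp_norm lborel p (\<lambda>\<xi>. ennreal (cmod (dyadic \<phi> j \<xi>)) * f \<xi>))"
    using besov_le_dyadic_norm[OF p q \<phi>] by blast
  obtain K3 where K3: "0 < K3" and le_fb': "\<And>f. f \<in> borel_measurable borel \<Longrightarrow>
    besov s' p q f \<le> ennreal K3 * weighted_norm s' q (\<lambda>j. Lp_norm lborel p (\<lambda>\<xi>. ennreal (cmod (dyadic \<phi> j \<xi>)) * f \<xi>))"
    using besov_le_dyadic_norm[OF p q \<phi>] by blast
  define k where "k = 756 / \<nu>"
  \<comment> \<open>84 comes from \<open>stationary_op_bound\<close>, the power of 2 from shifting
    the index by 2\<alpha> in \<open>besov_weight\<close>. With the comparison constants,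
    \<open>C / \<nu>\<close> bounds the linear part between the two Littlewood-Paley norms.\<close>
  define c where "c = 84 * 2 powr \<bar>- (2 * \<alpha>)\<bar>"
  define C where "C = K1 * c * K3"
  \<comment> \<open>The summand \<open>1 / K1\<close> provides for existence in
    \<open>small1\<close>, the summand \<open>K2\<close> for uniqueness in \<open>small2\<close>;
    each left-hand side there is then at most one half.\<close>
  define \<epsilon> where "\<epsilon> = 1 / (8 * k * K * (K2 + 1 / K1))"
  \<comment> \<open>A sharp-annulus norm of at most \<open>2 * \<delta>\<close> becomes a
    Littlewood-Paley norm of at most \<open>2 * \<epsilon>\<close>.\<close>
  define \<delta> where "\<delta> = \<epsilon> / K1"
  have k: "0 < k" and c: "0 < c" using \<nu> by (auto simp: k_def c_def)
  have C: "0 < C" using K1 K3 c by (simp add: C_def)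
  have \<epsilon>: "0 < \<epsilon>" using k K K1 K2 by (simp add: \<epsilon>_def add_pos_pos)
  have half: "k * K * \<epsilon> * (K2 + 1 / K1) = 1 / 8"
  proof -
    define P where "P = k * K * (K2 + 1 / K1)"
    have "0 < P" unfolding P_def using k K K1 K2 by (intro mult_pos_pos add_pos_pos) auto
    moreover have "\<epsilon> = 1 / (8 * P)" by (simp add: \<epsilon>_def P_def mult.assoc)
    moreover have "k * K * \<epsilon> * (K2 + 1 / K1) = P * \<epsilon>" by (simp add: P_def mult_ac)
    ultimately have "0 < P" "k * K * \<epsilon> * (K2 + 1 / K1) = P * (1 / (8 * P))" by simp_all
    then show ?thesis unfolding P_def[symmetric] by simp
  qed
  have pos: "0 \<le> k * K * \<epsilon> * K2" "0 \<le> k * K * \<epsilon> * (1 / K1)" using k K \<epsilon> K1 K2 by auto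
  have small1: "4 * (756 / \<nu>) * K * \<delta> \<le> 1"
  proof -
    have "4 * (756 / \<nu>) * K * \<delta> = 4 * (k * K * \<epsilon> * (1 / K1))" by (simp add: k_def \<delta>_def)
    then show ?thesis using half pos unfolding distrib_left by linarith
  qed
  have small2: "2 * (756 / \<nu>) * K * (K2 * (2 * \<epsilon>)) < 1"
  proof -
    have "2 * (756 / \<nu>) * K * (K2 * (2 * \<epsilon>)) = 4 * (k * K * \<epsilon> * K2)" by (simp add: k_def)
    then show ?thesis using half pos unfolding distrib_left by linarith
  qed
  have \<delta>: "0 \<le> \<delta>" using \<epsilon> K1 by (simp add: \<delta>_def)
  have "\<exists>u. stationary_mild_solution \<phi> p q \<alpha> \<nu> \<Omega> F u \<and> fb_norm \<phi> s p q u \<le> ennreal (2 * \<epsilon>) \<and>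
      (\<forall>v. stationary_mild_solution \<phi> p q \<alpha> \<nu> \<Omega> F v \<and> fb_norm \<phi> s p q v \<le> ennreal (2 * \<epsilon>) \<longrightarrow> v = u)"
    if F: "F \<in> fourier_besov \<phi> s' p q" and Fs: "fb_norm \<phi> s' p q F < ennreal (\<epsilon> * \<nu> / C)" for F
  proof -
    let ?F = "fourier_fun F"
    define A where "A \<xi> = stationary_op \<nu> \<Omega> \<alpha> \<xi> (?F \<xi>)" for \<xi>
    have [measurable]: "?F \<in> borel_measurable borel" by (rule fourier_fun_measurable[OF F])
    have A [measurable]: "A \<in> borel_measurable borel" unfolding A_def by (rule stationary_op_measurable) measurable
    have "besov s p q (mag A) \<le> besov s p q (\<lambda>\<xi>. ennreal (84 / \<nu>) * (ennreal (norm \<xi> powr - (2 * \<alpha>)) * mag ?F \<xi>))"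
    proof (intro besov_mono p q)
      fix \<xi>
      show "mag A \<xi> \<le> ennreal (84 / \<nu>) * (ennreal (norm \<xi> powr - (2 * \<alpha>)) * mag ?F \<xi>)"
      proof -
        have "0 \<le> 84 / \<nu>" using \<nu> by simp
        then have "ennreal (84 / \<nu> * norm \<xi> powr - (2 * \<alpha>) * norm (?F \<xi>)) =
            ennreal (84 / \<nu>) * (ennreal (norm \<xi> powr - (2 * \<alpha>)) * mag ?F \<xi>)"
          unfolding mag_def mult.assoc by (simp only: ennreal_mult' powr_ge_zero)
        then show ?thesis
          using ennreal_leI[OF stationary_op_bound[OF \<nu>, of \<Omega> \<alpha> \<xi> "?F \<xi>"]] by (simp only: mag_def[of A] A_def)
      qed
    qed measurable
    also have "\<dots> \<le> ennreal (84 / \<nu>) * besov s p q (\<lambda>\<xi>. ennreal (norm \<xi> powr - (2 * \<alpha>)) * mag ?F \<xi>)"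
      by (intro besov_cmult p q) measurable
    also have "\<dots> \<le> ennreal (84 / \<nu>) * (ennreal (2 powr \<bar>- (2 * \<alpha>)\<bar>) * besov s' p q (mag ?F))"
      unfolding ss' by (intro mult_left_mono besov_weight p q) auto
    also have "\<dots> \<le> ennreal (84 / \<nu>) * (ennreal (2 powr \<bar>- (2 * \<alpha>)\<bar>) * (ennreal K3 * ennreal (\<epsilon> * \<nu> / C)))"
      using le_fb'[of "mag ?F"] Fs unfolding fb_norm_eq[symmetric]
      by (intro mult_left_mono) (auto intro: order_trans[OF _ mult_left_mono])
    also have "\<dots> = ennreal (84 / \<nu> * (2 powr \<bar>- (2 * \<alpha>)\<bar> * (K3 * (\<epsilon> * \<nu> / C))))"
      using \<nu> K3 \<epsilon> C by (simp only: ennreal_mult[symmetric] mult_nonneg_nonneg divide_nonneg_nonneg less_imp_le zero_le_numeral powr_ge_zero)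
    also have "84 / \<nu> * (2 powr \<bar>- (2 * \<alpha>)\<bar> * (K3 * (\<epsilon> * \<nu> / C))) = \<delta>"
    proof -
      have "84 / \<nu> * (2 powr \<bar>- (2 * \<alpha>)\<bar> * (K3 * (\<epsilon> * \<nu> / C))) = c * K3 * \<epsilon> / C"
        using \<nu> by (simp add: c_def)
      also have "\<dots> = \<delta>" using c K3 K1 by (simp add: C_def \<delta>_def)
      finally show ?thesis .
    qed
    finally have Ab: "besov s p q (mag A) \<le> ennreal \<delta>" .
    obtain V where V [measurable]: "V \<in> borel_measurable borel" and Vb: "besov s p q (mag V) \<le> ennreal (2 * \<delta>)"
      and Veq: "AE \<xi> in lborel. V \<xi> = A \<xi> - bilinear_term \<nu> \<Omega> \<alpha> V \<xi>"
      using exists_fixed_point[OF p q \<alpha>(1) \<nu> K s_def conv A \<delta> Ab small1] by blast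
    have Vfin: "besov s p q (mag V) < \<infinity>" using Vb by (rule le_less_trans) simp
    obtain M :: nat where M: "(\<integral>\<^sup>+\<xi>. mag V \<xi> * ennreal (1 / (1 + norm \<xi>) ^ M) \<partial>lborel) < \<infinity>"
      using moderate_growth[OF p q _ Vfin sub] by auto
    have "\<exists>T. tempered T \<and> represents (\<lambda>\<xi>. V \<xi> $ k) (fourier_dist T)" for k
    proof -
      have "integrable lborel (\<lambda>\<xi>. V \<xi> $ k / of_real ((1 + norm \<xi>) ^ M))"
      proof (rule integrableI_bounded)
        have "(\<integral>\<^sup>+\<xi>. ennreal (norm (V \<xi> $ k / of_real ((1 + norm \<xi>) ^ M))) \<partial>lborel)
            \<le> (\<integral>\<^sup>+\<xi>. mag V \<xi> * ennreal (1 / (1 + norm \<xi>) ^ M) \<partial>lborel)"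
        proof (rule nn_integral_mono)
          fix \<xi> :: "real^3"
          have "0 < (1 + norm \<xi>) ^ M" by (intro zero_less_power add_pos_nonneg) auto
          then have "norm (V \<xi> $ k / of_real ((1 + norm \<xi>) ^ M)) \<le> norm (V \<xi>) * (1 / (1 + norm \<xi>) ^ M)"
            unfolding norm_divide norm_of_real using cmod_component_le[of "V \<xi>" k] by (simp add: divide_right_mono)
          then show "ennreal (norm (V \<xi> $ k / of_real ((1 + norm \<xi>) ^ M))) \<le> mag V \<xi> * ennreal (1 / (1 + norm \<xi>) ^ M)"
            unfolding mag_def by (subst ennreal_mult'[symmetric]) (auto intro: ennreal_leI)
        qed
        then show "(\<integral>\<^sup>+\<xi>. ennreal (norm (V \<xi> $ k / of_real ((1 + norm \<xi>) ^ M))) \<partial>lborel) < \<infinity>"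
          using M by (rule le_less_trans)
      qed measurable
      then show ?thesis
        using tempered_of_fourier_transform[of "\<lambda>\<xi>. V \<xi> $ k" M] component_measurable[OF V] by blast
    qed
    then obtain T where T: "\<And>k. tempered (T k)" "\<And>k. represents (\<lambda>\<xi>. V \<xi> $ k) (fourier_dist (T k))" by metis
    define u where "u = (\<chi> k. T k)"
    have uT: "u $ k = T k" for k by (simp add: u_def)
    \<comment> \<open>The definition of a solution speaks of the representative
      \<open>fourier_fun u\<close> and not of \<open>V\<close>; measurability, norm and equation are
      carried over up to null sets.\<close>
    have uV: "AE \<xi> in lborel. fourier_fun u \<xi> = V \<xi>"
      by (rule fourier_fun_AE_eq) (simp add: uT T)
    have um [measurable]: "fourier_fun u \<in> borel_measurable borel"
    proof (rule vec_measurable)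
      fix k
      have "represents (\<lambda>\<xi>. fourier_fun u \<xi> $ k) (fourier_dist (u $ k))"
        using T(2)[of k] by (intro fourier_fun_represents) (auto simp: uT)
      then show "(\<lambda>\<xi>. fourier_fun u \<xi> $ k) \<in> borel_measurable borel"
        by (simp add: represents_def locally_integrable_def)
    qed
    have ub: "besov s p q (mag (fourier_fun u)) \<le> ennreal (2 * \<delta>)"
      by (rule order_trans[OF besov_mono_AE[OF p q] Vb]) (use uV in \<open>auto simp: mag_def elim!: eventually_mono\<close>)
    have fbu: "fb_norm \<phi> s p q u \<le> ennreal (2 * \<epsilon>)"
    proof -
      have "fb_norm \<phi> s p q u \<le> ennreal K1 * besov s p q (mag (fourier_fun u))"
        unfolding fb_norm_eq by (intro fb_le) measurable
      also have "\<dots> \<le> ennreal K1 * ennreal (2 * \<delta>)" by (intro mult_left_mono ub) simp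
      also have "\<dots> = ennreal (2 * \<epsilon>)" using K1 \<delta> by (simp add: \<delta>_def flip: ennreal_mult)
      finally show ?thesis .
    qed
    have eq_div: "div_tensor_hat (fourier_fun u) \<xi> = div_tensor_hat V \<xi>" for \<xi>
      using tensor_hat_AE_cong[OF uV um V] by (simp add: div_tensor_hat_def)
    have sol: "stationary_mild_solution \<phi> p q \<alpha> \<nu> \<Omega> F u"
      unfolding stationary_mild_solution_def mild_equation_AE[OF \<nu>, of "fourier_fun u" \<Omega> \<alpha> "div_tensor_hat (fourier_fun u)" ?F]
    proof (intro conjI)
      have "fb_norm \<phi> s p q u < \<infinity>" using fbu by (rule le_less_trans) simp
      then show "u \<in> fourier_besov \<phi> (4 - 2 * \<alpha> - enn2real (3 / p)) p q"
        using T unfolding fourier_besov_def s_def mem_Collect_eq uT by blast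
      have "besov s p q (mag (fourier_fun u)) < \<infinity>" using ub by (rule le_less_trans) simp
      then have "AE \<xi> in lborel. conv (mag (fourier_fun u)) (mag (fourier_fun u)) \<xi> < \<infinity>"
        by (intro conv_AE_finite[OF p q \<alpha>(1) \<nu> K s_def conv]) auto
      then show "AE \<xi> in lborel. \<forall>m k. integrable lborel (\<lambda>\<eta>. fourier_fun u (\<xi> - \<eta>) $ m * fourier_fun u \<eta> $ k)"
        by eventually_elim (intro allI tensor_integrable um)
      show "AE \<xi> in lborel. fourier_fun u \<xi> = stationary_op \<nu> \<Omega> \<alpha> \<xi> (?F \<xi>) - stationary_op \<nu> \<Omega> \<alpha> \<xi> (div_tensor_hat (fourier_fun u) \<xi>)"
        using uV Veq by eventually_elim (simp add: eq_div A_def)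
    qed
    have uniq: "v = u" if v: "stationary_mild_solution \<phi> p q \<alpha> \<nu> \<Omega> F v" and vb: "fb_norm \<phi> s p q v \<le> ennreal (2 * \<epsilon>)" for v
    proof -
      have vF: "v \<in> fourier_besov \<phi> s p q" using v by (simp add: stationary_mild_solution_def s_def)
      have uF: "u \<in> fourier_besov \<phi> s p q" using sol by (simp add: stationary_mild_solution_def s_def)
      have eq: "AE \<xi> in lborel. fourier_fun w \<xi> = A \<xi> - bilinear_term \<nu> \<Omega> \<alpha> (fourier_fun w) \<xi>"
        if "stationary_mild_solution \<phi> p q \<alpha> \<nu> \<Omega> F w" for w
        using that unfolding stationary_mild_solution_def A_def
          mild_equation_AE[OF \<nu>, of "fourier_fun w" \<Omega> \<alpha> "div_tensor_hat (fourier_fun w)" ?F] by blast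
      \<comment> \<open>This is applied to \<open>u\<close> as well as to \<open>v\<close>:
        measuring both through the Littlewood-Paley ball gives the common bound that
        \<open>fixed_point_unique\<close> asks for.\<close>
      have bound: "besov s p q (mag (fourier_fun w)) \<le> ennreal (K2 * (2 * \<epsilon>))"
        if w: "w \<in> fourier_besov \<phi> s p q" "fb_norm \<phi> s p q w \<le> ennreal (2 * \<epsilon>)" for w
      proof -
        have "besov s p q (mag (fourier_fun w)) \<le> ennreal K2 * fb_norm \<phi> s p q w"
          unfolding fb_norm_eq by (intro le_fb mag_measurable fourier_fun_measurable[OF w(1)])
        also have "\<dots> \<le> ennreal K2 * ennreal (2 * \<epsilon>)" by (intro mult_left_mono w) simp
        finally show ?thesis using K2 \<epsilon> by (simp add: ennreal_mult)
      qed
      have "AE \<xi> in lborel. fourier_fun v \<xi> = fourier_fun u \<xi>"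
        by (rule fixed_point_unique[OF p q \<alpha>(1) \<nu> K s_def conv fourier_fun_measurable[OF vF] um
              eq[OF v] bound[OF vF vb] eq[OF sol] bound[OF uF fbu] _ small2]) (use K2 \<epsilon> in auto)
      then show ?thesis
        using vF uF unfolding fourier_besov_def by (intro fourier_fun_injective) auto
    qed
    show ?thesis using sol fbu uniq by blast
  qed
  then show ?thesis using C \<epsilon> unfolding s_def s'_def by blast
qed

end
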